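(* Let $\Lambda_{\square}^d$ denote the $d$-dimensional Euclidean grid, i.e. the $2d$-regular Cayley graph of $\mathbb{Z}^d$ with respect to the standard generators (with labels and orientations forgotten). For every $d\geq 3$, there is a finitary $\mathrm{Aut}(\Lambda_{\square}^d)$-factor of iid which is almost surely a Schreier decoration of $\Lambda_{\square}^d$. Moreover, it has almost surely no infinite monochromatic paths.
   Context: **Schreier decoration.** For a simple connected $2d$-regular graph $G$, a Schreier decoration of $G$ is a colouring of the edges with $d$ colours together with an orientation of the edges such that at every vertex there is exactly one incoming and exactly one outgoing edge of each colour. A path is monochromatic if all its edges have the same colour (orientation is ignored). **Factors of iid.** $\mu_G$ is the product measure on $[0,1]^{V(G)}$ with each coordinate Lebesgue. $\mathrm{Aut}(G)$ (the full graph automorphism group) acts on $[0,1]^{V(G)}$ by $(\gamma.f)(v)=f(\gamma^{-1}.v)$ and acts naturally on the measurable space of edge-colourings-with-orientation of $G$. An $\mathrm{Aut}(G)$-factor of iid is a measurable map $\Phi$ from $([0,1]^{V(G)},\mu_G)$ to such a space (possibly undefined on a $\mu_G$-null set) that is $\mathrm{Aut}(G)$-equivariant: $\gamma.\Phi(\omega)=\Phi(\gamma.\omega)$. It is finitary if, for each vertex $x$ and almost all $\omega\in[0,1]^{V(G)}$, there exists $R\in\mathbb{N}$ (depending on $\omega$) such that the restriction of $\Phi(\omega)$ to the edges incident to $x$ is already determined by $\omega|_{B_G(x,R)}$, i.e. changing $\omega$ outside the ball $B_G(x,R)$ does not change the decoration around $x$. *)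

theory Defs
  imports "HOL-Probability.Probability"
begin

text \<open>
  A simple graph on the vertex type \<open>'v\<close> is given by its set \<open>E\<close> of edges, each edge being
  the set of its two endpoints; every element of \<open>'v\<close> is a vertex.
\<close>

definition graph_ball :: "'v set set \<Rightarrow> 'v \<Rightarrow> nat \<Rightarrow> 'v set" where
  "graph_ball E x R = {y. \<exists>n\<le>R. (x, y) \<in> {(u, v). {u, v} \<in> E} ^^ n}"

definition graph_aut :: "'v set set \<Rightarrow> ('v \<Rightarrow> 'v) set" where
  "graph_aut E = {\<gamma>. bij \<gamma> \<and> (\<forall>u v. {\<gamma> u, \<gamma> v} \<in> E \<longleftrightarrow> {u, v} \<in> E)}"

definition grid_edges :: "(int ^ 'n) set set" where
  "grid_edges = {{x, x + axis i 1} | x i. True}"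


text \<open>
  An edge-colouring with \<open>d\<close> colours together with an orientation is a function \<open>D\<close> on \<open>E\<close>:
  \<open>fst (D e)\<close> is the colour of \<open>e\<close>, and \<open>snd (D e)\<close> is the endpoint of \<open>e\<close> towards which
  \<open>e\<close> is oriented.
\<close>

type_synonym 'v decoration = "'v set \<Rightarrow> nat \<times> 'v"

definition decoration_space :: "'v set set \<Rightarrow> nat \<Rightarrow> 'v decoration measure" where
  "decoration_space E d = (\<Pi>\<^sub>M e\<in>E. count_space ({..<d} \<times> e))"

definition schreier_decoration :: "'v set set \<Rightarrow> nat \<Rightarrow> 'v decoration \<Rightarrow> bool" where
  "schreier_decoration E d D \<longleftrightarrow>
     D \<in> (\<Pi>\<^sub>E e\<in>E. {..<d} \<times> e) \<and>
     (\<forall>v. \<forall>c<d.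
        (\<exists>!e. e \<in> E \<and> v \<in> e \<and> fst (D e) = c \<and> snd (D e) = v) \<and>
        (\<exists>!e. e \<in> E \<and> v \<in> e \<and> fst (D e) = c \<and> snd (D e) \<noteq> v))"

text \<open>
  Vertices on a path are distinct, so going round a finite cycle forever does not count.
  A two-sided infinite path contains a one-sided one.
\<close>

definition infinite_monochromatic_path :: "'v set set \<Rightarrow> 'v decoration \<Rightarrow> (nat \<Rightarrow> 'v) \<Rightarrow> bool" where
  "infinite_monochromatic_path E D p \<longleftrightarrow>
     inj p \<and> (\<forall>k. {p k, p (Suc k)} \<in> E) \<and> (\<exists>c. \<forall>k. fst (D {p k, p (Suc k)}) = c)"


definition iid :: "('v \<Rightarrow> real) measure" where
  "iid = (\<Pi>\<^sub>M v\<in>UNIV. restrict_space lborel {0..1})"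

definition act_labels :: "('v \<Rightarrow> 'v) \<Rightarrow> ('v \<Rightarrow> real) \<Rightarrow> 'v \<Rightarrow> real" where
  "act_labels \<gamma> \<omega> = (\<lambda>v. \<omega> (inv \<gamma> v))"

definition act_decoration :: "'v set set \<Rightarrow> ('v \<Rightarrow> 'v) \<Rightarrow> 'v decoration \<Rightarrow> 'v decoration" where
  "act_decoration E \<gamma> D = (\<lambda>e\<in>E. map_prod id \<gamma> (D (inv \<gamma> ` e)))"

text \<open>
  \<open>\<Omega>\<close> is the conull domain of definition of the partial map \<open>\<Phi>\<close>.  Equivariance is an equality of
  partial maps and therefore includes the invariance of \<open>\<Omega>\<close>.
\<close>

definition aut_factor_of_iid ::
    "'v set set \<Rightarrow> nat \<Rightarrow> ('v \<Rightarrow> real) set \<Rightarrow> (('v \<Rightarrow> real) \<Rightarrow> 'v decoration) \<Rightarrow> bool" where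
  "aut_factor_of_iid E d \<Omega> \<Phi> \<longleftrightarrow>
     \<Omega> \<in> sets iid \<and> (AE \<omega> in iid. \<omega> \<in> \<Omega>) \<and>
     \<Phi> \<in> restrict_space iid \<Omega> \<rightarrow>\<^sub>M decoration_space E d \<and>
     (\<forall>\<gamma>\<in>graph_aut E. \<forall>\<omega>\<in>\<Omega>.
        act_labels \<gamma> \<omega> \<in> \<Omega> \<and> act_decoration E \<gamma> (\<Phi> \<omega>) = \<Phi> (act_labels \<gamma> \<omega>))"

definition finitary ::
    "'v set set \<Rightarrow> ('v \<Rightarrow> real) set \<Rightarrow> (('v \<Rightarrow> real) \<Rightarrow> 'v decoration) \<Rightarrow> bool" where
  "finitary E \<Omega> \<Phi> \<longleftrightarrow>
     (\<forall>x. AE \<omega> in iid. \<exists>R. \<forall>\<omega>'\<in>\<Omega>.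
        (\<forall>y\<in>graph_ball E x R. \<omega>' y = \<omega> y) \<longrightarrow> (\<forall>e\<in>E. x \<in> e \<longrightarrow> \<Phi> \<omega>' e = \<Phi> \<omega> e))"

end

theory Submission
  imports Defs "HOL-Combinatorics.Permutations"
begin

text \<open>
  The edges along the axis \<open>i\<close> whose lower end has an even \<open>i\<close>-th coordinate form a perfect matching, and
  so do those whose lower end has an odd one.  Automorphisms permute these \<open>2 * d\<close> classes.  As the grid is
  bipartite, a Schreier decoration is the same as a proper colouring of the edges by the \<open>2 * d\<close> pairs of a
  colour and the parity of the head.  So each bijection from the classes to these pairs is a Schreier
  decoration, called a pattern here.  Two classes along different axes form disjoint unit squares, and
  this is used twice.  If no colour consists of the two classes of one axis, then the components of
  the colours of a pattern are squares (\<open>pattern_colour_components\<close>).  And exchanging the labels of two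
  classes may be done on some squares and not on others.  Since transpositions generate all
  permutations, any two patterns can be interpolated in a layer of bounded width around an arbitrary set
  (\<open>transition_labellings\<close>).

  The patterns need to be placed without violating the symmetry of the grid.  The labels provide marked
  vertices, and at each of these the order of the labels nearby selects a frame, that is, an automorphism
  mapping \<open>0\<close> to that vertex (\<open>frame_unique\<close>).  A piece around a marked vertex is decorated by a fixed
  pattern seen in the frame of that vertex.  The pieces form a toast: any two of them are far
  apart, or one lies deep inside the other (\<open>piece_nested_or_apart\<close>).  Around each piece, a layer
  interpolates between its pattern and the pattern of the next larger piece.  Different layers do not
  interfere, so the result is a Schreier decoration (\<open>schreier_at_decoration\<close>).  An edge is decided
  upon by the smallest piece that contains it, and this depends on finitely many labels.  An infinite
  monochromatic path would leave every piece and cross the zone beyond the layer around it, where the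
  decoration is a pattern, whose colours do not connect over a distance
  (\<open>no_infinite_monochromatic_path\<close>).

  The pieces of level \<open>n\<close> grow out of the Voronoi cells of a sparse set of marked vertices, cut off at a
  large radius and separated by large gaps.  To be compatible with the pieces of lower levels, a cell
  absorbs those near it, those near the absorbed ones, and so on.  This comes to an end because the gaps
  exceed the extent of clusters of lower pieces (\<open>used_chain_short\<close>).  A given vertex is in a cell of
  level \<open>n\<close> with probability tending to \<open>1\<close>, since shells of bounded width are small compared
  to cubes (\<open>prob_no_cell_le\<close>, \<open>ex_radius_density\<close>).  Hence almost surely every vertex is
  covered at infinitely many levels.
\<close>

hide_const (open) Finite_Cartesian_Product.transpose

section \<open>The grid and its automorphisms\<close>

definition sup_dist :: "int ^ 'n::finite \<Rightarrow> int ^ 'n \<Rightarrow> nat" where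
  "sup_dist x y = Max (range (\<lambda>i. nat \<bar>x $ i - y $ i\<bar>))"

lemma sup_dist_le_iff: "sup_dist x y \<le> k \<longleftrightarrow> (\<forall>i. \<bar>x $ i - y $ i\<bar> \<le> int k)"
  by (simp add: sup_dist_def nat_le_iff)

lemma sup_dist_sym: "sup_dist x y = sup_dist y x"
  by (simp add: sup_dist_def abs_minus_commute)

lemma sup_dist_triangle: "sup_dist x z \<le> sup_dist x y + sup_dist y z"
proof (unfold sup_dist_le_iff, intro allI)
  fix i
  have "\<bar>x $ i - y $ i\<bar> \<le> int (sup_dist x y)" "\<bar>y $ i - z $ i\<bar> \<le> int (sup_dist y z)"
    using sup_dist_le_iff by blast+
  then show "\<bar>x $ i - z $ i\<bar> \<le> int (sup_dist x y + sup_dist y z)" by simp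
qed

lemma sup_dist_eq_0 [simp]: "sup_dist x y = 0 \<longleftrightarrow> x = y"
  using sup_dist_le_iff[of x y 0] by (auto simp: vec_eq_iff)

lemma sup_dist_self [simp]: "sup_dist x x = 0"
  by simp

definition cube :: "int ^ 'n::finite \<Rightarrow> nat \<Rightarrow> (int ^ 'n) set" where
  "cube z k = {w. sup_dist z w \<le> k}"

lemma cube_eq_image:
  "cube z k = (\<lambda>f. z + vec_lambda f) ` (PiE UNIV (\<lambda>_. {- int k..int k}))"
proof (intro set_eqI iffI)
  fix w assume "w \<in> cube z k"
  then have "\<bar>z $ i - w $ i\<bar> \<le> int k" for i by (auto simp: cube_def sup_dist_le_iff)
  then have "\<And>i. w $ i - z $ i \<in> {- int k..int k}" by (simp add: abs_le_iff) (smt (verit))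
  then have "($) (w - z) \<in> PiE UNIV (\<lambda>_. {- int k..int k})" by auto
  moreover have "w = z + vec_lambda (($) (w - z))" by (simp add: vec_eq_iff)
  ultimately show "w \<in> (\<lambda>f. z + vec_lambda f) ` (PiE UNIV (\<lambda>_. {- int k..int k}))" by blast
qed (auto simp: cube_def sup_dist_le_iff abs_le_iff PiE_iff minus_le_iff)

lemma finite_cube [simp]: "finite (cube (z :: int ^ 'n::finite) k)"
  unfolding cube_eq_image by (intro finite_imageI finite_PiE) auto

lemma card_cube: "card (cube (z :: int ^ 'n::finite) k) = (2 * k + 1) ^ CARD('n)"
proof -
  have "inj (\<lambda>f. z + vec_lambda f)" by (auto simp: inj_def vec_eq_iff)
  then have "card (cube z k) = card (PiE (UNIV :: 'n set) (\<lambda>_. {- int k..int k}))"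
    unfolding cube_eq_image by (intro card_image) (auto simp: inj_def inj_on_def)
  also have "\<dots> = (\<Prod>i\<in>(UNIV :: 'n set). card {- int k..int k})"
    by (rule card_PiE) simp
  also have "\<dots> = (2 * k + 1) ^ CARD('n)"
    by (simp add: nat_add_distrib nat_mult_distrib)
  finally show ?thesis .
qed

definition nbhd :: "nat \<Rightarrow> (int ^ 'n::finite) set \<Rightarrow> (int ^ 'n) set" where
  "nbhd k K = {z. \<exists>a\<in>K. sup_dist a z \<le> k}"

lemma nbhd_mono: "K \<subseteq> L \<Longrightarrow> k \<le> l \<Longrightarrow> nbhd k K \<subseteq> nbhd l L"
  by (force simp: nbhd_def)

lemma subset_nbhd: "K \<subseteq> nbhd k K"
  by (force simp: nbhd_def)

lemma nbhd_nbhd: "nbhd k (nbhd l K) \<subseteq> nbhd (k + l) K"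
proof
  fix z assume "z \<in> nbhd k (nbhd l K)"
  then obtain a b where "a \<in> K" "sup_dist a b \<le> l" "sup_dist b z \<le> k" by (auto simp: nbhd_def)
  then show "z \<in> nbhd (k + l) K" using sup_dist_triangle[of a z b] by (force simp: nbhd_def)
qed

lemma nbhdI: "a \<in> K \<Longrightarrow> sup_dist a z \<le> k \<Longrightarrow> z \<in> nbhd k K"
  by (auto simp: nbhd_def)

lemma nbhd_step: "w \<in> nbhd k K \<Longrightarrow> sup_dist w z \<le> l \<Longrightarrow> z \<in> nbhd (k + l) K"
  using nbhd_nbhd[of l k K] by (auto simp: add.commute intro: nbhdI)

lemma finite_nbhd: "finite K \<Longrightarrow> finite (nbhd k K)"
proof -
  have "nbhd k K = (\<Union>a\<in>K. cube a k)" by (auto simp: nbhd_def cube_def)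
  then show "finite K \<Longrightarrow> finite (nbhd k K)" by simp
qed

subsection \<open>Edges\<close>

definition edge :: "int ^ 'n::finite \<Rightarrow> 'n \<Rightarrow> (int ^ 'n) set" where
  "edge x i = {x, x + axis i 1}"

lemma axis_one_eq_iff: "axis i (1::int) = axis j 1 \<longleftrightarrow> i = j"
  by (metis axis_nth axis_eq_axis zero_neq_one)

lemma axis_nonneg: "axis i (1::int) $ k \<ge> 0"
  by (simp add: axis_def)

lemma axis_add_neq_0: "axis i (1::int) + axis j 1 \<noteq> (0 :: int ^ 'n::finite)"
proof
  assume "axis i (1::int) + axis j 1 = (0 :: int ^ 'n)"
  then have "(axis i (1::int) + axis j 1 :: int ^ 'n) $ i = 0" by simp
  then show False using axis_nonneg[of j i] by simp
qed

lemma axis_one_neq_0 [simp]: "axis i (1::int) \<noteq> (0 :: int ^ 'n::finite)"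
  by (simp add: axis_eq_0_iff)

lemma edge_eq_iff: "edge x i = edge y j \<longleftrightarrow> x = y \<and> i = j"
proof
  assume "edge x i = edge y j"
  then have *: "x = y \<and> x + axis i 1 = y + axis j 1 \<or> x = y + axis j 1 \<and> x + axis i 1 = y"
    by (simp add: edge_def doubleton_eq_iff)
  have False if "x = y + axis j 1" "x + axis i 1 = y"
  proof -
    have "axis i 1 + axis j 1 = (x + axis i 1 - y) + (axis j 1 + y - x)" by (simp add: algebra_simps)
    also have "\<dots> = 0" using that by (simp add: algebra_simps)
    finally show False using axis_add_neq_0 by metis
  qed
  with * show "x = y \<and> i = j" by (auto simp: axis_one_eq_iff)
qed simp

lemma grid_edges_eq: "grid_edges = {edge x i | x i. True}"
  by (simp add: grid_edges_def edge_def)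

lemma edge_in_grid [simp]: "edge x i \<in> grid_edges"
  by (auto simp: grid_edges_eq)

lemma grid_edgeE:
  assumes "e \<in> grid_edges" obtains x i where "e = edge x i"
  using assms by (auto simp: grid_edges_eq)

lemma mem_edge_iff: "v \<in> edge x i \<longleftrightarrow> x = v \<or> x = v - axis i 1"
  by (auto simp: edge_def)

lemma adj_iff: "{u, v} \<in> grid_edges \<longleftrightarrow> (\<exists>i. v = u + axis i 1 \<or> u = v + axis i 1)"
proof -
  have "{u, v} = edge x i \<longleftrightarrow> (x = u \<and> v = u + axis i 1) \<or> (x = v \<and> u = v + axis i 1)" for x i
    by (auto simp: edge_def doubleton_eq_iff)
  then show ?thesis unfolding grid_edges_eq by blast
qed

lemma sup_dist_axis [simp]: "sup_dist x (x + axis i 1) \<le> 1" "sup_dist (x + axis i 1) x \<le> 1"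
  by (auto simp: sup_dist_le_iff axis_def)

lemma edge_sup_dist: "e \<in> grid_edges \<Longrightarrow> u \<in> e \<Longrightarrow> v \<in> e \<Longrightarrow> sup_dist u v \<le> 1"
  by (auto simp: grid_edges_eq edge_def sup_dist_axis(1)[simplified] sup_dist_axis(2)[simplified])

lemma adj_sup_dist: "{u, v} \<in> grid_edges \<Longrightarrow> sup_dist u v \<le> 1"
  by (rule edge_sup_dist) auto

lemma edge_finite: "e \<in> grid_edges \<Longrightarrow> finite e"
  by (auto simp: grid_edges_eq edge_def)

lemma finite_edges_at: "finite {e \<in> grid_edges. v \<in> e}"
proof -
  have "{e \<in> grid_edges. v \<in> e} \<subseteq> Pow (cube v 1)"
    using edge_sup_dist by (auto simp: cube_def)
  then show ?thesis by (rule finite_subset) simp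
qed

text \<open>Dependence on labels in a sup-norm cube is dependence on labels in a ball of the graph metric.\<close>

lemma grid_connected:
  fixes x y :: "int ^ 'n::finite"
  shows "(x, y) \<in> {(u, v). {u, v} \<in> grid_edges}\<^sup>*"
proof (induction "\<Sum>i\<in>UNIV. nat \<bar>y $ i - x $ i\<bar>" arbitrary: x rule: less_induct)
  case less
  show ?case
  proof (cases "x = y")
    case False
    then obtain i where i: "x $ i \<noteq> y $ i" by (auto simp: vec_eq_iff)
    define x' where "x' = (if x $ i < y $ i then x + axis i 1 else x - axis i 1)"
    have adj: "{x, x'} \<in> grid_edges" unfolding adj_iff x'_def by (auto intro!: exI[of _ i])
    have le: "nat \<bar>y $ k - x' $ k\<bar> \<le> nat \<bar>y $ k - x $ k\<bar>" for k
      using i by (auto simp: x'_def axis_def)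
    have "nat \<bar>y $ i - x' $ i\<bar> < nat \<bar>y $ i - x $ i\<bar>"
      using i by (auto simp: x'_def axis_def)
    with le have "(\<Sum>k\<in>UNIV. nat \<bar>y $ k - x' $ k\<bar>) < (\<Sum>k\<in>UNIV. nat \<bar>y $ k - x $ k\<bar>)"
      by (intro sum_strict_mono_ex1) auto
    from less[OF this] adj show ?thesis by (auto intro: converse_rtrancl_into_rtrancl)
  qed simp
qed

lemma cube_subset_graph_ball:
  obtains R where "cube x k \<subseteq> graph_ball grid_edges x R"
proof -
  have "\<forall>y. \<exists>n. (x, y) \<in> {(u, v). {u, v} \<in> grid_edges} ^^ n"
    using grid_connected rtrancl_imp_relpow by metis
  then obtain n where n: "\<And>y. (x, y) \<in> {(u, v). {u, v} \<in> grid_edges} ^^ n y" by metis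
  have "cube x k \<subseteq> graph_ball grid_edges x (Max (n ` cube x k))"
    using n by (auto simp: graph_ball_def intro!: exI[of _ "n _"])
  with that show ?thesis .
qed

subsection \<open>Automorphisms\<close>

abbreviation grid_aut :: "(int ^ 'n::finite \<Rightarrow> int ^ 'n) set" where
  "grid_aut \<equiv> graph_aut grid_edges"

lemma grid_aut_bij: "g \<in> grid_aut \<Longrightarrow> bij g"
  by (simp add: graph_aut_def)

lemma grid_aut_adj: "g \<in> grid_aut \<Longrightarrow> {g u, g v} \<in> grid_edges \<longleftrightarrow> {u, v} \<in> grid_edges"
  by (simp add: graph_aut_def)

lemma grid_aut_inv_f: "g \<in> grid_aut \<Longrightarrow> inv g (g x) = x"
  by (simp add: bij_is_inj grid_aut_bij)

lemma grid_aut_f_inv: "g \<in> grid_aut \<Longrightarrow> g (inv g x) = x"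
  by (simp add: bij_is_surj grid_aut_bij surj_f_inv_f)

lemma grid_aut_eq_iff: "g \<in> grid_aut \<Longrightarrow> g x = g y \<longleftrightarrow> x = y"
  by (metis grid_aut_inv_f)

lemmas grid_aut_simps = grid_aut_inv_f grid_aut_f_inv grid_aut_eq_iff

lemma mem_image_grid_aut: "g \<in> grid_aut \<Longrightarrow> z \<in> g ` S \<longleftrightarrow> inv g z \<in> S"
  using grid_aut_f_inv[of g z] by (auto simp: grid_aut_inv_f intro: rev_image_eqI)

lemma grid_aut_inv: "g \<in> grid_aut \<Longrightarrow> inv g \<in> grid_aut"
  using bij_imp_bij_inv[of g] grid_aut_adj[of g "inv g _" "inv g _"]
  by (simp add: graph_aut_def bij_is_surj surj_f_inv_f)

lemma grid_aut_comp: "g \<in> grid_aut \<Longrightarrow> h \<in> grid_aut \<Longrightarrow> g \<circ> h \<in> grid_aut"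
  by (simp add: graph_aut_def bij_comp)

lemma inv_comp_grid_aut: "g \<in> grid_aut \<Longrightarrow> h \<in> grid_aut \<Longrightarrow> inv (g \<circ> h) = inv h \<circ> inv g"
  by (simp add: o_inv_distrib grid_aut_bij)

lemma grid_aut_image_edge: "g \<in> grid_aut \<Longrightarrow> g ` e \<in> grid_edges \<longleftrightarrow> e \<in> grid_edges"
proof -
  have *: "g ` e \<in> grid_edges" if g: "g \<in> grid_aut" and "e \<in> grid_edges" for g e
  proof -
    obtain x i where "e = edge x i" using \<open>e \<in> grid_edges\<close> by (rule grid_edgeE)
    with g that(2) show ?thesis using grid_aut_adj[OF g, of x "x + axis i 1"] by (simp add: edge_def)
  qed
  assume g: "g \<in> grid_aut"
  note [simp] = grid_aut_simps[OF g]
  have "inv g ` (g ` e) = e" using g by (simp add: image_image)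
  then show ?thesis using *[OF g] *[OF grid_aut_inv[OF g], of "g ` e"] by auto
qed

definition unit_vec :: "int ^ 'n::finite \<Rightarrow> bool" where
  "unit_vec a \<longleftrightarrow> (\<exists>i. a = axis i 1 \<or> a = - axis i 1)"

lemma adj_unit: "{u, v} \<in> grid_edges \<longleftrightarrow> unit_vec (v - u)"
proof -
  have "v = u + axis i 1 \<longleftrightarrow> v - u = axis i 1" "u = v + axis i 1 \<longleftrightarrow> v - u = - axis i 1" for i
    by (auto simp: algebra_simps)
  then show ?thesis unfolding adj_iff unit_vec_def by simp
qed

lemma unit_vec_nth:
  assumes "unit_vec a" shows "a $ i \<in> {-1, 0, 1}" "a $ i \<noteq> 0 \<Longrightarrow> a = axis i (a $ i)"
  using assms by (auto simp: unit_vec_def axis_def vec_eq_iff)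

lemma unit_vec_nonzero:
  assumes "unit_vec a" obtains i where "a $ i \<noteq> 0"
  using assms by (auto simp: unit_vec_def axis_def)

text \<open>
  The common neighbours of \<open>w + a\<close> and \<open>w + b\<close>, for unit vectors \<open>a \<noteq> b\<close>, are \<open>w\<close> and \<open>w + a + b\<close>.  These coincide
  exactly if \<open>b = - a\<close>, so automorphisms see which neighbours of a vertex are opposite to each other,
  and which vertices complete a square.
\<close>

lemma unit_sum_eq:
  fixes a b c d :: "int ^ 'n::finite"
  assumes "unit_vec a" "unit_vec b" "unit_vec c" "unit_vec d" "a + c = b + d" "a \<noteq> b"
  shows "(d = a \<and> c = b) \<or> (c = - a \<and> d = - b)"
proof -
  obtain i where i: "a $ i \<noteq> 0" using assms(1) by (rule unit_vec_nonzero)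
  have a: "a = axis i (a $ i)" using unit_vec_nth(2)[OF assms(1) i] .
  have eq: "a $ m + c $ m = b $ m + d $ m" for m
    using arg_cong[OF assms(5), of "\<lambda>v. v $ m"] by simp
  have ax: "axis m (- s) = - axis m s" for m :: 'n and s :: int by (simp add: axis_def vec_eq_iff)
  note u = unit_vec_nth[OF assms(1), of i] unit_vec_nth[OF assms(2), of i]
    unit_vec_nth[OF assms(3), of i] unit_vec_nth[OF assms(4), of i]
  have "b $ i \<noteq> a $ i" using a u(4) i assms(6) by metis
  then have "d $ i = a $ i \<or> c $ i = - a $ i" using eq[of i] u(1,3,5,7) i by auto
  then show ?thesis
  proof
    assume d: "d $ i = a $ i"
    then have "d = a" using a u(8) i by metis
    then show ?thesis using assms(5) by simp
  next
    assume c: "c $ i = - a $ i"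
    then have "c = axis i (- a $ i)" using u(6) i by simp
    then have "c = - a" using a ax by (metis c)
    then show ?thesis using assms(5) by (simp add: eq_neg_iff_add_eq_0 add.commute)
  qed
qed

lemma grid_aut_unit:
  assumes "g \<in> grid_aut" "unit_vec a" shows "unit_vec (g (v + a) - g v)"
  using grid_aut_adj[OF assms(1), of v "v + a"] assms(2) by (simp add: adj_unit)

text \<open>If \<open>b \<noteq> a\<close>, then the increments belong to opposite edges of a square, and squares are mapped to squares.
  If \<open>b = a\<close>, they belong to consecutive edges of a line, and opposite neighbours stay opposite.\<close>

lemma grid_aut_parallel:
  assumes g: "g \<in> grid_aut" and a: "unit_vec a" and b: "unit_vec b" and ab: "b \<noteq> - a"
  shows "g (v + b + a) - g (v + b) = g (v + a) - g v"
proof (cases "b = a")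
  case False
  note [simp] = grid_aut_simps[OF g]
  define a' where "a' = g (v + a) - g v"
  define b' where "b' = g (v + b) - g v"
  define c' where "c' = g (v + a + b) - g (v + a)"
  define d' where "d' = g (v + a + b) - g (v + b)"
  have u: "unit_vec a'" "unit_vec b'" "unit_vec c'" "unit_vec d'"
    unfolding a'_def b'_def c'_def d'_def
    using grid_aut_unit[OF g a, of v] grid_aut_unit[OF g b, of v] grid_aut_unit[OF g b, of "v + a"]
      grid_aut_unit[OF g a, of "v + b"] by (simp_all only: add.assoc add.commute[of a b])
  have "a' + c' = b' + d'" "a' \<noteq> b'"
    using False g by (auto simp: a'_def b'_def c'_def d'_def)
  with unit_sum_eq[OF u] have "d' = a' \<or> c' = - a'" by blast
  moreover have "c' \<noteq> - a'"
  proof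
    assume "c' = - a'"
    then have "g (v + a + b) = g v" by (simp add: c'_def a'_def algebra_simps)
    then have "a + b = 0" using g by (simp add: add.assoc)
    with ab show False by (simp add: eq_neg_iff_add_eq_0 add.commute)
  qed
  ultimately show ?thesis by (simp add: a'_def d'_def add_ac)
next
  case True
  note [simp] = grid_aut_simps[OF g]
  \<comment> \<open>The image of \<open>v + a + a\<close> is the neighbour of \<open>g (v + a)\<close> opposite to \<open>g v\<close>; otherwise it
    would have a second common neighbour with \<open>g v\<close>.\<close>
  define d where "d = g (v + a) - g v"
  define c where "c = g (v + a + a) - g (v + a)"
  have u: "unit_vec d" "unit_vec c"
    using grid_aut_unit[OF g a, of v] grid_aut_unit[OF g a, of "v + a"] by (simp_all add: d_def c_def)
  have "c = d"
  proof (rule ccontr)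
    assume "c \<noteq> d"
    define w where "w = inv g (g v + c)"
    have gw: "g w = g v + c" using g by (simp add: w_def)
    have eq: "g (v + a + a) = g v + d + c" by (simp add: c_def d_def)
    have "unit_vec (g w - g v)" "unit_vec (g (v + a + a) - g w)"
      unfolding gw eq using u by simp_all
    then have "unit_vec (w - v)" "unit_vec (v + a + a - w)"
      using grid_aut_adj[OF g] unfolding adj_unit[symmetric] by auto
    moreover have "w - v \<noteq> a"
    proof
      assume "w - v = a"
      then have "w = v + a" by (simp add: algebra_simps)
      with gw have "g (v + a) = g v + c" by simp
      with \<open>c \<noteq> d\<close> show False by (simp add: d_def)
    qed
    ultimately have "(v + a + a - w = a \<and> a = w - v) \<or> (a = - a \<and> v + a + a - w = - (w - v))"
      using unit_sum_eq[of a "w - v" a "v + a + a - w"] a by auto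
    moreover have "a \<noteq> - a"
    proof
      assume "a = - a"
      then have "a $ i = - a $ i" for i by (metis vector_uminus_component)
      then have "a $ i = 0" for i by (metis equal_neg_zero)
      then show False using unit_vec_nonzero[OF a] by metis
    qed
    ultimately show False using \<open>w - v \<noteq> a\<close> by auto
  qed
  then show ?thesis using True by (simp add: c_def d_def)
qed

lemma grid_aut_axis:
  assumes g: "g \<in> grid_aut"
  shows "g (v + axis i 1) - g v = g (axis i 1) - g 0"
proof -
  have step: "g (w + axis i 1) - g w = g (v + axis i 1) - g v" if "{v, w} \<in> grid_edges" for v w
  proof -
    have *: "g (v + axis j 1 + axis i 1) - g (v + axis j 1) = g (v + axis i 1) - g v" for j v
      by (rule grid_aut_parallel[OF g])
        (use axis_add_neq_0[of j i] in \<open>auto simp: unit_vec_def eq_neg_iff_add_eq_0\<close>)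
    from that obtain j where "w = v + axis j 1 \<or> v = w + axis j 1" unfolding adj_iff by blast
    with * show ?thesis by metis
  qed
  from grid_connected[of 0 v] show ?thesis
  proof (induction rule: rtrancl_induct)
    case (step y z)
    then show ?case using \<open>\<And>w v. {v, w} \<in> grid_edges \<Longrightarrow> _\<close>[of y z] by simp
  qed simp
qed

text \<open>The increments along the axes being constant, automorphisms are the signed permutations of
  the coordinates followed by a translation.\<close>

lemma grid_aut_normal_form:
  fixes g :: "int ^ 'n::finite \<Rightarrow> int ^ 'n"
  assumes g: "g \<in> grid_aut"
  obtains \<tau> :: "'n \<Rightarrow> 'n" and \<sigma> :: "'n \<Rightarrow> int" and t
  where "bij \<tau>" "\<And>k. \<sigma> k = 1 \<or> \<sigma> k = -1" "\<And>v k. g v $ k = t $ k + \<sigma> k * v $ \<tau> k"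
proof -
  note [simp] = grid_aut_simps[OF g]
  define \<delta> where "\<delta> i = g (axis i 1) - g 0" for i
  have "unit_vec (\<delta> i)" for i
    unfolding \<delta>_def using grid_aut_unit[OF g, of "axis i 1" 0] by (simp add: unit_vec_def) blast
  then have "\<exists>j s. (s = 1 \<or> s = -1) \<and> \<delta> i = axis j s" for i
    using unit_vec_nonzero unit_vec_nth by (metis insertE singletonD)
  then obtain \<rho> s where s: "\<And>i. s i = 1 \<or> s i = (-1::int)" and \<delta>: "\<And>i. \<delta> i = axis (\<rho> i) (s i)"
    by metis
  have "inj \<rho>"
  proof (rule injI, rule ccontr)
    fix i j assume "\<rho> i = \<rho> j" "i \<noteq> j"
    have "\<delta> i \<noteq> \<delta> j" using g \<open>i \<noteq> j\<close> by (simp add: \<delta>_def axis_one_eq_iff)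
    moreover have "\<delta> i \<noteq> - \<delta> j"
    proof
      assume "\<delta> i = - \<delta> j"
      moreover have "g (axis i 1 + axis j 1) - g (axis i 1) = \<delta> j"
        using grid_aut_axis[OF g, of "axis i 1" j] by (simp add: \<delta>_def)
      ultimately have "g (axis i 1 + axis j 1) = g 0" by (simp add: \<delta>_def algebra_simps)
      then show False using g axis_add_neq_0[of i j] by simp
    qed
    moreover have "s i = s j \<or> s i = - s j" using s[of i] s[of j] by auto
    moreover have "axis (\<rho> j) (- s j) = - axis (\<rho> j) (s j)" by (simp add: axis_def vec_eq_iff)
    ultimately show False using \<open>\<rho> i = \<rho> j\<close> by (auto simp: \<delta>)
  qed
  then have "bij \<rho>" by (simp add: bij_def finite_UNIV_inj_surj)
  have aff: "g v $ k = g 0 $ k + s (inv \<rho> k) * v $ inv \<rho> k" for v k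
    using grid_connected[of 0 v]
  proof (induction rule: rtrancl_induct)
    case (step y z)
    have *: "g (w + axis i 1) $ k = g w $ k + s (inv \<rho> k) * axis i 1 $ inv \<rho> k" for w i
    proof -
      have "g (w + axis i 1) - g w = axis (\<rho> i) (s i)"
        using grid_aut_axis[OF g, of w i] by (simp add: \<delta>[symmetric] \<delta>_def)
      then have "g (w + axis i 1) $ k = g w $ k + axis (\<rho> i) (s i) $ k"
        by (metis add_diff_cancel_left' diff_add_cancel vector_add_component add.commute)
      moreover have "axis (\<rho> i) (s i) $ k = s (inv \<rho> k) * axis i 1 $ inv \<rho> k"
        using \<open>bij \<rho>\<close> by (auto simp: axis_def bij_is_inj bij_is_surj surj_f_inv_f)
      ultimately show ?thesis by simp
    qed
    from step(2) obtain i where "z = y + axis i 1 \<or> y = z + axis i 1"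
      unfolding mem_Collect_eq case_prod_conv adj_iff by blast
    then show ?case using step.IH *[of y i] *[of z i] by (auto simp: algebra_simps)
  qed simp
  show ?thesis
    by (rule that[of "inv \<rho>" "\<lambda>k. s (inv \<rho> k)" "g 0"], rule bij_imp_bij_inv[OF \<open>bij \<rho>\<close>], rule s, rule aff)
qed

lemma sup_dist_grid_aut:
  fixes g :: "int ^ 'n::finite \<Rightarrow> int ^ 'n"
  assumes g: "g \<in> grid_aut" shows "sup_dist (g x) (g y) = sup_dist x y"
proof -
  obtain \<tau> \<sigma> t where n: "bij \<tau>" "\<And>k. \<sigma> k = 1 \<or> \<sigma> k = (-1::int)"
    "\<And>v k. g v $ k = t $ k + \<sigma> k * v $ \<tau> k" by (rule grid_aut_normal_form[OF g]) metis
  have *: "\<bar>g x $ k - g y $ k\<bar> = \<bar>x $ \<tau> k - y $ \<tau> k\<bar>" for k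
    using n(2)[of k] by (auto simp: n(3))
  have "sup_dist (g x) (g y) \<le> k \<longleftrightarrow> sup_dist x y \<le> k" for k
    unfolding sup_dist_le_iff * using \<open>bij \<tau>\<close> by (metis bij_pointE)
  then show ?thesis by (meson order_antisym order_refl)
qed

lemma nbhd_grid_aut: "g \<in> grid_aut \<Longrightarrow> nbhd k (g ` K) = g ` nbhd k K"
proof (intro set_eqI iffI)
  fix z assume g: "g \<in> grid_aut" and "z \<in> nbhd k (g ` K)"
  note [simp] = grid_aut_simps[OF g]
  from \<open>z \<in> nbhd k (g ` K)\<close> obtain a where a: "a \<in> K" "sup_dist (g a) z \<le> k" by (auto simp: nbhd_def)
  have "z = g (inv g z)" using g by simp
  moreover have "inv g z \<in> nbhd k K"
    using a sup_dist_grid_aut[OF g, of a "inv g z"] g by (auto simp: nbhd_def)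
  ultimately show "z \<in> g ` nbhd k K" by blast
qed (auto simp: nbhd_def sup_dist_grid_aut)

lemma grid_aut_eq_if_eq_on_unit_cube:
  fixes g h :: "int ^ 'n::finite \<Rightarrow> int ^ 'n"
  assumes g: "g \<in> grid_aut" and h: "h \<in> grid_aut" and eq: "\<And>u. u \<in> cube 0 1 \<Longrightarrow> g u = h u"
  shows "g = h"
proof
  fix v
  have 0: "g 0 = h 0" by (rule eq) (simp add: cube_def)
  have ax: "g (axis i 1) = h (axis i 1)" for i
    by (rule eq) (use sup_dist_axis(1)[of 0 i] in \<open>simp add: cube_def\<close>)
  from grid_connected[of 0 v] show "g v = h v"
  proof (induction rule: rtrancl_induct)
    case (step y z)
    then obtain i where "z = y + axis i 1 \<or> y = z + axis i 1"
      unfolding mem_Collect_eq case_prod_conv adj_iff by blast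
    moreover have "g (w + axis i 1) - g w = h (w + axis i 1) - h w" for w
      by (simp add: grid_aut_axis[OF g] grid_aut_axis[OF h] 0 ax)
    ultimately show ?case using step.IH by (metis diff_add_cancel diff_left_imp_eq)
  qed (rule 0)
qed

section \<open>Decorations that are constant on the parity classes of edges\<close>

definition even_vertex :: "int ^ 'n::finite \<Rightarrow> bool" where
  "even_vertex v \<longleftrightarrow> even (\<Sum>i\<in>UNIV. v $ i)"

lemma even_vertex_add_axis [simp]: "even_vertex (x + axis i 1) \<longleftrightarrow> \<not> even_vertex x"
proof -
  have "(\<Sum>k\<in>UNIV. (x + axis i 1) $ k) = (\<Sum>k\<in>UNIV. x $ k) + 1"
    by (simp add: sum.distrib axis_def)
  then show ?thesis by (simp add: even_vertex_def)
qed

type_synonym 'n labelling = "'n \<times> bool \<Rightarrow> nat \<times> bool"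

text \<open>The edges \<open>edge x i\<close> with a given parity of \<open>x $ i\<close> form a perfect matching, the class \<open>(i, even (x $ i))\<close>.
  A labelling assigns to each class a colour and the parity of the vertices that its edges point at.
  Prescribing the parity of the head, rather than a direction, makes every labelling consistent: an
  edge has one end of each parity, so it enters one of its ends and leaves the other.\<close>

definition is_labelling :: "'n::finite labelling \<Rightarrow> bool" where
  "is_labelling \<psi> \<longleftrightarrow> bij_betw \<psi> UNIV ({..<CARD('n)} \<times> UNIV)"

lemma is_labellingI:
  fixes \<psi> :: "'n::finite labelling"
  assumes "inj \<psi>" "\<And>i a. fst (\<psi> (i, a)) < CARD('n)" shows "is_labelling \<psi>"
proof -
  have "range \<psi> \<subseteq> {..<CARD('n)} \<times> UNIV"
  proof (rule image_subsetI)
    fix k show "\<psi> k \<in> {..<CARD('n)} \<times> UNIV" by (cases k) (simp add: mem_Times_iff assms(2))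
  qed
  moreover have "card (range \<psi>) = card ({..<CARD('n)} \<times> (UNIV :: bool set))"
    using card_image[OF assms(1)] by (simp add: card_cartesian_product UNIV_Times_UNIV[symmetric] del: UNIV_Times_UNIV)
  ultimately have "range \<psi> = {..<CARD('n)} \<times> UNIV" by (intro card_subset_eq) auto
  with assms(1) show ?thesis by (simp add: is_labelling_def bij_betw_def)
qed

lemma is_labellingD:
  fixes \<psi> :: "'n::finite labelling"
  assumes "is_labelling \<psi>"
  shows "inj \<psi>" "fst (\<psi> (i, a)) < CARD('n)" "c < CARD('n) \<Longrightarrow> \<exists>k. \<psi> k = (c, b)"
proof -
  show "inj \<psi>" using assms by (simp add: is_labelling_def bij_betw_def)
  have r: "range \<psi> = {..<CARD('n)} \<times> UNIV" using assms by (simp add: is_labelling_def bij_betw_def)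
  then show "fst (\<psi> (i, a)) < CARD('n)" by (metis lessThan_iff mem_Times_iff rangeI)
  show "\<exists>k. \<psi> k = (c, b)" if "c < CARD('n)"
    using r that by (metis (no_types, lifting) SigmaI UNIV_I imageE lessThan_iff)
qed

definition pattern :: "'n::finite labelling \<Rightarrow> (int ^ 'n) decoration" where
  "pattern \<psi> e = (THE q. \<exists>x i. e = edge x i \<and> snd q \<in> e \<and>
     \<psi> (i, even (x $ i)) = (fst q, even_vertex (snd q)))"

lemma pattern_eqI:
  assumes "h \<in> edge x i" "\<psi> (i, even (x $ i)) = (c, even_vertex h)"
  shows "pattern \<psi> (edge x i) = (c, h)"
  unfolding pattern_def
proof (rule the_equality)
  show "\<exists>y j. edge x i = edge y j \<and> snd (c, h) \<in> edge x i \<and>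
     \<psi> (j, even (y $ j)) = (fst (c, h), even_vertex (snd (c, h)))"
    using assms by auto
  fix q assume "\<exists>y j. edge x i = edge y j \<and> snd q \<in> edge x i \<and>
     \<psi> (j, even (y $ j)) = (fst q, even_vertex (snd q))"
  then have "snd q \<in> edge x i" "\<psi> (i, even (x $ i)) = (fst q, even_vertex (snd q))"
    by (auto simp: edge_eq_iff)
  with assms show "q = (c, h)" by (cases q) (auto simp: edge_def)
qed

lemma pattern_edge:
  obtains c h where "h \<in> edge x i" "\<psi> (i, even (x $ i)) = (c, even_vertex h)"
    "pattern \<psi> (edge x i) = (c, h)"
proof -
  obtain c b where cb: "\<psi> (i, even (x $ i)) = (c, b)" by fastforce
  define h where "h = (if b = even_vertex x then x else x + axis i 1)"
  have "h \<in> edge x i" "\<psi> (i, even (x $ i)) = (c, even_vertex h)"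
    using cb by (auto simp: h_def edge_def)
  with pattern_eqI that show ?thesis by metis
qed

definition edge_at :: "int ^ 'n::finite \<Rightarrow> 'n \<times> bool \<Rightarrow> (int ^ 'n) set" where
  "edge_at v k = (let i = fst k in if even (v $ i) = snd k then edge v i else edge (v - axis i 1) i)"

lemma edge_at_cases:
  obtains x where "edge_at v (i, a) = edge x i" "even (x $ i) = a" "v \<in> edge x i"
proof (cases "even (v $ i) = a")
  case False
  then have "even ((v - axis i 1) $ i) = a" by auto
  with False that[of "v - axis i 1"] show ?thesis by (simp add: edge_at_def edge_def)
qed (use that[of v] in \<open>simp add: edge_at_def edge_def\<close>)

lemma edge_at_in_grid [simp]: "edge_at v k \<in> grid_edges"
  and mem_edge_at [simp]: "v \<in> edge_at v k"
  by (metis edge_at_cases edge_in_grid surj_pair)+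

lemma edge_at_eq: "v \<in> edge x i \<Longrightarrow> edge_at v (i, even (x $ i)) = edge x i"
  by (auto simp: edge_at_def mem_edge_iff axis_def)

lemma edges_atE:
  assumes "e \<in> grid_edges" "v \<in> e" obtains k where "e = edge_at v k"
  using assms by (metis edge_at_eq grid_edgeE)

lemma pattern_edge_at:
  shows "fst (pattern \<psi> (edge_at v k)) = fst (\<psi> k)"
    and "snd (pattern \<psi> (edge_at v k)) = v \<longleftrightarrow> snd (\<psi> k) = even_vertex v"
    and "snd (pattern \<psi> (edge_at v k)) \<in> edge_at v k"
proof -
  obtain i a where k: "k = (i, a)" by fastforce
  obtain x where x: "edge_at v (i, a) = edge x i" "even (x $ i) = a" "v \<in> edge x i"
    by (rule edge_at_cases)
  obtain c h where h: "h \<in> edge x i" "\<psi> (i, even (x $ i)) = (c, even_vertex h)"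
    "pattern \<psi> (edge x i) = (c, h)" by (rule pattern_edge)
  have "h = v \<longleftrightarrow> even_vertex h = even_vertex v" using h(1) x(3) by (auto simp: edge_def)
  with x h k show "fst (pattern \<psi> (edge_at v k)) = fst (\<psi> k)"
    "snd (pattern \<psi> (edge_at v k)) = v \<longleftrightarrow> snd (\<psi> k) = even_vertex v"
    "snd (pattern \<psi> (edge_at v k)) \<in> edge_at v k"
    by simp_all
qed

text \<open>The condition at a single vertex depends only on the edges there.  So decorations may be glued as long
  as near each vertex the result coincides with one of them.\<close>

definition schreier_at :: "(int ^ 'n::finite) decoration \<Rightarrow> int ^ 'n \<Rightarrow> bool" where
  "schreier_at D v \<longleftrightarrow>
     (\<forall>e\<in>grid_edges. v \<in> e \<longrightarrow> D e \<in> {..<CARD('n)} \<times> e) \<and>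
     (\<forall>c<CARD('n).
        (\<exists>!e. e \<in> grid_edges \<and> v \<in> e \<and> fst (D e) = c \<and> snd (D e) = v) \<and>
        (\<exists>!e. e \<in> grid_edges \<and> v \<in> e \<and> fst (D e) = c \<and> snd (D e) \<noteq> v))"

lemma schreier_at_cong:
  assumes "\<And>e. e \<in> grid_edges \<Longrightarrow> v \<in> e \<Longrightarrow> D e = D' e"
  shows "schreier_at D v \<longleftrightarrow> schreier_at D' v"
proof -
  have "(e \<in> grid_edges \<and> v \<in> e \<and> fst (D e) = c \<and> P (snd (D e))) \<longleftrightarrow>
        (e \<in> grid_edges \<and> v \<in> e \<and> fst (D' e) = c \<and> P (snd (D' e)))" for e c P
    using assms by auto
  note * = this[of _ _ "\<lambda>h. h = v"] this[of _ _ "\<lambda>h. h \<noteq> v"]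
  show ?thesis unfolding schreier_at_def * using assms by simp
qed

lemma schreier_decoration_iff:
  fixes D :: "(int ^ 'n::finite) decoration"
  shows "schreier_decoration grid_edges CARD('n) (restrict D grid_edges) \<longleftrightarrow> (\<forall>v. schreier_at D v)"
proof -
  have D: "(\<forall>e\<in>grid_edges. D e \<in> {..<CARD('n)} \<times> e) \<longleftrightarrow>
     (\<forall>v. \<forall>e\<in>grid_edges. v \<in> e \<longrightarrow> D e \<in> {..<CARD('n)} \<times> e)"
    by (auto simp: grid_edges_eq edge_def)
  have "schreier_at D v \<longleftrightarrow> schreier_at (restrict D grid_edges) v" for v
    by (rule schreier_at_cong) simp
  then show ?thesis
    unfolding schreier_decoration_def restrict_PiE_iff D schreier_at_def all_conj_distrib[symmetric]
    by (simp add: all_conj_distrib)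
qed

lemma schreier_at_pattern:
  fixes \<psi> :: "'n::finite labelling"
  assumes \<psi>: "is_labelling \<psi>" shows "schreier_at (pattern \<psi>) v"
proof -
  have ex1: "\<exists>!e. e \<in> grid_edges \<and> v \<in> e \<and> fst (pattern \<psi> e) = c \<and> (snd (pattern \<psi> e) = v) = b"
    if c: "c < CARD('n)" for c b
  proof -
    obtain k where k: "\<psi> k = (c, even_vertex v = b)" using is_labellingD(3)[OF \<psi> c] by blast
    show ?thesis
    proof (rule ex1I[of _ "edge_at v k"])
      fix e assume e: "e \<in> grid_edges \<and> v \<in> e \<and> fst (pattern \<psi> e) = c \<and> (snd (pattern \<psi> e) = v) = b"
      then obtain k' where k': "e = edge_at v k'" using edges_atE by blast
      with e have "\<psi> k' = (c, even_vertex v = b)"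
        using pattern_edge_at(1,2)[of \<psi> v k'] by (cases "\<psi> k'") auto
      with k is_labellingD(1)[OF \<psi>] k' show "e = edge_at v k" by (metis injD)
    qed (use k in \<open>auto simp: pattern_edge_at\<close>)
  qed
  have "pattern \<psi> e \<in> {..<CARD('n)} \<times> e" if "e \<in> grid_edges" "v \<in> e" for e
  proof -
    obtain k where "e = edge_at v k" using \<open>e \<in> grid_edges\<close> \<open>v \<in> e\<close> by (rule edges_atE)
    then show ?thesis using is_labellingD(2)[OF \<psi>, of "fst k" "snd k"] pattern_edge_at(1,3)[of \<psi> v k]
      by (simp add: mem_Times_iff)
  qed
  then show ?thesis using ex1[where b = True] ex1[where b = False] by (simp add: schreier_at_def)
qed

subsection \<open>Two-coloured squares\<close>

text \<open>The edges of two classes along different axes form disjoint unit squares, whose corners are found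
  by moving the two coordinates within the pairs of integers that the classes join.\<close>

definition pair_eq :: "bool \<Rightarrow> int \<Rightarrow> int \<Rightarrow> bool" where
  "pair_eq a x y \<longleftrightarrow> (x + of_bool (\<not> a)) div 2 = (y + of_bool (\<not> a)) div 2"

lemma pair_eq_Suc: "even x = a \<Longrightarrow> pair_eq a (x + 1) y \<longleftrightarrow> pair_eq a x y"
  unfolding pair_eq_def by (cases a) (auto elim!: evenE oddE)

lemma pair_eq_dist: "pair_eq a x y \<Longrightarrow> \<bar>x - y\<bar> \<le> 1"
  unfolding pair_eq_def by (cases a; simp; presburger)

definition square :: "'n \<times> bool \<Rightarrow> 'n \<times> bool \<Rightarrow> int ^ 'n::finite \<Rightarrow> (int ^ 'n) set" where
  "square k k' v = {z. \<forall>l. if l = fst k then pair_eq (snd k) (z $ l) (v $ l)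
     else if l = fst k' then pair_eq (snd k') (z $ l) (v $ l) else z $ l = v $ l}"

lemma self_in_square [simp]: "v \<in> square k k' v"
  by (simp add: square_def pair_eq_def)

lemma square_subset_cube: "square k k' v \<subseteq> cube v 1"
proof
  fix z assume "z \<in> square k k' v"
  then have "\<bar>z $ l - v $ l\<bar> \<le> 1" for l
    using pair_eq_dist[of _ "z $ l" "v $ l"] by (auto simp: square_def split: if_splits dest!: spec[of _ l])
  then show "z \<in> cube v 1" by (simp add: cube_def sup_dist_le_iff abs_minus_commute)
qed

lemma square_edge:
  assumes "(l, even (x $ l)) \<in> {k, k'}" "fst k \<noteq> fst k'"
  shows "x + axis l 1 \<in> square k k' v \<longleftrightarrow> x \<in> square k k' v"
proof -
  have "(if m = fst k then pair_eq (snd k) ((x + axis l 1) $ m) (v $ m)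
     else if m = fst k' then pair_eq (snd k') ((x + axis l 1) $ m) (v $ m) else (x + axis l 1) $ m = v $ m)
   = (if m = fst k then pair_eq (snd k) (x $ m) (v $ m)
     else if m = fst k' then pair_eq (snd k') (x $ m) (v $ m) else x $ m = v $ m)" for m
    using assms by (cases "m = l") (auto simp: axis_def pair_eq_Suc)
  then show ?thesis by (simp add: square_def)
qed

text \<open>The two classes of one axis together form straight lines, so no colour may consist of them.\<close>

definition no_straight_colour :: "'n::finite labelling \<Rightarrow> bool" where
  "no_straight_colour \<psi> \<longleftrightarrow> (\<forall>i. fst (\<psi> (i, True)) \<noteq> fst (\<psi> (i, False)))"

lemma pattern_colour_components:
  fixes \<psi> :: "'n::finite labelling"
  assumes \<psi>: "is_labelling \<psi>" "no_straight_colour \<psi>"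
  obtains S where "v \<in> S" "S \<subseteq> cube v 1"
    "\<And>e. e \<in> grid_edges \<Longrightarrow> e \<inter> S \<noteq> {} \<Longrightarrow> fst (pattern \<psi> e) = c \<Longrightarrow> e \<subseteq> S"
proof (cases "c < CARD('n)")
  case True
  obtain k k' where k: "\<psi> k = (c, True)" "\<psi> k' = (c, False)"
    using is_labellingD(3)[OF \<psi>(1) True] by metis
  have "fst k \<noteq> fst k'"
  proof
    assume *: "fst k = fst k'"
    have "k \<noteq> k'" using k by auto
    with * have "snd k \<noteq> snd k'" by (simp add: prod_eq_iff)
    with * k \<psi>(2) show False
      by (cases k; cases k'; cases "snd k"; cases "snd k'") (auto simp: no_straight_colour_def dest!: spec[of _ "fst k"])
  qed
  have "e \<subseteq> square k k' v"
    if e: "e \<in> grid_edges" "e \<inter> square k k' v \<noteq> {}" "fst (pattern \<psi> e) = c" for e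
  proof -
    obtain x i where x: "e = edge x i" using e(1) by (rule grid_edgeE)
    have "fst (\<psi> (i, even (x $ i))) = c"
      using e(3) pattern_edge[of x i \<psi>] unfolding x by (metis fst_conv)
    then have "\<psi> (i, even (x $ i)) = \<psi> k \<or> \<psi> (i, even (x $ i)) = \<psi> k'"
      unfolding k by (cases "snd (\<psi> (i, even (x $ i)))") (simp_all add: prod_eq_iff)
    then have "(i, even (x $ i)) \<in> {k, k'}"
      using is_labellingD(1)[OF \<psi>(1)] by (auto dest: injD)
    from square_edge[OF this \<open>fst k \<noteq> fst k'\<close>] e(2) show ?thesis by (auto simp: x edge_def)
  qed
  then show ?thesis using that[of "square k k' v"] square_subset_cube[of k k' v] by auto
next
  case False
  have "fst (pattern \<psi> e) \<noteq> c" if "e \<in> grid_edges" for e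
  proof -
    obtain x i where "e = edge x i" using \<open>e \<in> grid_edges\<close> by (rule grid_edgeE)
    then show ?thesis using is_labellingD(2)[OF \<psi>(1), of i] False pattern_edge[of x i \<psi>] by (metis fst_conv)
  qed
  then show ?thesis using that[of "{v}"] by (auto simp: cube_def)
qed

subsection \<open>Passing from one pattern to another in a bounded layer\<close>

text \<open>One decoration is turned into another across a layer of width \<open>r\<close> around an arbitrary set \<open>K\<close>.  That \<open>r\<close>
  does not depend on \<open>K\<close> is what allows pieces of any shape.\<close>

definition interpolates ::
    "nat \<Rightarrow> (int ^ 'n::finite) set \<Rightarrow> (int ^ 'n) decoration \<Rightarrow> (int ^ 'n) decoration \<Rightarrow> (int ^ 'n) decoration \<Rightarrow> bool" where
  "interpolates r K A B D \<longleftrightarrow> (\<forall>v. schreier_at D v) \<and>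
     (\<forall>e\<in>grid_edges. e \<inter> K \<noteq> {} \<longrightarrow> D e = A e) \<and>
     (\<forall>e\<in>grid_edges. e \<inter> nbhd r K = {} \<longrightarrow> D e = B e)"

definition transition :: "nat \<Rightarrow> (int ^ 'n::finite) decoration \<Rightarrow> (int ^ 'n) decoration \<Rightarrow> bool" where
  "transition r A B \<longleftrightarrow> (\<forall>K. \<exists>D. interpolates r K A B D)"

lemma transition_mono:
  assumes AB: "transition r A B" and "r \<le> r'" shows "transition r' A B"
  unfolding transition_def
proof
  fix K
  obtain D where "interpolates r K A B D"
    using AB[unfolded transition_def, THEN spec[of _ K]] by (rule exE)
  moreover have "e \<inter> nbhd r K = {}" if "e \<inter> nbhd r' K = {}" for e
    using that nbhd_mono[OF order_refl \<open>r \<le> r'\<close>, of K] by auto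
  ultimately have "interpolates r' K A B D" by (simp add: interpolates_def)
  then show "\<exists>D. interpolates r' K A B D" by (rule exI[of _ D])
qed

text \<open>Put the second transition around a neighbourhood of the first: where the two meet, both
  coincide with \<open>B\<close>.\<close>

lemma transition_trans:
  assumes AB: "transition r A B" and BC: "transition s B C"
  shows "transition (r + 1 + s) A C"
  unfolding transition_def
proof
  fix K
  obtain D1 D2 where "interpolates r K A B D1" "interpolates s (nbhd (r + 1) K) B C D2"
    using AB[unfolded transition_def, THEN spec[of _ K]]
      BC[unfolded transition_def, THEN spec[of _ "nbhd (r + 1) K"]] by (elim exE)
  then have D1: "\<And>v. schreier_at D1 v"
      "\<And>e. e \<in> grid_edges \<Longrightarrow> e \<inter> K \<noteq> {} \<Longrightarrow> D1 e = A e"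
      "\<And>e. e \<in> grid_edges \<Longrightarrow> e \<inter> nbhd r K = {} \<Longrightarrow> D1 e = B e"
    and D2: "\<And>v. schreier_at D2 v"
      "\<And>e. e \<in> grid_edges \<Longrightarrow> e \<inter> nbhd (r + 1) K \<noteq> {} \<Longrightarrow> D2 e = B e"
      "\<And>e. e \<in> grid_edges \<Longrightarrow> e \<inter> nbhd s (nbhd (r + 1) K) = {} \<Longrightarrow> D2 e = C e"
    by (simp_all add: interpolates_def)
  define D where "D e = (if e \<inter> nbhd r K \<noteq> {} then D1 e else D2 e)" for e
  have "schreier_at D v" for v
  proof (cases "v \<in> nbhd (r + 1) K")
    case True
    then have "D e = D1 e" if "e \<in> grid_edges" "v \<in> e" for e
      using that D1(3)[of e] D2(2)[of e] by (auto simp: D_def)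
    then show ?thesis using schreier_at_cong[of v D D1] D1(1) by blast
  next
    case False
    have "D e = D2 e" if e: "e \<in> grid_edges" "v \<in> e" for e
    proof -
      have "u \<notin> nbhd r K" if "u \<in> e" for u
        using nbhd_step[of u r K v 1] edge_sup_dist[OF e(1) that e(2)] False by blast
      then show ?thesis by (auto simp: D_def)
    qed
    then show ?thesis using schreier_at_cong[of v D D2] D2(1) by blast
  qed
  moreover have "D e = A e" if "e \<in> grid_edges" "e \<inter> K \<noteq> {}" for e
    using that D1(2) subset_nbhd[of K r] by (auto simp: D_def)
  moreover have "D e = C e" if "e \<in> grid_edges" "e \<inter> nbhd (r + 1 + s) K = {}" for e
  proof -
    have "nbhd r K \<subseteq> nbhd (r + 1 + s) K" by (rule nbhd_mono) auto
    moreover have "nbhd s (nbhd (r + 1) K) \<subseteq> nbhd (r + 1 + s) K"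
      using nbhd_nbhd[of s "r + 1" K] by (simp add: add_ac)
    ultimately show ?thesis using that D2(3)[of e] by (auto simp: D_def disjoint_iff)
  qed
  ultimately show "\<exists>D. interpolates (r + 1 + s) K A C D"
    unfolding interpolates_def by (intro exI[of _ D] conjI allI) simp_all
qed

lemma is_labelling_comp_bij:
  fixes \<psi> :: "'n::finite labelling" and \<pi> :: "'n \<times> bool \<Rightarrow> 'n \<times> bool"
  shows "is_labelling \<psi> \<Longrightarrow> bij \<pi> \<Longrightarrow> is_labelling (\<psi> \<circ> \<pi>)"
  unfolding is_labelling_def by (rule bij_betw_trans[of _ _ UNIV])

text \<open>The two patterns differ only on the squares formed by the two classes.  Each vertex lies on
  exactly one of these squares, so one may choose between the two patterns square by square.\<close>

lemma transition_swap:
  fixes \<psi> :: "'n::finite labelling"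
  assumes \<psi>: "is_labelling \<psi>" and kk': "fst k \<noteq> fst k'"
  shows "transition 1 (pattern \<psi>) (pattern (\<psi> \<circ> transpose k k'))"
  unfolding transition_def
proof
  fix K
  let ?\<psi>' = "\<psi> \<circ> transpose k k'"
  have \<psi>': "is_labelling ?\<psi>'" by (rule is_labelling_comp_bij[OF \<psi>]) simp
  define M where "M = (\<Union>w\<in>K. square k k' w)"
  define D where "D e = (if e \<inter> M \<noteq> {} then pattern \<psi> e else pattern ?\<psi>' e)" for e
  have M_edge: "e \<subseteq> M \<or> e \<inter> M = {}" if "e = edge x l" "(l, even (x $ l)) \<in> {k, k'}" for e x l
    using square_edge[OF that(2) kk'] by (auto simp: M_def that(1) edge_def)
  have same: "pattern \<psi> e = pattern ?\<psi>' e" if "e = edge x l" "(l, even (x $ l)) \<notin> {k, k'}" for e x l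
  proof -
    have "\<psi> (l, even (x $ l)) = ?\<psi>' (l, even (x $ l))" using that(2) by (simp add: Transposition.transpose_def)
    then show ?thesis using pattern_eqI pattern_edge that(1) by metis
  qed
  have "schreier_at D v" for v
  proof (cases "v \<in> M")
    case True
    then have "schreier_at D v \<longleftrightarrow> schreier_at (pattern \<psi>) v"
      by (intro schreier_at_cong) (auto simp: D_def)
    then show ?thesis using schreier_at_pattern[OF \<psi>] by simp
  next
    case False
    have "D e = pattern ?\<psi>' e" if e: "e \<in> grid_edges" "v \<in> e" for e
    proof -
      obtain x l where "e = edge x l" using e(1) by (rule grid_edgeE)
      then show ?thesis using M_edge[of e x l] same[of e x l] False e(2) by (auto simp: D_def)
    qed
    then show ?thesis using schreier_at_cong[of v D] schreier_at_pattern[OF \<psi>'] by blast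
  qed
  moreover have "K \<subseteq> M" by (auto simp: M_def)
  moreover have "M \<subseteq> nbhd 1 K"
    using square_subset_cube[of k k'] by (fastforce simp: M_def cube_def nbhd_def)
  ultimately show "\<exists>D. interpolates 1 K (pattern \<psi>) (pattern ?\<psi>') D"
    unfolding interpolates_def by (intro exI[of _ D]) (auto simp: D_def)
qed

lemma transition_pattern_self: "is_labelling \<psi> \<Longrightarrow> transition 0 (pattern \<psi>) (pattern \<psi>)"
  unfolding transition_def interpolates_def
  by (intro allI exI[of _ "pattern \<psi>"]) (auto intro: schreier_at_pattern)

text \<open>Classes along the same axis form straight lines.  They are exchanged by way of a class along
  another axis.\<close>

lemma transition_transpose:
  fixes \<psi> :: "'n::finite labelling"
  assumes \<psi>: "is_labelling \<psi>" and "CARD('n) \<ge> 2"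
  shows "transition 5 (pattern \<psi>) (pattern (\<psi> \<circ> transpose k k'))"
proof (cases "fst k = fst k'")
  case True
  obtain i :: 'n where i: "i \<noteq> fst k"
  proof (rule ccontr)
    assume "\<not> thesis"
    with that have "(UNIV :: 'n set) = {fst k}" by auto
    then have "CARD('n) = 1" by (metis card_1_singleton_iff One_nat_def)
    with assms(2) show False by simp
  qed
  show ?thesis
  proof (cases "k = k'")
    case False
    define m where "m = (i, True)"
    have m: "m \<noteq> k" "m \<noteq> k'" "fst m \<noteq> fst k" "fst m \<noteq> fst k'"
      using i True by (auto simp: m_def)
    note l1 = is_labelling_comp_bij[OF \<psi> bij_transpose[of k m]]
    note l2 = is_labelling_comp_bij[OF l1 bij_transpose[of m k']]
    have "transition (1 + 1 + 1 + 1 + 1) (pattern \<psi>)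
        (pattern (\<psi> \<circ> transpose k m \<circ> transpose m k' \<circ> transpose k m))"
      by (rule transition_trans[OF transition_trans[OF transition_swap[OF \<psi> m(3)[symmetric]]
            transition_swap[OF l1 m(4)]] transition_swap[OF l2 m(3)[symmetric]]])
    moreover have "\<psi> \<circ> transpose k m \<circ> transpose m k' \<circ> transpose k m = \<psi> \<circ> transpose k k'"
      using m False by (auto simp: fun_eq_iff Transposition.transpose_def)
    ultimately show ?thesis by (simp add: eval_nat_numeral)
  qed (use transition_mono[OF transition_pattern_self[OF \<psi>], of 5] in simp)
qed (rule transition_mono[OF transition_swap[OF \<psi>]], simp_all)

lemma transition_permutation:
  assumes "\<pi> permutes (UNIV :: ('n::finite \<times> bool) set)" and "CARD('n) \<ge> 2"
  shows "\<exists>r. \<forall>\<psi> :: 'n labelling. is_labelling \<psi> \<longrightarrow> transition r (pattern \<psi>) (pattern (\<psi> \<circ> \<pi>))"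
  using assms(1) finite[of UNIV]
proof (induction rule: permutes_induct)
  case id
  show ?case using transition_pattern_self by (auto simp: id_def)
next
  case (swap a b p)
  then obtain r where r: "\<And>\<psi>. is_labelling \<psi> \<Longrightarrow> transition r (pattern \<psi>) (pattern (\<psi> \<circ> p))" by blast
  have "transition (5 + 1 + r) (pattern \<psi>) (pattern (\<psi> \<circ> (transpose a b \<circ> p)))"
    if "is_labelling \<psi>" for \<psi> :: "'n labelling"
    using transition_trans[OF transition_transpose[OF that assms(2)]
        r[OF is_labelling_comp_bij[OF that bij_transpose[of a b]]]]
    by (simp add: comp_assoc)
  then show ?case by blast
qed

text \<open>There are only finitely many permutations of the classes, so a single width serves all of them.\<close>

lemma transition_labellings:
  assumes "CARD('n::finite) \<ge> 2"
  obtains r where "\<And>\<psi> \<psi>' :: 'n labelling. is_labelling \<psi> \<Longrightarrow> is_labelling \<psi>' \<Longrightarrow>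
    transition r (pattern \<psi>) (pattern \<psi>')"
proof -
  let ?P = "{\<pi>. \<pi> permutes (UNIV :: ('n \<times> bool) set)}"
  have "\<forall>\<pi>\<in>?P. \<exists>r. \<forall>\<psi> :: 'n labelling. is_labelling \<psi> \<longrightarrow> transition r (pattern \<psi>) (pattern (\<psi> \<circ> \<pi>))"
    using transition_permutation assms by blast
  then obtain r where r: "\<And>\<pi> \<psi> :: 'n labelling. \<pi> \<in> ?P \<Longrightarrow> is_labelling \<psi> \<Longrightarrow>
      transition (r \<pi>) (pattern \<psi>) (pattern (\<psi> \<circ> \<pi>))"
    by metis
  have "transition (Max (r ` ?P)) (pattern \<psi>) (pattern \<psi>')"
    if \<psi>: "is_labelling \<psi>" "is_labelling \<psi>'" for \<psi> \<psi>' :: "'n labelling"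
  proof -
    define \<pi> where "\<pi> = inv_into UNIV \<psi> \<circ> \<psi>'"
    have "bij_betw \<pi> UNIV UNIV"
      unfolding \<pi>_def using \<psi> by (auto simp: is_labelling_def intro: bij_betw_trans bij_betw_inv_into)
    then have "\<pi> \<in> ?P" by (simp add: bij_imp_permutes permutes_def) (metis bij_pointE)
    moreover have "\<psi> \<circ> \<pi> = \<psi>'"
    proof
      fix k
      have "\<psi>' k \<in> range \<psi>" using \<psi> by (metis is_labelling_def bij_betw_imp_surj_on rangeI)
      then show "(\<psi> \<circ> \<pi>) k = \<psi>' k" by (simp add: \<pi>_def f_inv_into_f)
    qed
    moreover have "finite ?P" by (rule finite_permutations) simp
    ultimately show ?thesis
      using transition_mono[OF r[of \<pi> \<psi>], of "Max (r ` ?P)"] \<psi>(1) by simp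
  qed
  with that show ?thesis .
qed

subsection \<open>Transporting decorations by automorphisms\<close>

definition transport :: "('v \<Rightarrow> 'v) \<Rightarrow> 'v decoration \<Rightarrow> 'v decoration" where
  "transport g D e = map_prod id g (D (inv g ` e))"

lemma transport_image: "g \<in> grid_aut \<Longrightarrow> transport g D (g ` e) = map_prod id g (D e)"
  by (simp add: transport_def image_image grid_aut_simps)

lemma transport_comp:
  "g \<in> grid_aut \<Longrightarrow> h \<in> grid_aut \<Longrightarrow> transport (g \<circ> h) D = transport g (transport h D)"
  by (rule ext) (simp add: transport_def inv_comp_grid_aut image_comp prod.map_comp split: prod.split)

lemma grid_edge_image_inv:
  "g \<in> grid_aut \<Longrightarrow> e \<in> grid_edges \<Longrightarrow> \<exists>e'\<in>grid_edges. e = g ` e'"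
  using grid_aut_image_edge[OF grid_aut_inv, of g e]
  by (intro bexI[of _ "inv g ` e"]) (simp_all add: image_image grid_aut_f_inv)

lemma schreier_at_transport:
  fixes g :: "int ^ 'n::finite \<Rightarrow> int ^ 'n"
  assumes g: "g \<in> grid_aut" and D: "schreier_at D v" shows "schreier_at (transport g D) (g v)"
proof -
  note [simp] = grid_aut_simps[OF g]
  have ex1: "\<exists>!e. e \<in> grid_edges \<and> g v \<in> e \<and> fst (transport g D e) = c \<and> (snd (transport g D e) = g v) = b"
    if "\<exists>!e. e \<in> grid_edges \<and> v \<in> e \<and> fst (D e) = c \<and> (snd (D e) = v) = b" for c b
  proof -
    let ?P = "\<lambda>e. e \<in> grid_edges \<and> v \<in> e \<and> fst (D e) = c \<and> (snd (D e) = v) = b"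
    from that[unfolded Ex1_def] obtain e where e0: "?P e \<and> (\<forall>e'. ?P e' \<longrightarrow> e' = e)" by (rule exE)
    then have e: "?P e" and uniq: "\<And>e'. ?P e' \<Longrightarrow> e' = e" by simp_all
    show ?thesis
    proof (rule ex1I[of _ "g ` e"])
      fix e2 assume e2: "e2 \<in> grid_edges \<and> g v \<in> e2 \<and> fst (transport g D e2) = c \<and>
        (snd (transport g D e2) = g v) = b"
      then obtain e' where e': "e' \<in> grid_edges" "e2 = g ` e'" using grid_edge_image_inv[OF g] by blast
      with e2 g have "e' = e" by (intro uniq) (auto simp: transport_image)
      with e' show "e2 = g ` e" by simp
    qed (use e g in \<open>auto simp: transport_image grid_aut_image_edge\<close>)
  qed
  have "transport g D e \<in> {..<CARD('n)} \<times> e" if "e \<in> grid_edges" "g v \<in> e" for e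
  proof -
    obtain e' where e': "e' \<in> grid_edges" "e = g ` e'" using grid_edge_image_inv[OF g] \<open>e \<in> grid_edges\<close> by blast
    with that(2) g have "v \<in> e'" by auto
    with e' D g show ?thesis by (auto simp: schreier_at_def transport_image mem_Times_iff)
  qed
  then show ?thesis
    using D ex1[where b = True] ex1[where b = False] unfolding schreier_at_def by simp
qed

text \<open>Automorphisms permute the parity classes, and preserve or exchange the two parities of
  vertices; so they act on the patterns through the labellings.\<close>

lemma transport_pattern:
  fixes \<psi> :: "'n::finite labelling"
  assumes g: "g \<in> grid_aut" and \<psi>: "is_labelling \<psi>" "no_straight_colour \<psi>"
  obtains \<psi>' where "is_labelling \<psi>'" "no_straight_colour \<psi>'"
    "\<And>e. e \<in> grid_edges \<Longrightarrow> transport g (pattern \<psi>) e = pattern \<psi>' e"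
proof -
  note [simp] = grid_aut_simps[OF g]
  define f where "f = inv g"
  have f: "f \<in> grid_aut" using grid_aut_inv[OF g] by (simp add: f_def)
  obtain \<tau> \<sigma> t where \<tau>: "bij \<tau>" and \<sigma>: "\<And>k. \<sigma> k = 1 \<or> \<sigma> k = (-1::int)"
    and nf: "\<And>v k. f v $ k = t $ k + \<sigma> k * v $ \<tau> k"
    by (rule grid_aut_normal_form[OF f]) metis
  have \<tau>_inv: "\<tau> (inv \<tau> i) = i" "inv \<tau> (\<tau> i) = i" for i
    using \<tau> by (simp_all add: bij_is_inj bij_is_surj surj_f_inv_f)
  define q where "q k = even (t $ k - (if \<sigma> k = 1 then 0 else 1))" for k
  define p where "p = even_vertex t"
  define \<psi>' where "\<psi>' = (\<lambda>(i, a). map_prod id (\<lambda>b. b = p) (\<psi> (inv \<tau> i, a = q (inv \<tau> i))))"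
  have inj: "inj \<psi>'"
  proof (rule injI, clarsimp simp: \<psi>'_def)
    fix i a j b assume "map_prod id (\<lambda>b. b = p) (\<psi> (inv \<tau> i, a = q (inv \<tau> i))) =
      map_prod id (\<lambda>b. b = p) (\<psi> (inv \<tau> j, b = q (inv \<tau> j)))"
    then have "\<psi> (inv \<tau> i, a = q (inv \<tau> i)) = \<psi> (inv \<tau> j, b = q (inv \<tau> j))"
      by (auto simp: prod_eq_iff map_prod_def split_def)
    then have "(inv \<tau> i, a = q (inv \<tau> i)) = (inv \<tau> j, b = q (inv \<tau> j))"
      using is_labellingD(1)[OF \<psi>(1)] by (rule injD[rotated])
    then have ij: "inv \<tau> i = inv \<tau> j" and "(a = q (inv \<tau> i)) = (b = q (inv \<tau> j))" by auto
    then have "a = b" by auto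
    moreover have "i = j" using arg_cong[OF ij, of \<tau>] by (simp only: \<tau>_inv)
    ultimately show "i = j \<and> a = b" by simp
  qed
  have lab: "is_labelling \<psi>'"
    by (rule is_labellingI[OF inj]) (use is_labellingD(2)[OF \<psi>(1)] in \<open>simp add: \<psi>'_def\<close>)
  have nsc: "no_straight_colour \<psi>'"
    unfolding no_straight_colour_def
  proof
    fix i
    show "fst (\<psi>' (i, True)) \<noteq> fst (\<psi>' (i, False))"
      using \<psi>(2)[unfolded no_straight_colour_def, rule_format, of "inv \<tau> i"]
      by (cases "q (inv \<tau> i)") (simp_all add: \<psi>'_def)
  qed
  have par: "even_vertex (f v) = (even_vertex v = p)" for v
  proof -
    have "even (\<Sum>k\<in>UNIV. \<sigma> k * v $ \<tau> k) = even (\<Sum>k\<in>UNIV. v $ \<tau> k)"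
    proof -
      have "even (\<sigma> k * v $ \<tau> k - v $ \<tau> k)" for k using \<sigma>[of k] by auto
      then have "even (\<Sum>k\<in>UNIV. \<sigma> k * v $ \<tau> k - v $ \<tau> k)" by (intro dvd_sum) auto
      then show ?thesis by (simp add: sum_subtractf)
    qed
    also have "(\<Sum>k\<in>UNIV. v $ \<tau> k) = (\<Sum>k\<in>UNIV. v $ k)"
      using sum.reindex_bij_betw[of \<tau> UNIV UNIV "($) v"] \<tau> by simp
    finally show ?thesis by (auto simp: even_vertex_def nf sum.distrib p_def)
  qed
  have eq: "transport g (pattern \<psi>) e = pattern \<psi>' e" if "e \<in> grid_edges" for e
  proof -
    obtain x i where e: "e = edge x i" using \<open>e \<in> grid_edges\<close> by (rule grid_edgeE)
    define k where "k = inv \<tau> i"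
    have \<tau>k: "\<tau> m = i \<longleftrightarrow> m = k" for m unfolding k_def using \<tau>_inv by metis
    define y where "y = (if \<sigma> k = 1 then f x else f x - axis k 1)"
    have "f (x + axis i 1) = (if \<sigma> k = 1 then f x + axis k 1 else f x - axis k 1)"
      using \<sigma>[of k] by (auto simp: vec_eq_iff nf axis_def \<tau>k distrib_left)
    then have img: "f ` e = edge y k" by (auto simp: e edge_def y_def)
    have cls: "even (y $ k) = (even (x $ i) = q k)"
      using \<sigma>[of k] \<tau>k[of k] by (auto simp: y_def nf q_def)
    obtain c h where h: "h \<in> edge y k" "\<psi> (k, even (y $ k)) = (c, even_vertex h)"
      "pattern \<psi> (edge y k) = (c, h)" by (rule pattern_edge)
    have "h \<in> f ` e" using h(1) img by simp
    then have "g h \<in> e" using g by (auto simp: f_def)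
    have "even_vertex h = (even_vertex (g h) = p)" using par[of "g h"] g by (simp add: f_def)
    then have "\<psi>' (i, even (x $ i)) = (c, even_vertex (g h))"
      using h(2) cls by (auto simp: \<psi>'_def k_def[symmetric])
    then have "pattern \<psi>' e = (c, g h)"
      using pattern_eqI[of "g h" x i \<psi>' c] \<open>g h \<in> e\<close> by (simp add: e)
    then show ?thesis using h(3) img by (simp add: transport_def f_def)
  qed
  show ?thesis by (rule that[OF lab nsc eq])
qed

text \<open>In a cyclic order of the axes, let each colour consist of one class of an axis and one class of the next
  axis.\<close>

lemma ex_labelling_no_straight_colour:
  assumes "CARD('n::finite) \<ge> 2"
  obtains \<psi> :: "'n::finite labelling" where "is_labelling \<psi>" "no_straight_colour \<psi>"
proof -
  let ?d = "CARD('n)"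
  obtain f :: "'n \<Rightarrow> nat" where f: "bij_betw f UNIV {..<?d}"
    using ex_bij_betw_finite_nat[of "UNIV :: 'n set"] by (auto simp: atLeast0LessThan)
  have f_less: "f i < ?d" for i using f by (auto simp: bij_betw_def)
  have f_inj: "f i = f j \<longleftrightarrow> i = j" for i j using f by (auto simp: bij_betw_def inj_def)
  define \<psi> :: "'n labelling" where
    "\<psi> = (\<lambda>(i, a). (if a then Suc (f i) mod ?d else f i, a))"
  have succ: "Suc k mod ?d = (if Suc k = ?d then 0 else Suc k)" if "k < ?d" for k
    using that by auto
  have "\<psi> k = \<psi> k' \<Longrightarrow> k = k'" for k k'
    using f_less[of "fst k"] f_less[of "fst k'"]
    by (cases k; cases k') (auto simp: \<psi>_def f_inj[symmetric] succ split: if_splits)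
  then have "is_labelling \<psi>"
    by (intro is_labellingI injI) (auto simp: \<psi>_def f_less)
  moreover have "no_straight_colour \<psi>"
    using assms f_less by (auto simp: no_straight_colour_def \<psi>_def succ)
  ultimately show ?thesis by (rule that)
qed

subsection \<open>Interpolation between transported patterns\<close>

locale transition_layer =
  fixes \<psi> :: "'n::finite labelling" and r :: nat
  assumes labelling: "is_labelling \<psi>" "no_straight_colour \<psi>"
    and transition: "g \<in> grid_aut \<Longrightarrow> transition r (transport g (pattern \<psi>)) (pattern \<psi>)"
begin

text \<open>A decoration that passes from the pattern in the frame \<open>h\<close> on \<open>K\<close> to the pattern in the frame \<open>g\<close> far
  from \<open>K\<close>.  It is chosen in the coordinates given by \<open>g\<close>, where it depends on \<open>inv g ` K\<close> and \<open>inv g \<circ> h\<close> only.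
  Applying an automorphism to \<open>K\<close>, \<open>h\<close> and \<open>g\<close> does not change these, so an arbitrary choice is
  equivariant.\<close>

definition interpolation ::
    "(int ^ 'n) set \<Rightarrow> (int ^ 'n \<Rightarrow> int ^ 'n) \<Rightarrow> (int ^ 'n \<Rightarrow> int ^ 'n) \<Rightarrow> (int ^ 'n) decoration" where
  "interpolation K h g = transport g
     (SOME D. interpolates r (inv g ` K) (transport (inv g \<circ> h) (pattern \<psi>)) (pattern \<psi>) D)"

lemma interpolation:
  assumes g: "g \<in> grid_aut" and h: "h \<in> grid_aut"
  shows schreier_at_interpolation: "schreier_at (interpolation K h g) v"
    and interpolation_inside: "e \<in> grid_edges \<Longrightarrow> e \<inter> K \<noteq> {} \<Longrightarrow>
      interpolation K h g e = transport h (pattern \<psi>) e"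
    and interpolation_outside: "e \<in> grid_edges \<Longrightarrow> e \<inter> nbhd r K = {} \<Longrightarrow>
      interpolation K h g e = transport g (pattern \<psi>) e"
proof -
  note [simp] = grid_aut_simps[OF g]
  let ?Q = "interpolates r (inv g ` K) (transport (inv g \<circ> h) (pattern \<psi>)) (pattern \<psi>)"
  define D where "D = (SOME D. ?Q D)"
  have int: "interpolation K h g = transport g D" by (simp add: interpolation_def D_def)
  have gi: "inv g \<in> grid_aut" using grid_aut_inv[OF g] .
  have "\<exists>D. ?Q D"
    using transition[OF grid_aut_comp[OF gi h]] unfolding transition_def by (rule spec)
  then have "?Q D" unfolding D_def by (rule someI_ex)
  then have D: "\<And>v. schreier_at D v"
    "\<And>e. e \<in> grid_edges \<Longrightarrow> e \<inter> inv g ` K \<noteq> {} \<Longrightarrow> D e = transport (inv g \<circ> h) (pattern \<psi>) e"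
    "\<And>e. e \<in> grid_edges \<Longrightarrow> e \<inter> nbhd r (inv g ` K) = {} \<Longrightarrow> D e = pattern \<psi> e"
    unfolding interpolates_def by simp_all
  show "schreier_at (interpolation K h g) v"
    using schreier_at_transport[OF g D(1)[of "inv g v"]] g by (simp add: int)
  have e': "inv g ` e \<in> grid_edges" if "e \<in> grid_edges"
    using grid_aut_image_edge[OF gi] that by simp
  have inj: "inj (inv g)" using gi grid_aut_bij bij_is_inj by blast
  show "interpolation K h g e = transport h (pattern \<psi>) e" if "e \<in> grid_edges" "e \<inter> K \<noteq> {}"
  proof -
    have "inv g ` e \<inter> inv g ` K \<noteq> {}" using that(2) by blast
    from D(2)[OF e'[OF that(1)] this]
    have "interpolation K h g e = transport g (transport (inv g \<circ> h) (pattern \<psi>)) e"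
      by (simp add: int transport_def[of g])
    also have "\<dots> = transport (g \<circ> (inv g \<circ> h)) (pattern \<psi>) e"
      by (simp add: transport_comp[OF g grid_aut_comp[OF gi h]])
    also have "g \<circ> (inv g \<circ> h) = h" using g by (simp add: fun_eq_iff)
    finally show ?thesis .
  qed
  show "interpolation K h g e = transport g (pattern \<psi>) e" if "e \<in> grid_edges" "e \<inter> nbhd r K = {}"
  proof -
    have "inv g ` e \<inter> nbhd r (inv g ` K) = {}"
      unfolding nbhd_grid_aut[OF gi] using that(2) inj by (metis image_Int image_is_empty)
    from D(3)[OF e'[OF that(1)] this] show ?thesis by (simp add: int transport_def)
  qed
qed

lemma interpolation_equivariant:
  assumes "\<gamma> \<in> grid_aut" "g \<in> grid_aut" "h \<in> grid_aut"
  shows "interpolation (\<gamma> ` K) (\<gamma> \<circ> h) (\<gamma> \<circ> g) = transport \<gamma> (interpolation K h g)"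
proof -
  have "inv (\<gamma> \<circ> g) ` \<gamma> ` K = inv g ` K" "inv (\<gamma> \<circ> g) \<circ> (\<gamma> \<circ> h) = inv g \<circ> h"
    using assms by (simp_all add: inv_comp_grid_aut image_image fun_eq_iff grid_aut_inv_f)
  then show ?thesis by (simp add: interpolation_def transport_comp assms)
qed

end

lemma ex_transition_layer:
  assumes "CARD('n::finite) \<ge> 2"
  obtains \<psi> :: "'n::finite labelling" and r where "transition_layer \<psi> r"
proof -
  obtain \<psi> :: "'n labelling" where \<psi>: "is_labelling \<psi>" "no_straight_colour \<psi>"
    using assms by (rule ex_labelling_no_straight_colour)
  obtain r where r: "\<And>\<psi> \<psi>' :: 'n labelling. is_labelling \<psi> \<Longrightarrow> is_labelling \<psi>' \<Longrightarrow>
    transition r (pattern \<psi>) (pattern \<psi>')"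
    using transition_labellings[where 'n = 'n] assms by blast
  have "transition r (transport g (pattern \<psi>)) (pattern \<psi>)" if g: "g \<in> grid_aut" for g
  proof -
    obtain \<psi>' where \<psi>': "is_labelling \<psi>'" "\<And>e. e \<in> grid_edges \<Longrightarrow> transport g (pattern \<psi>) e = pattern \<psi>' e"
      using transport_pattern[OF g \<psi>] by metis
    show ?thesis using r[OF \<psi>'(1) \<psi>(1)] \<psi>'(2) by (simp add: transition_def interpolates_def)
  qed
  with \<psi> have "transition_layer \<psi> r" by unfold_locales
  then show ?thesis by (rule that)
qed

section \<open>Frames\<close>

text \<open>Distinct labels near \<open>y\<close> single out an automorphism mapping \<open>0\<close> to \<open>y\<close>: among all of these,
  take the one for which the order of the labels, pulled back to the unit cube around \<open>0\<close>, is a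
  fixed representative of those that occur.\<close>

definition order_pattern :: "(int ^ 'n::finite \<Rightarrow> real) \<Rightarrow> (int ^ 'n \<Rightarrow> int ^ 'n) \<Rightarrow> ((int ^ 'n) \<times> (int ^ 'n)) set" where
  "order_pattern \<omega> g = {(u, v). u \<in> cube 0 1 \<and> v \<in> cube 0 1 \<and> \<omega> (g u) < \<omega> (g v)}"

definition is_frame :: "(int ^ 'n::finite \<Rightarrow> real) \<Rightarrow> int ^ 'n \<Rightarrow> (int ^ 'n \<Rightarrow> int ^ 'n) \<Rightarrow> bool" where
  "is_frame \<omega> y g \<longleftrightarrow> g \<in> grid_aut \<and> g 0 = y \<and>
     order_pattern \<omega> g = (SOME \<rho>. \<exists>h. h \<in> grid_aut \<and> h 0 = y \<and> order_pattern \<omega> h = \<rho>)"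

definition frame :: "(int ^ 'n::finite \<Rightarrow> real) \<Rightarrow> int ^ 'n \<Rightarrow> int ^ 'n \<Rightarrow> int ^ 'n" where
  "frame \<omega> y = (THE g. is_frame \<omega> y g)"

lemma translation_grid_aut: "(\<lambda>x. x + y) \<in> grid_aut"
proof -
  have "bij (\<lambda>x. x + y)" by (rule bij_betw_byWitness[of _ "\<lambda>x. x - y"]) auto
  then show ?thesis by (simp add: graph_aut_def adj_unit)
qed

text \<open>The permutation preserves the number of smaller elements.\<close>

lemma order_preserving_permutation_id:
  fixes f :: "'a \<Rightarrow> real"
  assumes "finite B" "inj_on f B" "h ` B = B" "inj_on h B"
    and mono: "\<And>u v. u \<in> B \<Longrightarrow> v \<in> B \<Longrightarrow> f (h u) < f (h v) \<longleftrightarrow> f u < f v" and "x \<in> B"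
  shows "h x = x"
proof -
  define lower where "lower x = {u \<in> B. f u < f x}" for x
  have hx: "h x \<in> B" using assms(3,6) by blast
  have "lower (h x) = h ` lower x"
  proof (intro set_eqI iffI)
    fix w assume "w \<in> lower (h x)"
    then have w: "w \<in> B" "f w < f (h x)" by (auto simp: lower_def)
    then obtain u where "u \<in> B" "w = h u" using assms(3) by blast
    with w mono[of u x] \<open>x \<in> B\<close> show "w \<in> h ` lower x" by (auto simp: lower_def)
  qed (use assms(3) mono \<open>x \<in> B\<close> in \<open>auto simp: lower_def\<close>)
  moreover have "inj_on h (lower x)" by (rule inj_on_subset[OF assms(4)]) (auto simp: lower_def)
  ultimately have card: "card (lower (h x)) = card (lower x)" by (simp add: card_image)
  have less: "card (lower u) < card (lower v)" if "u \<in> B" "v \<in> B" "f u < f v" for u v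
  proof (rule psubset_card_mono)
    show "finite (lower v)" using assms(1) by (simp add: lower_def)
    show "lower u \<subset> lower v" using that by (auto simp: lower_def)
  qed
  have "f (h x) = f x"
    using less[OF hx \<open>x \<in> B\<close>] less[OF \<open>x \<in> B\<close> hx] card by (cases "f (h x)" "f x" rule: linorder_cases) auto
  then show ?thesis using assms(2) hx \<open>x \<in> B\<close> by (simp add: inj_on_eq_iff)
qed

text \<open>Two frames at \<open>y\<close> differ by an automorphism that fixes \<open>0\<close> and preserves the order of the labels on the
  unit cube.  It therefore fixes the cube pointwise and is the identity.\<close>

lemma frame_unique:
  fixes \<omega> :: "int ^ 'n::finite \<Rightarrow> real"
  assumes "inj \<omega>" shows "is_frame \<omega> y (frame \<omega> y)" "is_frame \<omega> y g \<Longrightarrow> g = frame \<omega> y"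
proof -
  have "\<exists>\<rho> h. h \<in> grid_aut \<and> h 0 = y \<and> order_pattern \<omega> h = \<rho>"
    using translation_grid_aut[of y] by (intro exI[of _ "\<lambda>x. x + y"] exI) simp
  then have "\<exists>g. is_frame \<omega> y g"
    unfolding is_frame_def by (rule someI_ex)
  moreover have "g = h" if gh: "is_frame \<omega> y g" "is_frame \<omega> y h" for g h
  proof (rule grid_aut_eq_if_eq_on_unit_cube)
    show g: "g \<in> grid_aut" and h: "h \<in> grid_aut" using gh by (auto simp: is_frame_def)
    note [simp] = grid_aut_simps[OF g]
    fix u :: "int ^ 'n" assume u: "u \<in> cube 0 1"
    define k where "k = inv g \<circ> h"
    have k: "k \<in> grid_aut" unfolding k_def by (intro grid_aut_comp grid_aut_inv g h)
    have "k 0 = 0" using gh g by (auto simp: k_def is_frame_def)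
    then have "k w \<in> cube 0 1 \<longleftrightarrow> w \<in> cube 0 1" for w
      using sup_dist_grid_aut[OF k, of 0 w] by (simp add: cube_def)
    moreover have "\<exists>w. z = k w" for z using grid_aut_f_inv[OF k] by metis
    ultimately have img: "k ` cube 0 1 = cube 0 1" by auto (metis image_eqI)
    have "order_pattern \<omega> g = order_pattern \<omega> h" using gh by (simp add: is_frame_def)
    then have ord: "\<omega> (g v) < \<omega> (g w) \<longleftrightarrow> \<omega> (h v) < \<omega> (h w)" if "v \<in> cube 0 1" "w \<in> cube 0 1" for v w
      using that by (auto simp: order_pattern_def set_eq_iff)
    have gk: "g (k v) = h v" for v using g by (simp add: k_def)
    have "k u = u"
    proof (rule order_preserving_permutation_id[where f = "\<lambda>v. \<omega> (g v)" and B = "cube 0 1" and h = k])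
      show "inj_on (\<lambda>v. \<omega> (g v)) (cube 0 1)" by (simp add: inj_on_def inj_eq[OF assms])
      show "inj_on k (cube 0 1)" by (simp add: inj_on_def grid_aut_eq_iff[OF k])
      show "\<omega> (g (k v)) < \<omega> (g (k w)) \<longleftrightarrow> \<omega> (g v) < \<omega> (g w)"
        if "v \<in> cube 0 1" "w \<in> cube 0 1" for v w
        using ord[OF that] by (simp add: gk)
    qed (simp_all only: img u finite_cube)
    then show "g u = h u" using gk[of u] by simp
  qed
  ultimately have "\<exists>!g. is_frame \<omega> y g" by blast
  then show "is_frame \<omega> y (frame \<omega> y)" "is_frame \<omega> y g \<Longrightarrow> g = frame \<omega> y"
    unfolding frame_def by (rule theI', metis the1_equality)
qed

lemma frame_grid_aut: "inj \<omega> \<Longrightarrow> frame \<omega> y \<in> grid_aut"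
  using frame_unique(1)[of \<omega> y] by (simp add: is_frame_def)

lemma inj_act_labels:
  assumes "\<gamma> \<in> grid_aut" shows "inj (act_labels \<gamma> \<omega>) \<longleftrightarrow> inj \<omega>"
proof -
  have *: "inv \<gamma> u = inv \<gamma> v \<longleftrightarrow> u = v" "\<exists>w. inv \<gamma> w = u" for u v
    using assms by (metis grid_aut_f_inv, metis grid_aut_inv_f)
  show ?thesis by (simp add: inj_def act_labels_def) (metis *)
qed

lemma frame_equivariant:
  assumes \<gamma>: "\<gamma> \<in> grid_aut" and "inj \<omega>"
  shows "frame (act_labels \<gamma> \<omega>) (\<gamma> y) = \<gamma> \<circ> frame \<omega> y"
proof (rule sym, rule frame_unique(2))
  note [simp] = grid_aut_simps[OF \<gamma>]
  show "inj (act_labels \<gamma> \<omega>)" using assms by (simp add: inj_act_labels)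
  have op: "order_pattern (act_labels \<gamma> \<omega>) (\<gamma> \<circ> g) = order_pattern \<omega> g" for g
    using \<gamma> by (simp add: order_pattern_def act_labels_def)
  have "(\<exists>h. h \<in> grid_aut \<and> h 0 = \<gamma> y \<and> order_pattern (act_labels \<gamma> \<omega>) h = \<rho>) \<longleftrightarrow>
     (\<exists>h. h \<in> grid_aut \<and> h 0 = y \<and> order_pattern \<omega> h = \<rho>)" (is "?L = ?R") for \<rho>
  proof
    assume ?L
    then obtain h where h: "h \<in> grid_aut" "h 0 = \<gamma> y" "order_pattern (act_labels \<gamma> \<omega>) h = \<rho>" by blast
    have "\<gamma> \<circ> (inv \<gamma> \<circ> h) = h" using \<gamma> by (simp add: fun_eq_iff)
    with h op[of "inv \<gamma> \<circ> h"] show ?R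
      using \<gamma> by (intro exI[of _ "inv \<gamma> \<circ> h"]) (simp add: grid_aut_comp grid_aut_inv)
  next
    assume ?R
    then obtain h where "h \<in> grid_aut" "h 0 = y" "order_pattern \<omega> h = \<rho>" by blast
    then show ?L using \<gamma> op[of h] by (intro exI[of _ "\<gamma> \<circ> h"]) (simp add: grid_aut_comp)
  qed
  then show "is_frame (act_labels \<gamma> \<omega>) (\<gamma> y) (\<gamma> \<circ> frame \<omega> y)"
    using frame_unique(1)[OF \<open>inj \<omega>\<close>, of y] \<gamma> by (simp add: is_frame_def op grid_aut_comp)
qed

lemma frame_local:
  assumes "\<And>u v. u \<in> cube y 1 \<Longrightarrow> v \<in> cube y 1 \<Longrightarrow> \<omega> u < \<omega> v \<longleftrightarrow> \<omega>' u < \<omega>' v"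
  shows "frame \<omega> y = frame \<omega>' y"
proof -
  have op: "order_pattern \<omega> g = order_pattern \<omega>' g" if "g \<in> grid_aut" "g 0 = y" for g
  proof -
    have "g u \<in> cube y 1 \<longleftrightarrow> u \<in> cube 0 1" for u
      using that sup_dist_grid_aut[OF that(1), of 0 u] by (simp add: cube_def)
    then show ?thesis using assms by (auto simp: order_pattern_def)
  qed
  have "(\<exists>h. h \<in> grid_aut \<and> h 0 = y \<and> order_pattern \<omega> h = \<rho>) \<longleftrightarrow>
    (\<exists>h. h \<in> grid_aut \<and> h 0 = y \<and> order_pattern \<omega>' h = \<rho>)" for \<rho>
    using op by metis
  then have "is_frame \<omega> y g \<longleftrightarrow> is_frame \<omega>' y g" for g
    unfolding is_frame_def using op[of g] by auto
  then show ?thesis by (simp add: frame_def)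
qed

section \<open>Toasts\<close>

text \<open>A toast is a family of finite sets any two of which are either far apart or nested with a wide
  margin.\<close>

definition link :: "nat \<Rightarrow> (int ^ 'n::finite) set \<Rightarrow> ((int ^ 'n) \<times> (int ^ 'n)) set" where
  "link t X = {(a, b). a \<in> X \<and> b \<in> X \<and> sup_dist a b \<le> t}"

lemma link_mono: "X \<subseteq> X' \<Longrightarrow> link t X \<subseteq> link t X'"
  by (auto simp: link_def)

lemma link_rtrancl_sym: "(a, b) \<in> (link t X)\<^sup>* \<Longrightarrow> (b, a) \<in> (link t X)\<^sup>*"
proof -
  have "sym (link t X)" by (auto simp: sym_def link_def sup_dist_sym)
  then show "(a, b) \<in> (link t X)\<^sup>* \<Longrightarrow> (b, a) \<in> (link t X)\<^sup>*" by (meson sym_rtrancl symD)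
qed

lemma link_rtrancl_mem: "(a, b) \<in> (link t X)\<^sup>* \<Longrightarrow> a \<in> X \<Longrightarrow> b \<in> X"
  by (induction rule: rtrancl_induct) (auto simp: link_def)

text \<open>If chains in \<open>Y\<close> are short and the blobs are far apart, then a chain that visits a blob cannot
  get away from it: in order to reach another blob, it would have to bridge the gap within \<open>Y\<close>.\<close>

lemma link_blob:
  assumes short: "\<And>a b. (a, b) \<in> (link t Y)\<^sup>* \<Longrightarrow> sup_dist a b \<le> E"
    and apart: "\<And>i j x z. i \<in> I \<Longrightarrow> j \<in> I \<Longrightarrow> i \<noteq> j \<Longrightarrow> x \<in> B i \<Longrightarrow> z \<in> B j \<Longrightarrow>
      E + 2 * t < sup_dist x z"
    and i: "i \<in> I" "a \<in> B i" and ab: "(a, b) \<in> (link t (Y \<union> (\<Union>i\<in>I. B i)))\<^sup>*"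
  shows "b \<in> nbhd (E + t) (B i)"
proof -
  have near: "b \<in> nbhd (E + t) (B i)"
    if "b \<in> B i \<or> (\<exists>c\<in>Y \<inter> nbhd t (B i). (c, b) \<in> (link t Y)\<^sup>*)" for b
    using that
  proof
    assume "\<exists>c\<in>Y \<inter> nbhd t (B i). (c, b) \<in> (link t Y)\<^sup>*"
    then obtain c where "c \<in> nbhd t (B i)" "sup_dist c b \<le> E" using short by blast
    then show ?thesis using nbhd_step by (metis add.commute)
  qed (use subset_nbhd in blast)
  from ab have "b \<in> B i \<or> (\<exists>c\<in>Y \<inter> nbhd t (B i). (c, b) \<in> (link t Y)\<^sup>*)"
  proof (induction rule: rtrancl_induct)
    case (step b c)
    have bc: "b \<in> Y \<union> (\<Union>i\<in>I. B i)" "c \<in> Y \<union> (\<Union>i\<in>I. B i)" "sup_dist b c \<le> t"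
      using step.hyps(2) by (auto simp: link_def)
    have other: "j = i" if "j \<in> I" "z \<in> B j" "sup_dist b z \<le> t" for j z
    proof (rule ccontr)
      assume "j \<noteq> i"
      obtain x where x: "x \<in> B i" "sup_dist x b \<le> E + t" using near[OF step.IH] by (auto simp: nbhd_def)
      then have "sup_dist x z \<le> E + 2 * t" using sup_dist_triangle[of x z b] that(3) by simp
      with apart[OF i(1) that(1) _ x(1) that(2)] \<open>j \<noteq> i\<close> show False by simp
    qed
    show ?case
    proof (cases "c \<in> (\<Union>i\<in>I. B i)")
      case True
      then show ?thesis using other bc(3) by blast
    next
      case False
      then have c: "c \<in> Y" using bc(2) by blast
      show ?thesis
      proof (cases "b \<in> B i")
        case True
        then have "c \<in> Y \<inter> nbhd t (B i)" using c bc(3) by (auto intro: nbhdI)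
        then show ?thesis by blast
      next
        case False
        then have "b \<in> Y" using bc(1) other[of _ b] by auto
        with c bc(3) have "(b, c) \<in> link t Y" by (simp add: link_def)
        with step.IH False show ?thesis by (blast intro: rtrancl_into_rtrancl)
      qed
    qed
  qed (use i in blast)
  then show ?thesis by (rule near)
qed

lemma link_visits_blob:
  assumes "(a, b) \<in> (link t (Y \<union> B))\<^sup>*"
  shows "(a, b) \<in> (link t Y)\<^sup>* \<or> (\<exists>c\<in>B. (c, a) \<in> (link t (Y \<union> B))\<^sup>* \<and> (c, b) \<in> (link t (Y \<union> B))\<^sup>*)"
  using assms
proof (induction rule: rtrancl_induct)
  case (step b c)
  note IH = step.IH
  have bc: "b \<in> Y \<union> B" "c \<in> Y \<union> B" "sup_dist b c \<le> t"
    using step.hyps(2) by (auto simp: link_def)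
  show ?case
  proof (cases "b \<in> B \<or> c \<in> B")
    case True
    with step.hyps link_rtrancl_sym[OF step.hyps(1)] link_rtrancl_sym[of b c t "Y \<union> B"] show ?thesis
      by (metis rtrancl.rtrancl_refl rtrancl_trans r_into_rtrancl)
  next
    case False
    then have "(b, c) \<in> link t Y" using bc by (auto simp: link_def)
    with IH step.hyps(2) show ?thesis by (meson rtrancl.rtrancl_into_rtrancl)
  qed
qed simp

text \<open>On level \<open>n\<close>, cells have radius \<open>R n\<close> and mutual distance \<open>G n\<close>, and \<open>E n\<close> bounds the extent of the clusters
  that the pieces of the levels below \<open>n\<close> form when gaps of length \<open>3 * s\<close> are bridged.  Such clusters
  grow in three ways: a cell takes in the clusters around it, it receives a margin \<open>s\<close>, and the
  result is again linked to clusters; this accounts for the recursion of \<open>E\<close>.  The gap has to exceed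
  the extent of a cluster also when it lies between two pieces with their margins.\<close>

locale toast =
  fixes R G E :: "nat \<Rightarrow> nat" and s :: nat
  assumes s_pos: "1 \<le> s"
    and gap: "3 * E n + 15 * s \<le> G n"
    and extent: "4 * E n + 2 * R n + 14 * s \<le> E (Suc n)"
begin

text \<open>The level \<open>n\<close> cells are the Voronoi cells of the points of \<open>A n\<close>, cut off at radius \<open>R n\<close> and
  thinned out so that different cells have distance at least \<open>G n\<close>.\<close>

definition cell :: "(nat \<Rightarrow> (int ^ 'n::finite) set) \<Rightarrow> nat \<Rightarrow> int ^ 'n \<Rightarrow> (int ^ 'n) set" where
  "cell A n y = {z. sup_dist z y \<le> R n \<and> (\<forall>y'\<in>A n. y' \<noteq> y \<longrightarrow> sup_dist z y + G n \<le> sup_dist z y')}"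

definition centres :: "(nat \<Rightarrow> (int ^ 'n::finite) set) \<Rightarrow> nat \<Rightarrow> (int ^ 'n) set" where
  "centres A n = {y \<in> A n. y \<in> cell A n y}"

definition linked :: "(int ^ 'n::finite) set \<Rightarrow> int ^ 'n \<Rightarrow> (int ^ 'n) set" where
  "linked X y = {z. (y, z) \<in> (link (3 * s) X)\<^sup>*}"

fun used :: "(nat \<Rightarrow> (int ^ 'n::finite) set) \<Rightarrow> nat \<Rightarrow> (int ^ 'n) set" where
  "used A 0 = {}"
| "used A (Suc n) = used A n \<union>
     (\<Union>y\<in>centres A n. nbhd s (linked (used A n \<union> (\<Union>y\<in>centres A n. cell A n y)) y))"

abbreviation absorbable where
  "absorbable A n \<equiv> used A n \<union> (\<Union>y\<in>centres A n. cell A n y)"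

text \<open>A level \<open>n\<close> cell swallows all pieces of lower levels near it, the pieces near these, and so
  on.  The margin \<open>s\<close> added in the end separates the boundary of the new piece from those which it
  contains.  As pieces that are left out have distance more than \<open>3 * s\<close> from the core, they keep
  the distance \<open>2 * s\<close> from the new piece: margins do not use up the gaps level by level.\<close>

definition core :: "(nat \<Rightarrow> (int ^ 'n::finite) set) \<Rightarrow> nat \<Rightarrow> int ^ 'n \<Rightarrow> (int ^ 'n) set" where
  "core A n y = linked (absorbable A n) y"

definition piece :: "(nat \<Rightarrow> (int ^ 'n::finite) set) \<Rightarrow> nat \<Rightarrow> int ^ 'n \<Rightarrow> (int ^ 'n) set" where
  "piece A n y = nbhd s (core A n y)"

lemma used_Suc: "used A (Suc n) = used A n \<union> (\<Union>y\<in>centres A n. piece A n y)"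
  by (simp add: piece_def core_def)

declare used.simps(2) [simp del]

lemma core_subset_piece: "core A n y \<subseteq> piece A n y"
  by (simp add: piece_def subset_nbhd)

lemma cell_imp_centre:
  assumes "y \<in> A n" "z \<in> cell A n y" shows "y \<in> centres A n"
proof -
  have "G n \<le> sup_dist y y'" if "y' \<in> A n" "y' \<noteq> y" for y'
    using assms(2) that sup_dist_triangle[of z y' y] by (force simp: cell_def)
  then show ?thesis using assms(1) by (simp add: centres_def cell_def)
qed

text \<open>Each of the two points is closer to its own centre, by at least \<open>G n\<close>, than to the other one; the
  triangle inequality in the quadrangle of the four points turns this into a distance.\<close>

lemma cells_apart:
  assumes "y \<in> centres A n" "y' \<in> centres A n" "y \<noteq> y'" "z \<in> cell A n y" "z' \<in> cell A n y'"
  shows "G n \<le> sup_dist z z'"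
proof -
  have "sup_dist z y + G n \<le> sup_dist z y'" "sup_dist z' y' + G n \<le> sup_dist z' y"
    using assms by (auto simp: cell_def centres_def)
  moreover have "sup_dist z y' \<le> sup_dist z z' + sup_dist z' y'" "sup_dist z' y \<le> sup_dist z z' + sup_dist z y"
    using sup_dist_triangle[of z y' z'] sup_dist_triangle[of z' y z] sup_dist_sym[of z z'] by simp_all
  ultimately show ?thesis by linarith
qed

lemma ex_step_towards:
  assumes "z \<noteq> y"
  obtains z' where "sup_dist z z' \<le> 1" "sup_dist z y = Suc (sup_dist z' y)"
proof -
  define z' where "z' = (\<chi> i. z $ i - sgn (z $ i - y $ i))"
  have z': "z' $ i = z $ i - sgn (z $ i - y $ i)" for i by (simp add: z'_def)
  have "sup_dist z z' \<le> 1" by (simp add: sup_dist_le_iff z' sgn_if)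
  moreover have "sup_dist z' y \<le> sup_dist z y - 1"
  proof (unfold sup_dist_le_iff, rule allI)
    fix i
    have "sup_dist z y \<noteq> 0" using assms by simp
    moreover have "\<bar>z $ i - y $ i\<bar> \<le> int (sup_dist z y)" using sup_dist_le_iff by blast
    ultimately show "\<bar>z' $ i - y $ i\<bar> \<le> int (sup_dist z y - 1)"
      by (auto simp: z' sgn_if of_nat_diff)
  qed
  moreover have "sup_dist z y \<le> sup_dist z z' + sup_dist z' y" by (rule sup_dist_triangle)
  moreover have "sup_dist z y \<noteq> 0" using assms by simp
  ultimately show ?thesis by (intro that[of z']) linarith+
qed

text \<open>Cells are star-shaped: a step towards the centre reduces its distance at least as much as that of any other.\<close>

lemma cell_subset_core:
  assumes y: "y \<in> centres A n" shows "cell A n y \<subseteq> core A n y"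
proof
  fix z assume "z \<in> cell A n y"
  then have "(y, z) \<in> (link (3 * s) (cell A n y))\<^sup>*"
  proof (induction "sup_dist z y" arbitrary: z rule: less_induct)
    case less
    show ?case
    proof (cases "z = y")
      case False
      then obtain z' where z': "sup_dist z z' \<le> 1" "sup_dist z y = Suc (sup_dist z' y)"
        by (rule ex_step_towards)
      have "z' \<in> cell A n y"
        unfolding cell_def
      proof (intro CollectI conjI ballI impI)
        show "sup_dist z' y \<le> R n" using z'(2) less.prems by (simp add: cell_def)
        fix y' assume "y' \<in> A n" "y' \<noteq> y"
        then have "sup_dist z y + G n \<le> sup_dist z y'" using less.prems by (simp add: cell_def)
        with z' sup_dist_triangle[of z y' z'] show "sup_dist z' y + G n \<le> sup_dist z' y'" by simp
      qed
      moreover from this have "(z', z) \<in> link (3 * s) (cell A n y)"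
        using z'(1) less.prems s_pos by (simp add: link_def sup_dist_sym)
      ultimately show ?thesis using less.hyps[of z'] z'(2) by (simp add: rtrancl.rtrancl_into_rtrancl)
    qed simp
  qed
  moreover have "cell A n y \<subseteq> absorbable A n" using y by blast
  ultimately show "z \<in> core A n y"
    unfolding core_def linked_def using rtrancl_mono[OF link_mono] by blast
qed

text \<open>The bound on chains is a hypothesis here and in the next lemmas, because they serve as the step of its
  proof by induction on the level (\<open>used_chain_short\<close>).\<close>

lemma core_subset_if_short:
  assumes short: "\<And>a b. (a, b) \<in> (link (3 * s) (used A n))\<^sup>* \<Longrightarrow> sup_dist a b \<le> E n"
    and y: "y \<in> centres A n"
  shows "core A n y \<subseteq> nbhd (E n + 3 * s) (cell A n y)"
proof
  fix z assume "z \<in> core A n y"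
  then have "(y, z) \<in> (link (3 * s) (absorbable A n))\<^sup>*"
    by (simp add: core_def linked_def)
  moreover have "E n + 2 * (3 * s) < sup_dist x z"
    if "i \<in> centres A n" "j \<in> centres A n" "i \<noteq> j" "x \<in> cell A n i" "z \<in> cell A n j" for i j x z
    using cells_apart[OF that] gap[of n] s_pos by linarith
  ultimately show "z \<in> nbhd (E n + 3 * s) (cell A n y)"
    using short y by (intro link_blob[of "3 * s" "used A n" "E n" "centres A n" "cell A n" y y])
      (auto simp: centres_def)
qed

lemma piece_subset_if_short:
  assumes short: "\<And>a b. (a, b) \<in> (link (3 * s) (used A n))\<^sup>* \<Longrightarrow> sup_dist a b \<le> E n"
    and y: "y \<in> centres A n"
  shows "piece A n y \<subseteq> nbhd (E n + 4 * s) (cell A n y)"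
proof -
  have "piece A n y \<subseteq> nbhd s (nbhd (E n + 3 * s) (cell A n y))"
    unfolding piece_def by (intro nbhd_mono core_subset_if_short assms) auto
  also have "\<dots> \<subseteq> nbhd (s + (E n + 3 * s)) (cell A n y)" by (rule nbhd_nbhd)
  finally show ?thesis by (simp add: algebra_simps)
qed

lemma pieces_apart_if_short:
  assumes short: "\<And>a b. (a, b) \<in> (link (3 * s) (used A n))\<^sup>* \<Longrightarrow> sup_dist a b \<le> E n"
    and yy': "y \<in> centres A n" "y' \<in> centres A n" "y \<noteq> y'" and z: "z \<in> piece A n y" "z' \<in> piece A n y'"
  shows "E n + 6 * s < sup_dist z z'"
proof -
  obtain a a' where a: "a \<in> cell A n y" "sup_dist a z \<le> E n + 4 * s"
    "a' \<in> cell A n y'" "sup_dist a' z' \<le> E n + 4 * s"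
    using piece_subset_if_short[OF short yy'(1)] piece_subset_if_short[OF short yy'(2)] z
    unfolding nbhd_def by blast
  have "G n \<le> sup_dist a a'" by (rule cells_apart[OF yy' a(1,3)])
  also have "\<dots> \<le> sup_dist a z + sup_dist z z' + sup_dist a' z'"
    using sup_dist_triangle[of a a' z] sup_dist_triangle[of z a' z'] sup_dist_sym[of a' z'] by linarith
  finally show ?thesis using a gap[of n] s_pos by linarith
qed

lemma piece_subset_cube_if_short:
  assumes short: "\<And>a b. (a, b) \<in> (link (3 * s) (used A n))\<^sup>* \<Longrightarrow> sup_dist a b \<le> E n"
    and y: "y \<in> centres A n"
  shows "piece A n y \<subseteq> cube y (R n + E n + 4 * s)"
proof
  fix z assume "z \<in> piece A n y"
  then obtain a where a: "a \<in> cell A n y" "sup_dist a z \<le> E n + 4 * s"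
    using piece_subset_if_short[OF assms] by (auto simp: nbhd_def)
  have "sup_dist y a \<le> R n" using a(1) by (simp add: cell_def sup_dist_sym)
  with a(2) show "z \<in> cube y (R n + E n + 4 * s)"
    using sup_dist_triangle[of y z a] by (simp add: cube_def)
qed

text \<open>A chain either avoids the pieces of the last level or stays close to one of them.\<close>

lemma used_chain_short: "(a, b) \<in> (link (3 * s) (used A n))\<^sup>* \<Longrightarrow> sup_dist a b \<le> E n"
proof (induction n arbitrary: a b)
  case 0
  then have "(a, b) \<in> Id" by (simp add: link_def)
  then show ?case by simp
next
  case (Suc n)
  note short = Suc.IH
  let ?B = "\<Union>y\<in>centres A n. piece A n y"
  from link_visits_blob[OF Suc.prems[unfolded used_Suc]] show ?case
  proof
    assume "(a, b) \<in> (link (3 * s) (used A n))\<^sup>*"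
    then have "sup_dist a b \<le> E n" by (rule short)
    also have "E n \<le> E (Suc n)" using extent[of n] by linarith
    finally show ?thesis .
  next
    assume "\<exists>c\<in>?B. (c, a) \<in> (link (3 * s) (used A n \<union> ?B))\<^sup>* \<and> (c, b) \<in> (link (3 * s) (used A n \<union> ?B))\<^sup>*"
    then obtain y c where y: "y \<in> centres A n" "c \<in> piece A n y"
      and c: "(c, a) \<in> (link (3 * s) (used A n \<union> ?B))\<^sup>*" "(c, b) \<in> (link (3 * s) (used A n \<union> ?B))\<^sup>*"
      by blast
    have "sup_dist y u \<le> R n + 2 * E n + 7 * s"
      if "(c, u) \<in> (link (3 * s) (used A n \<union> ?B))\<^sup>*" for u
    proof -
      have "u \<in> nbhd (E n + 3 * s) (piece A n y)"
      proof (rule link_blob[OF short _ y that])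
        fix i j x z assume "i \<in> centres A n" "j \<in> centres A n" "i \<noteq> j" "x \<in> piece A n i" "z \<in> piece A n j"
        from pieces_apart_if_short[OF short this] show "E n + 2 * (3 * s) < sup_dist x z" by simp
      qed
      then obtain w where w: "w \<in> piece A n y" "sup_dist w u \<le> E n + 3 * s" by (auto simp: nbhd_def)
      have "sup_dist y w \<le> R n + E n + 4 * s"
        using piece_subset_cube_if_short[OF short y(1)] w(1) by (auto simp: cube_def)
      with w(2) sup_dist_triangle[of y u w] show ?thesis by linarith
    qed
    from this[OF c(1)] this[OF c(2)] show ?thesis
      using sup_dist_triangle[of a b y] sup_dist_sym[of a y] extent[of n] by linarith
  qed
qed

lemma piece_subset_cube: "y \<in> centres A n \<Longrightarrow> piece A n y \<subseteq> cube y (R n + E n + 4 * s)"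
  by (rule piece_subset_cube_if_short) (rule used_chain_short)

lemma finite_piece: "y \<in> centres A n \<Longrightarrow> finite (piece A n y)"
  using piece_subset_cube[of y A n] finite_subset finite_cube by blast

lemma pieces_apart:
  "y \<in> centres A n \<Longrightarrow> y' \<in> centres A n \<Longrightarrow> y \<noteq> y' \<Longrightarrow> z \<in> piece A n y \<Longrightarrow> z' \<in> piece A n y' \<Longrightarrow>
    s < sup_dist z z'"
  using pieces_apart_if_short[of A n y y' z z'] used_chain_short[of _ _ A n] s_pos by fastforce

lemma used_mono: "m \<le> n \<Longrightarrow> used A m \<subseteq> used A n"
  by (rule lift_Suc_mono_le[of "used A"]) (auto simp: used_Suc)

text \<open>A piece of a lower level is absorbed as a whole or not at all, because chains connect it.\<close>

lemma piece_linked: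
  assumes y: "y \<in> centres A n" and z: "z \<in> piece A n y" "z' \<in> piece A n y"
  shows "(z, z') \<in> (link (3 * s) (piece A n y))\<^sup>*"
proof -
  have core: "(y, a) \<in> (link (3 * s) (piece A n y))\<^sup>*" if "a \<in> core A n y" for a
  proof -
    from that have "(y, a) \<in> (link (3 * s) (absorbable A n))\<^sup>*"
      by (simp add: core_def linked_def)
    then show ?thesis
    proof (induction rule: rtrancl_induct)
      case (step b c)
      then have "b \<in> core A n y" "c \<in> core A n y"
        by (auto simp: core_def linked_def intro: rtrancl_into_rtrancl)
      then have "(b, c) \<in> link (3 * s) (piece A n y)"
        using step.hyps(2) core_subset_piece[of A n y] by (auto simp: link_def)
      with step.IH show ?case by (rule rtrancl_into_rtrancl)
    qed simp
  qed
  have "(y, a) \<in> (link (3 * s) (piece A n y))\<^sup>*" if a: "a \<in> piece A n y" for a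
  proof -
    obtain b where b: "b \<in> core A n y" "sup_dist b a \<le> s" using a by (auto simp: piece_def nbhd_def)
    then have "(b, a) \<in> link (3 * s) (piece A n y)"
      using a core_subset_piece[of A n y] by (auto simp: link_def)
    with core[OF b(1)] show ?thesis by (rule rtrancl_into_rtrancl)
  qed
  with z show ?thesis by (meson link_rtrancl_sym rtrancl_trans)
qed

text \<open>A lower piece that comes within \<open>2 * s\<close> of a higher one comes within \<open>3 * s\<close> of its core.  Then it is
  linked to the core as a whole, and the margin of the higher piece goes around it.\<close>

lemma piece_nested_or_apart:
  assumes "m < n" and x: "x \<in> centres A m" and y: "y \<in> centres A n"
    and ab: "a \<in> piece A m x" "b \<in> piece A n y" "sup_dist a b \<le> 2 * s"
  shows "nbhd s (piece A m x) \<subseteq> piece A n y"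
proof -
  let ?X = "absorbable A n"
  have sub: "piece A m x \<subseteq> ?X"
    using used_mono[of "Suc m" n A] \<open>m < n\<close> x by (auto simp: used_Suc)
  obtain b' where b': "b' \<in> core A n y" "sup_dist b' b \<le> s" using ab(2) by (auto simp: piece_def nbhd_def)
  have "y \<in> ?X" using y by (auto simp: centres_def)
  then have "b' \<in> ?X" using b'(1) link_rtrancl_mem[of y b' _ ?X] unfolding core_def linked_def by blast
  moreover have "sup_dist b' a \<le> 3 * s"
    using sup_dist_triangle[of b' a b] b'(2) ab(3) by (simp add: sup_dist_sym)
  ultimately have "(b', a) \<in> link (3 * s) ?X" using sub ab(1) by (auto simp: link_def)
  with b'(1) have ya: "(y, a) \<in> (link (3 * s) ?X)\<^sup>*"
    by (auto simp: core_def linked_def intro: rtrancl_into_rtrancl)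
  have "z \<in> core A n y" if "z \<in> piece A m x" for z
  proof -
    have "(a, z) \<in> (link (3 * s) ?X)\<^sup>*"
      using piece_linked[OF x ab(1) that] rtrancl_mono[OF link_mono[OF sub]] by blast
    with ya show ?thesis by (auto simp: core_def linked_def)
  qed
  then show ?thesis unfolding piece_def[of A n y] by (intro nbhd_mono subsetI) auto
qed

subsection \<open>Equivariance and locality of the toast\<close>

lemma
  assumes g: "g \<in> grid_aut"
  shows cell_equivariant: "cell (\<lambda>n. g ` A n) n (g y) = g ` cell A n y"
    and centres_equivariant: "centres (\<lambda>n. g ` A n) n = g ` centres A n"
    and piece_equivariant: "piece (\<lambda>n. g ` A n) n (g y) = g ` piece A n y"
proof -
  note [simp] = grid_aut_simps[OF g] sup_dist_grid_aut[OF g]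
  have mem_image: "z \<in> g ` S \<longleftrightarrow> inv g z \<in> S" for z S by (rule mem_image_grid_aut[OF g])
  have Un_image: "(\<Union>y\<in>g ` C. F y) = (\<Union>y\<in>C. F (g y))" for C and F :: "_ \<Rightarrow> (int ^ 'n) set" by blast
  show cell: "cell (\<lambda>n. g ` A n) n (g y) = g ` cell A n y" for n y
  proof (rule set_eqI)
    fix z
    have d: "sup_dist z (g w) = sup_dist (inv g z) w" for w
      using sup_dist_grid_aut[OF g, of "inv g z" w] by simp
    show "z \<in> cell (\<lambda>n. g ` A n) n (g y) \<longleftrightarrow> z \<in> g ` cell A n y"
      by (simp add: mem_image cell_def d)
  qed
  have centres: "centres (\<lambda>n. g ` A n) n = g ` centres A n" for n
    unfolding centres_def using cell by auto
  then show "centres (\<lambda>n. g ` A n) n = g ` centres A n" .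
  have linked: "linked (g ` X) (g y) = g ` linked X y" for X y
  proof -
    have *: "(g y, g z) \<in> (link (3 * s) (g ` X))\<^sup>*" if "(y, z) \<in> (link (3 * s) X)\<^sup>*" for z
      using that
    proof (induction rule: rtrancl_induct)
      case (step b c)
      then have "(g b, g c) \<in> link (3 * s) (g ` X)" by (auto simp: link_def)
      with step.IH show ?case by (rule rtrancl_into_rtrancl)
    qed simp
    have "\<exists>z'. z = g z' \<and> (y, z') \<in> (link (3 * s) X)\<^sup>*" if "(g y, z) \<in> (link (3 * s) (g ` X))\<^sup>*" for z
      using that
    proof (induction rule: rtrancl_induct)
      case (step b c)
      then obtain b' where b': "b = g b'" "(y, b') \<in> (link (3 * s) X)\<^sup>*" by blast
      from step.hyps(2) b'(1) obtain c' where "c = g c'" "(b', c') \<in> link (3 * s) X"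
        by (auto simp: link_def)
      with b' show ?case by (intro exI[of _ c']) (simp add: rtrancl.rtrancl_into_rtrancl)
    qed simp
    with * show ?thesis by (auto simp: linked_def)
  qed
  have used: "used (\<lambda>n. g ` A n) n = g ` used A n" for n
  proof (induction n)
    case (Suc n)
    have X: "used (\<lambda>n. g ` A n) n \<union> (\<Union>y\<in>centres (\<lambda>n. g ` A n) n. cell (\<lambda>n. g ` A n) n y) =
      g ` (absorbable A n)"
      by (simp add: Suc centres cell image_Un image_UN)
    show ?case
      unfolding used.simps(2) X unfolding Suc centres Un_image linked nbhd_grid_aut[OF g]
      by (simp only: image_Un image_UN)
  qed simp
  show "piece (\<lambda>n. g ` A n) n (g y) = g ` piece A n y"
  proof -
    have "used (\<lambda>n. g ` A n) n \<union> (\<Union>y\<in>centres (\<lambda>n. g ` A n) n. cell (\<lambda>n. g ` A n) n y) =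
      g ` (absorbable A n)"
      by (simp add: used centres cell image_Un image_UN)
    then show ?thesis by (simp add: piece_def core_def linked nbhd_grid_aut[OF g])
  qed
qed

text \<open>All parts of the toast are functions \<open>F A z\<close> for which there is a radius, independent of \<open>A\<close> and \<open>z\<close>, such
  that the sets \<open>A 0, \<dots>, A n\<close> within that radius of \<open>z\<close> determine the value.\<close>

definition agree :: "nat \<Rightarrow> nat \<Rightarrow> int ^ 'n::finite \<Rightarrow> (nat \<Rightarrow> (int ^ 'n) set) \<Rightarrow> (nat \<Rightarrow> (int ^ 'n) set) \<Rightarrow> bool" where
  "agree n \<rho> z A A' \<longleftrightarrow> (\<forall>m\<le>n. \<forall>y\<in>cube z \<rho>. y \<in> A m \<longleftrightarrow> y \<in> A' m)"

definition local_to :: "nat \<Rightarrow> ((nat \<Rightarrow> (int ^ 'n::finite) set) \<Rightarrow> int ^ 'n \<Rightarrow> 'a) \<Rightarrow> bool" where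
  "local_to n F \<longleftrightarrow> (\<exists>\<rho>. \<forall>z A A'. agree n \<rho> z A A' \<longrightarrow> F A z = F A' z)"

lemma cube_mono: "sup_dist z w + \<rho> \<le> \<rho>' \<Longrightarrow> cube w \<rho> \<subseteq> cube z \<rho>'"
proof
  fix u assume "sup_dist z w + \<rho> \<le> \<rho>'" "u \<in> cube w \<rho>"
  then show "u \<in> cube z \<rho>'" using sup_dist_triangle[of z u w] by (simp add: cube_def)
qed

lemma agree_mono:
  assumes "agree n \<rho>' z A A'" "m \<le> n" "sup_dist z w + \<rho> \<le> \<rho>'" shows "agree m \<rho> w A A'"
  using assms cube_mono[OF assms(3)] unfolding agree_def by (meson le_trans subsetD)

lemma agree_sym: "agree n \<rho> z A A' \<Longrightarrow> agree n \<rho> z A' A"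
  by (simp add: agree_def)

lemma local_to_comp:
  assumes F: "local_to n F"
    and H: "\<And>A A' z. agree n k z A A' \<Longrightarrow> (\<And>w. w \<in> cube z k \<Longrightarrow> F A w = F A' w) \<Longrightarrow> H A z = H A' z"
  shows "local_to n H"
proof -
  obtain \<rho> where "\<forall>z A A'. agree n \<rho> z A A' \<longrightarrow> F A z = F A' z"
    using F unfolding local_to_def by (rule exE)
  note \<rho> = this[rule_format]
  have "H A z = H A' z" if a: "agree n (k + \<rho>) z A A'" for z A A'
  proof (rule H)
    show "agree n k z A A'" by (rule agree_mono[OF a]) simp_all
    fix w assume "w \<in> cube z k"
    then show "F A w = F A' w" by (intro \<rho> agree_mono[OF a]) (simp_all add: cube_def)
  qed
  then show ?thesis unfolding local_to_def by blast
qed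

lemma cell_local: "local_to n (\<lambda>A y. cell A n y)"
  unfolding local_to_def
proof (intro exI allI impI)
  fix y A A' assume a: "agree n (2 * R n + G n) y A A'"
  have "cell A n y \<subseteq> cell A' n y" if a: "agree n (2 * R n + G n) y A A'" for A A'
  proof
    fix z assume z: "z \<in> cell A n y"
    show "z \<in> cell A' n y"
      unfolding cell_def
    proof (intro CollectI conjI ballI impI)
      show "sup_dist z y \<le> R n" using z by (simp add: cell_def)
      fix y' assume y': "y' \<in> A' n" "y' \<noteq> y"
      show "sup_dist z y + G n \<le> sup_dist z y'"
      proof (rule ccontr)
        assume "\<not> ?thesis"
        then have "sup_dist y y' \<le> 2 * R n + G n"
          using sup_dist_triangle[of y y' z] \<open>sup_dist z y \<le> R n\<close> by (simp add: sup_dist_sym)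
        then have "y' \<in> A n" using a y'(1) by (simp add: agree_def cube_def)
        with z y' \<open>\<not> ?thesis\<close> show False by (simp add: cell_def)
      qed
    qed
  qed
  from this[OF a] this[OF agree_sym[OF a]] show "cell A n y = cell A' n y" by blast
qed

definition at_centres where
  "at_centres A n F y = (if y \<in> centres A n then Some (F y) else None)"

lemma at_centres_eq_iff:
  "at_centres A n F y = at_centres A' n F' y \<longleftrightarrow>
    (y \<in> centres A n \<longleftrightarrow> y \<in> centres A' n) \<and> (y \<in> centres A n \<longrightarrow> F y = F' y)"
  by (auto simp: at_centres_def)

text \<open>Membership in cells is local, and the chains that form a core stay within a bounded distance of its centre.\<close>

lemma piece_local_if_used_local:
  assumes "local_to n (\<lambda>A (z :: int ^ 'n::finite). z \<in> used A n)"
  shows "local_to n (\<lambda>A (y :: int ^ 'n). at_centres A n (piece A n) y)"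
proof -
  let ?X = "\<lambda>A :: nat \<Rightarrow> (int ^ 'n) set. absorbable A n"
  have cells: "local_to n (\<lambda>A (z :: int ^ 'n). at_centres A n (cell A n) z)"
  proof -
    have "local_to n (\<lambda>A (z :: int ^ 'n). (z \<in> A n, cell A n z))"
      by (rule local_to_comp[OF cell_local, of n 0]) (simp add: agree_def cube_def)
    then show ?thesis
      by (rule local_to_comp[of _ _ 0]) (auto simp: at_centres_def centres_def cube_def)
  qed
  have "local_to n (\<lambda>A (z :: int ^ 'n). (z \<in> centres A n, z \<in> (\<Union>y\<in>centres A n. cell A n y)))"
  proof (rule local_to_comp[OF cells, of "R n"], rule prod_eqI)
    fix A A' z assume eq: "\<And>w. w \<in> cube z (R n) \<Longrightarrow>
      at_centres A n (cell A n) w = at_centres A' n (cell A' n) w"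
    show "fst (z \<in> centres A n, z \<in> (\<Union>y\<in>centres A n. cell A n y)) =
        fst (z \<in> centres A' n, z \<in> (\<Union>y\<in>centres A' n. cell A' n y))"
      using eq[of z] by (simp add: cube_def at_centres_eq_iff)
    have "z \<in> (\<Union>y\<in>centres B n. cell B n y) \<longleftrightarrow> (\<exists>y\<in>cube z (R n). y \<in> centres B n \<and> z \<in> cell B n y)" for B
      by (auto simp: cell_def cube_def)
    with eq show "snd (z \<in> centres A n, z \<in> (\<Union>y\<in>centres A n. cell A n y)) =
        snd (z \<in> centres A' n, z \<in> (\<Union>y\<in>centres A' n. cell A' n y))"
      unfolding at_centres_eq_iff by (simp only: snd_conv) metis
  qed
  then have X: "local_to n (\<lambda>A (z :: int ^ 'n). (z \<in> centres A n, z \<in> ?X A))"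
  proof -
    obtain \<rho>1 where "\<forall>(z :: int ^ 'n) A A'. agree n \<rho>1 z A A' \<longrightarrow>
      (z \<in> centres A n, z \<in> (\<Union>y\<in>centres A n. cell A n y)) =
      (z \<in> centres A' n, z \<in> (\<Union>y\<in>centres A' n. cell A' n y))"
      using \<open>local_to n (\<lambda>A (z :: int ^ 'n). (z \<in> centres A n, z \<in> (\<Union>y\<in>centres A n. cell A n y)))\<close>
      unfolding local_to_def by (rule exE)
    note \<rho>1 = this[rule_format]
    obtain \<rho>2 where "\<forall>(z :: int ^ 'n) A A'. agree n \<rho>2 z A A' \<longrightarrow> (z \<in> used A n) = (z \<in> used A' n)"
      using assms unfolding local_to_def by (rule exE)
    note \<rho>2 = this[rule_format]
    have "(z \<in> centres A n, z \<in> ?X A) = (z \<in> centres A' n, z \<in> ?X A')" if "agree n (\<rho>1 + \<rho>2) z A A'" for z :: "int ^ 'n" and A A'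
      using \<rho>1[OF agree_mono[OF that, of n z \<rho>1]] \<rho>2[OF agree_mono[OF that, of n z \<rho>2]] by simp
    then show ?thesis unfolding local_to_def by blast
  qed
  define k where "k = R n + E n + 4 * s"
  show ?thesis
  proof (rule local_to_comp[OF X, of k])
    fix A A' y assume eq: "\<And>w. w \<in> cube y k \<Longrightarrow> (w \<in> centres A n, w \<in> ?X A) = (w \<in> centres A' n, w \<in> ?X A')"
    have "core A n y \<subseteq> core A' n y" if y: "y \<in> centres A n"
      and eq: "\<And>w. w \<in> cube y k \<Longrightarrow> w \<in> ?X A \<longleftrightarrow> w \<in> ?X A'" for A A'
    proof
      fix z assume "z \<in> core A n y"
      then have "(y, z) \<in> (link (3 * s) (?X A))\<^sup>*" by (simp add: core_def linked_def)
      then have "(y, z) \<in> (link (3 * s) (?X A'))\<^sup>*"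
      proof (induction rule: rtrancl_induct)
        case (step b c)
        then have "b \<in> core A n y" "c \<in> core A n y"
          by (auto simp: core_def linked_def intro: rtrancl_into_rtrancl)
        then have "b \<in> cube y k" "c \<in> cube y k"
          using core_subset_piece piece_subset_cube[OF y] unfolding k_def by blast+
        with eq step.hyps(2) have "(b, c) \<in> link (3 * s) (?X A')" by (auto simp: link_def)
        with step.IH show ?case by (rule rtrancl_into_rtrancl)
      qed simp
      then show "z \<in> core A' n y" by (simp add: core_def linked_def)
    qed
    note sub = this
    have c: "y \<in> centres A n \<longleftrightarrow> y \<in> centres A' n" using eq[of y] by (simp add: cube_def)
    have "core A n y = core A' n y" if "y \<in> centres A n"
      by (intro equalityI sub) (use that c eq in auto)
    with c show "at_centres A n (piece A n) y = at_centres A' n (piece A' n) y"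
      by (simp add: piece_def at_centres_eq_iff)
  qed
qed

lemma used_local: "local_to n (\<lambda>A (z :: int ^ 'n::finite). z \<in> used A n)"
proof (induction n)
  case 0
  show ?case by (simp add: local_to_def)
next
  case (Suc n)
  obtain \<rho>1 where "\<forall>(z :: int ^ 'n) A A'. agree n \<rho>1 z A A' \<longrightarrow> (z \<in> used A n) = (z \<in> used A' n)"
    using Suc unfolding local_to_def by (rule exE)
  note \<rho>1 = this[rule_format]
  obtain \<rho>2 where "\<forall>(z :: int ^ 'n) A A'. agree n \<rho>2 z A A' \<longrightarrow>
    at_centres A n (piece A n) z = at_centres A' n (piece A' n) z"
    using piece_local_if_used_local[OF Suc] unfolding local_to_def by (rule exE)
  note \<rho>2 = this[rule_format]
  define k where "k = R n + E n + 4 * s"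
  have "z \<in> used A (Suc n) \<longleftrightarrow> z \<in> used A' (Suc n)" if a: "agree (Suc n) (\<rho>1 + (k + \<rho>2)) z A A'" for z :: "int ^ 'n" and A A'
  proof -
    have "z \<in> used A n \<longleftrightarrow> z \<in> used A' n" by (rule \<rho>1, rule agree_mono[OF a]) simp_all
    moreover have "z \<in> (\<Union>y\<in>centres B n. piece B n y) \<longleftrightarrow>
        (\<exists>y\<in>cube z k. y \<in> centres B n \<and> z \<in> piece B n y)" for B
      using piece_subset_cube[of _ B n] by (fastforce simp: cube_def k_def sup_dist_sym)
    moreover have "y \<in> centres A n \<and> z \<in> piece A n y \<longleftrightarrow> y \<in> centres A' n \<and> z \<in> piece A' n y"
      if y: "y \<in> cube z k" for y
    proof -
      have "agree n \<rho>2 y A A'" by (rule agree_mono[OF a]) (use y in \<open>simp_all add: cube_def\<close>)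
      from \<rho>2[OF this] show ?thesis by (auto simp: at_centres_eq_iff)
    qed
    ultimately show ?thesis by (simp add: used_Suc)
  qed
  then show ?case unfolding local_to_def by blast
qed

lemmas piece_local = piece_local_if_used_local[OF used_local]

lemma close_pieces:
  assumes "x \<in> centres A m" "y \<in> centres A n" "a \<in> piece A m x" "b \<in> piece A n y" "sup_dist a b \<le> s"
  shows "m = n \<and> x = y \<or> m < n \<and> nbhd s (piece A m x) \<subseteq> piece A n y \<or>
    n < m \<and> nbhd s (piece A n y) \<subseteq> piece A m x"
proof (cases m n rule: linorder_cases)
  case less
  with assms piece_nested_or_apart[of m n x A y a b] show ?thesis by simp
next
  case equal
  with assms pieces_apart[of x A n y a b] show ?thesis by fastforce
next
  case greater
  with assms piece_nested_or_apart[of n m y A x b a] show ?thesis by (simp add: sup_dist_sym)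
qed

definition covers :: "(nat \<Rightarrow> (int ^ 'n::finite) set) \<Rightarrow> bool" where
  "covers A \<longleftrightarrow> (\<forall>z m. \<exists>n\<ge>m. \<exists>y\<in>A n. z \<in> cell A n y)"

lemma covers_piece:
  assumes "covers A" obtains n y where "m \<le> n" "y \<in> centres A n" "z \<in> piece A n y"
proof -
  obtain n y where n: "m \<le> n" "y \<in> A n" "z \<in> cell A n y" using assms unfolding covers_def by blast
  then have "y \<in> centres A n" by (intro cell_imp_centre)
  with n cell_subset_core[of y A n] core_subset_piece[of A n y] show ?thesis by (intro that[of n y]) auto
qed

lemma covers_nbhd:
  assumes "covers A" "x \<in> centres A m"
  obtains n y where "m < n" "y \<in> centres A n" "nbhd s (piece A m x) \<subseteq> piece A n y"
proof -
  obtain n y where n: "Suc m \<le> n" "y \<in> centres A n" "x \<in> piece A n y"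
    using assms(1) by (rule covers_piece)
  have "x \<in> piece A m x"
    using assms(2) cell_subset_core[OF assms(2)] core_subset_piece[of A m x] by (auto simp: centres_def)
  with n piece_nested_or_apart[of m n x A y x x] assms(2) have "nbhd s (piece A m x) \<subseteq> piece A n y" by simp
  with n show ?thesis by (intro that[of n y]) auto
qed

end

section \<open>The decoration\<close>

text \<open>The margin has room for two layers and for the squares next to them.\<close>

locale toast_decoration = transition_layer \<psi> r + toast R G E s
  for \<psi> :: "'n::finite labelling" and r R G E s +
  fixes \<theta> :: "nat \<Rightarrow> real"
  assumes wide: "2 * r + 10 \<le> s"
begin

definition marked :: "(int ^ 'n \<Rightarrow> real) \<Rightarrow> nat \<Rightarrow> (int ^ 'n) set" where
  "marked \<omega> n = {y. \<omega> y < \<theta> n}"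

text \<open>The smallest piece containing an edge decides on the edge.\<close>

definition owns :: "(int ^ 'n \<Rightarrow> real) \<Rightarrow> nat \<Rightarrow> int ^ 'n \<Rightarrow> (int ^ 'n) set \<Rightarrow> bool" where
  "owns \<omega> n y e \<longleftrightarrow> y \<in> centres (marked \<omega>) n \<and> e \<subseteq> piece (marked \<omega>) n y \<and>
     (\<forall>m<n. \<forall>x\<in>centres (marked \<omega>) m. \<not> e \<subseteq> piece (marked \<omega>) m x)"

definition near :: "(int ^ 'n \<Rightarrow> real) \<Rightarrow> nat \<Rightarrow> nat \<Rightarrow> int ^ 'n \<Rightarrow> (int ^ 'n) set \<Rightarrow> bool" where
  "near \<omega> n m x e \<longleftrightarrow> m < n \<and> x \<in> centres (marked \<omega>) m \<and> e \<inter> nbhd r (piece (marked \<omega>) m x) \<noteq> {}"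

abbreviation framed_pattern :: "(int ^ 'n \<Rightarrow> real) \<Rightarrow> int ^ 'n \<Rightarrow> (int ^ 'n) decoration" where
  "framed_pattern \<omega> y \<equiv> transport (frame \<omega> y) (pattern \<psi>)"

abbreviation layer :: "(int ^ 'n \<Rightarrow> real) \<Rightarrow> nat \<Rightarrow> int ^ 'n \<Rightarrow> int ^ 'n \<Rightarrow> (int ^ 'n) decoration" where
  "layer \<omega> m x y \<equiv> interpolation (piece (marked \<omega>) m x) (frame \<omega> x) (frame \<omega> y)"

text \<open>An edge follows the pattern in the frame of its owner, except near a smaller piece, where the pattern
  has to be matched with that of the smaller piece.\<close>

definition prescribed where
  "prescribed \<omega> n y e q \<longleftrightarrow> (\<exists>m x. near \<omega> n m x e \<and> q = layer \<omega> m x y e) \<or>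
     (\<not> (\<exists>m x. near \<omega> n m x e) \<and> q = framed_pattern \<omega> y e)"

definition decorated :: "(int ^ 'n \<Rightarrow> real) \<Rightarrow> nat \<Rightarrow> (int ^ 'n) set \<Rightarrow> nat \<times> (int ^ 'n) \<Rightarrow> bool" where
  "decorated \<omega> n e q \<longleftrightarrow> (\<exists>y. owns \<omega> n y e \<and> prescribed \<omega> n y e q)"

definition decoration :: "(int ^ 'n \<Rightarrow> real) \<Rightarrow> (int ^ 'n) decoration" where
  "decoration \<omega> e = (THE q. \<exists>n. decorated \<omega> n e q)"

abbreviation factor :: "(int ^ 'n \<Rightarrow> real) \<Rightarrow> (int ^ 'n) decoration" where
  "factor \<omega> \<equiv> restrict (decoration \<omega>) grid_edges"

definition home :: "(int ^ 'n \<Rightarrow> real) \<Rightarrow> nat \<Rightarrow> int ^ 'n \<Rightarrow> int ^ 'n \<Rightarrow> bool" where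
  "home \<omega> n y v \<longleftrightarrow> y \<in> centres (marked \<omega>) n \<and> v \<in> piece (marked \<omega>) n y \<and>
     (\<forall>m<n. \<forall>x\<in>centres (marked \<omega>) m. v \<notin> piece (marked \<omega>) m x)"

lemma owner_unique:
  assumes "owns \<omega> n y e" "owns \<omega> n' y' e" "e \<noteq> {}" shows "n' = n \<and> y' = y"
proof -
  have "n' = n" using assms by (meson linorder_neqE_nat owns_def)
  moreover have "y' = y"
  proof (rule ccontr)
    assume "y' \<noteq> y"
    obtain u where "u \<in> e" using assms(3) by blast
    with assms \<open>n' = n\<close> have "u \<in> piece (marked \<omega>) n y" "u \<in> piece (marked \<omega>) n y'"
      "y \<in> centres (marked \<omega>) n" "y' \<in> centres (marked \<omega>) n" by (auto simp: owns_def)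
    with pieces_apart[of y "marked \<omega>" n y' u u] \<open>y' \<noteq> y\<close> show False by simp
  qed
  ultimately show ?thesis by simp
qed

text \<open>Two pieces near \<open>e\<close> are near each other.  If they were different, one would lie deep inside the other, which
  would thus contain \<open>e\<close> and be smaller than the owner.\<close>

lemma near_unique:
  assumes "owns \<omega> n y e" and e: "e \<in> grid_edges" and n: "near \<omega> n m x e" "near \<omega> n m' x' e"
  shows "m' = m \<and> x' = x"
proof -
  have near_e: "e \<subseteq> nbhd (r + 1) (piece (marked \<omega>) m x)" if "near \<omega> n m x e" for m x
  proof
    fix u assume "u \<in> e"
    obtain w where "w \<in> e" "w \<in> nbhd r (piece (marked \<omega>) m x)" using \<open>near \<omega> n m x e\<close> unfolding near_def by blast
    then show "u \<in> nbhd (r + 1) (piece (marked \<omega>) m x)"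
      using nbhd_step edge_sup_dist[OF e \<open>w \<in> e\<close> \<open>u \<in> e\<close>] by blast
  qed
  have deep: "\<not> nbhd s (piece (marked \<omega>) m x) \<subseteq> piece (marked \<omega>) m' x'"
    if "near \<omega> n m x e" "near \<omega> n m' x' e" for m x m' x'
  proof
    assume "nbhd s (piece (marked \<omega>) m x) \<subseteq> piece (marked \<omega>) m' x'"
    moreover have "nbhd (r + 1) (piece (marked \<omega>) m x) \<subseteq> nbhd s (piece (marked \<omega>) m x)"
      using wide by (intro nbhd_mono) auto
    ultimately have "e \<subseteq> piece (marked \<omega>) m' x'" using near_e[OF that(1)] by blast
    with that(2) assms(1) show False by (auto simp: owns_def near_def)
  qed
  obtain u where "u \<in> e" using e by (auto simp: grid_edges_eq edge_def)
  then obtain a a' where a: "a \<in> piece (marked \<omega>) m x" "sup_dist a u \<le> r + 1"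
    "a' \<in> piece (marked \<omega>) m' x'" "sup_dist a' u \<le> r + 1"
    using near_e[OF n(1)] near_e[OF n(2)] unfolding nbhd_def by blast
  then have "sup_dist a a' \<le> s"
    using sup_dist_triangle[of a a' u] sup_dist_sym[of a' u] wide by linarith
  then show ?thesis
    using close_pieces[of x "marked \<omega>" m x' m' a a'] a n deep[OF n] deep[OF n(2,1)] by (auto simp: near_def)
qed

lemma decorated_unique:
  assumes "decorated \<omega> n e q" "decorated \<omega> n' e q'" and e: "e \<in> grid_edges"
  shows "n' = n" "q' = q"
proof -
  have "e \<noteq> {}" using e by (auto simp: grid_edges_eq edge_def)
  obtain y y' where y: "owns \<omega> n y e" "owns \<omega> n' y' e"
    and q: "prescribed \<omega> n y e q" and q': "prescribed \<omega> n' y' e q'"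
    using assms(1,2) unfolding decorated_def by blast
  note q = q[unfolded prescribed_def] q'[unfolded prescribed_def]
  have eq: "n' = n" "y' = y" using owner_unique[OF y \<open>e \<noteq> {}\<close>] by auto
  then show "n' = n" by simp
  show "q' = q"
  proof (cases "\<exists>m x. near \<omega> n m x e")
    case True
    with q eq obtain m x m' x' where "near \<omega> n m x e" "q = layer \<omega> m x y e"
      "near \<omega> n m' x' e" "q' = layer \<omega> m' x' y e" by blast
    with near_unique[OF y(1) e, of m x m' x'] show ?thesis by simp
  qed (use q eq in auto)
qed

lemma decoration_eqI:
  assumes "decorated \<omega> n e q" "e \<in> grid_edges" shows "decoration \<omega> e = q"
  unfolding decoration_def using assms decorated_unique(2) by blast

lemma decoration_near: "owns \<omega> n y e \<Longrightarrow> near \<omega> n m x e \<Longrightarrow> e \<in> grid_edges \<Longrightarrow> decoration \<omega> e = layer \<omega> m x y e"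
  by (rule decoration_eqI) (auto simp: decorated_def prescribed_def)

lemma decoration_not_near:
  "owns \<omega> n y e \<Longrightarrow> (\<And>m x. \<not> near \<omega> n m x e) \<Longrightarrow> e \<in> grid_edges \<Longrightarrow> decoration \<omega> e = framed_pattern \<omega> y e"
  by (rule decoration_eqI) (auto simp: decorated_def prescribed_def)

lemma least_level:
  assumes "\<exists>n. \<exists>y\<in>centres (marked \<omega>) n. P n y"
  obtains n y where "y \<in> centres (marked \<omega>) n" "P n y" "\<And>m x. m < n \<Longrightarrow> x \<in> centres (marked \<omega>) m \<Longrightarrow> \<not> P m x"
proof -
  let ?n = "LEAST n. \<exists>y\<in>centres (marked \<omega>) n. P n y"
  have "\<exists>y\<in>centres (marked \<omega>) ?n. P ?n y" using assms by (rule LeastI_ex)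
  moreover have "\<not> (\<exists>y\<in>centres (marked \<omega>) m. P m y)" if "m < ?n" for m using not_less_Least[OF that] .
  ultimately show ?thesis using that by blast
qed

context
  fixes \<omega> :: "int ^ 'n \<Rightarrow> real"
  assumes inj: "inj \<omega>" and covers: "covers (marked \<omega>)"
begin

lemma ex_home: obtains n y where "home \<omega> n y v"
proof -
  have "\<exists>n. \<exists>y\<in>centres (marked \<omega>) n. v \<in> piece (marked \<omega>) n y"
    using covers_piece[OF covers, of 0 v] by metis
  then obtain n y where "y \<in> centres (marked \<omega>) n" "v \<in> piece (marked \<omega>) n y"
    "\<And>m x. m < n \<Longrightarrow> x \<in> centres (marked \<omega>) m \<Longrightarrow> \<not> v \<in> piece (marked \<omega>) m x"
    by (rule least_level) blast
  then show ?thesis by (intro that[of n y]) (simp add: home_def)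
qed

lemma ex_owner:
  assumes e: "e \<in> grid_edges" obtains n y where "owns \<omega> n y e"
proof -
  obtain u where "u \<in> e" using e by (auto simp: grid_edges_eq edge_def)
  obtain m x where m: "x \<in> centres (marked \<omega>) m" "u \<in> piece (marked \<omega>) m x"
    using covers by (rule covers_piece)
  obtain n y where n: "y \<in> centres (marked \<omega>) n" "nbhd s (piece (marked \<omega>) m x) \<subseteq> piece (marked \<omega>) n y"
    using covers m(1) by (rule covers_nbhd)
  have "e \<subseteq> nbhd s (piece (marked \<omega>) m x)"
  proof
    fix w assume "w \<in> e"
    have "sup_dist u w \<le> s" using edge_sup_dist[OF e \<open>u \<in> e\<close> \<open>w \<in> e\<close>] s_pos by linarith
    with m(2) show "w \<in> nbhd s (piece (marked \<omega>) m x)" by (rule nbhdI)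
  qed
  with n have "\<exists>n. \<exists>y\<in>centres (marked \<omega>) n. e \<subseteq> piece (marked \<omega>) n y" by blast
  then obtain n y where "y \<in> centres (marked \<omega>) n" "e \<subseteq> piece (marked \<omega>) n y"
    "\<And>m x. m < n \<Longrightarrow> x \<in> centres (marked \<omega>) m \<Longrightarrow> \<not> e \<subseteq> piece (marked \<omega>) m x"
    by (rule least_level) blast
  then show ?thesis by (intro that[of n y]) (simp add: owns_def)
qed

lemma ex_decorated:
  assumes "e \<in> grid_edges" shows "\<exists>n q. decorated \<omega> n e q"
proof -
  obtain n y where "owns \<omega> n y e" using assms by (rule ex_owner)
  then show ?thesis unfolding decorated_def prescribed_def by blast
qed

lemma schreier_at_framed_pattern: "schreier_at (framed_pattern \<omega> y) v"
  using schreier_at_transport[OF frame_grid_aut[OF inj, of y] schreier_at_pattern[OF labelling(1)],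
      of "inv (frame \<omega> y) v"]
  by (simp add: grid_aut_f_inv[OF frame_grid_aut[OF inj]])

text \<open>Let \<open>P\<close> be the smallest piece containing \<open>v\<close>.  If all neighbours of \<open>v\<close> belong to \<open>P\<close>, then the
  decoration agrees at \<open>v\<close> with the pattern of \<open>P\<close> or with a layer inside \<open>P\<close>.  Otherwise \<open>v\<close> is far
  from the smaller pieces in \<open>P\<close>, and the edges leaving \<open>P\<close> belong to a layer around \<open>P\<close>, where it
  continues the pattern of \<open>P\<close>.\<close>

lemma schreier_at_decoration: "schreier_at (decoration \<omega>) v"
proof -
  let ?A = "marked \<omega>"
  obtain n y where h: "home \<omega> n y v" by (rule ex_home)
  then have y: "y \<in> centres ?A n" and v: "v \<in> piece ?A n y"
    and lower: "\<And>m x. m < n \<Longrightarrow> x \<in> centres ?A m \<Longrightarrow> v \<notin> piece ?A m x"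
    by (auto simp: home_def)
  have own: "owns \<omega> n y e" if "v \<in> e" "e \<subseteq> piece ?A n y" for e
    using that y lower by (auto simp: owns_def)
  have near_v: "v \<in> nbhd (r + 1) (piece ?A m x)"
    if "near \<omega> n m x e" "e \<in> grid_edges" "v \<in> e" for m x e
  proof -
    obtain w where "w \<in> e" "w \<in> nbhd r (piece ?A m x)" using \<open>near \<omega> n m x e\<close> unfolding near_def by blast
    then show ?thesis using nbhd_step edge_sup_dist[OF that(2) \<open>w \<in> e\<close> that(3)] by blast
  qed
  note frame = frame_grid_aut[OF inj]
  show ?thesis
  proof (cases "\<forall>e\<in>grid_edges. v \<in> e \<longrightarrow> e \<subseteq> piece ?A n y")
    case True
    show ?thesis
    proof (cases "\<exists>m x. m < n \<and> x \<in> centres ?A m \<and> v \<in> nbhd (r + 1) (piece ?A m x)")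
      case ex: True
      then obtain m x where m: "m < n" "x \<in> centres ?A m" "v \<in> nbhd (r + 1) (piece ?A m x)" by blast
      have uniq: "m' = m \<and> x' = x"
        if m': "m' < n" "x' \<in> centres ?A m'" "v \<in> nbhd (r + 1) (piece ?A m' x')" for m' x'
      proof -
        obtain a a' where a: "a \<in> piece ?A m x" "sup_dist a v \<le> r + 1"
          "a' \<in> piece ?A m' x'" "sup_dist a' v \<le> r + 1" using m m' by (auto simp: nbhd_def)
        then have "sup_dist a a' \<le> s"
          using sup_dist_triangle[of a a' v] sup_dist_sym[of a' v] wide by linarith
        moreover have "v \<in> nbhd s (piece ?A m x)" "v \<in> nbhd s (piece ?A m' x')"
          using a wide by (auto intro!: nbhdI)
        ultimately show ?thesis
          using close_pieces[OF m(2) m'(2) a(1,3)] lower m m' by blast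
      qed
      have "decoration \<omega> e = layer \<omega> m x y e" if e: "e \<in> grid_edges" "v \<in> e" for e
      proof (cases "near \<omega> n m x e")
        case near: True
        then show ?thesis using own[OF e(2)] True e by (intro decoration_near) auto
      next
        case not_near: False
        have "\<not> near \<omega> n m' x' e" for m' x'
          using uniq[of m' x'] near_v[OF _ e, of m' x'] not_near by (auto simp: near_def)
        then have "decoration \<omega> e = framed_pattern \<omega> y e"
          using own[OF e(2)] True e by (intro decoration_not_near) auto
        moreover have "layer \<omega> m x y e = framed_pattern \<omega> y e"
          using not_near m e by (intro interpolation_outside frame) (auto simp: near_def)
        ultimately show ?thesis by simp
      qed
      then show ?thesis
        using schreier_at_cong[of v "decoration \<omega>"] schreier_at_interpolation[OF frame frame] by blast
    next
      case False
      then have "\<not> near \<omega> n m x e" if "e \<in> grid_edges" "v \<in> e" for m x e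
        using near_v[OF _ that, of m x] by (auto simp: near_def)
      then have "decoration \<omega> e = framed_pattern \<omega> y e" if "e \<in> grid_edges" "v \<in> e" for e
        using own[OF that(2)] True that by (intro decoration_not_near) auto
      then show ?thesis
        using schreier_at_cong[of v "decoration \<omega>"] schreier_at_framed_pattern by blast
    qed
  next
    case False
    then obtain e0 where e0: "e0 \<in> grid_edges" "v \<in> e0" "\<not> e0 \<subseteq> piece ?A n y" by blast
    have far: "v \<notin> nbhd (r + 1) (piece ?A m x)" if m: "m < n" "x \<in> centres ?A m" for m x
    proof
      assume v': "v \<in> nbhd (r + 1) (piece ?A m x)"
      then obtain a where "a \<in> piece ?A m x" "sup_dist a v \<le> r + 1" by (auto simp: nbhd_def)
      then have "nbhd s (piece ?A m x) \<subseteq> piece ?A n y"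
        using close_pieces[OF m(2) y, of a v] v m(1) wide by auto
      moreover have "e0 \<subseteq> nbhd s (piece ?A m x)"
      proof
        fix w assume "w \<in> e0"
        then have "w \<in> nbhd (r + 1 + 1) (piece ?A m x)"
          using nbhd_step[OF v'] edge_sup_dist[OF e0(1,2)] by blast
        moreover have "nbhd (r + 1 + 1) (piece ?A m x) \<subseteq> nbhd s (piece ?A m x)"
          using wide by (intro nbhd_mono) auto
        ultimately show "w \<in> nbhd s (piece ?A m x)" by blast
      qed
      ultimately show False using e0(3) by blast
    qed
    have "decoration \<omega> e = framed_pattern \<omega> y e" if e: "e \<in> grid_edges" "v \<in> e" for e
    proof (cases "e \<subseteq> piece ?A n y")
      case True
      have "\<not> near \<omega> n m x e" for m x
        using near_v[OF _ e, of m x] far[of m x] by (auto simp: near_def)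
      then show ?thesis using own[OF e(2)] True e by (intro decoration_not_near) auto
    next
      case False
      obtain n' y' where o: "owns \<omega> n' y' e" using e(1) by (rule ex_owner)
      then have y': "y' \<in> centres ?A n'" "v \<in> piece ?A n' y'" using e(2) by (auto simp: owns_def)
      have "n < n'"
        using close_pieces[OF y y'(1) v y'(2)] lower[of n' y'] y' False o by (auto simp: owns_def)
      moreover have "v \<in> nbhd r (piece ?A n y)" using v subset_nbhd by blast
      ultimately have "near \<omega> n' n y e" using y e(2) by (auto simp: near_def)
      then have "decoration \<omega> e = layer \<omega> n y y' e" using o e by (intro decoration_near) auto
      also have "\<dots> = framed_pattern \<omega> y e" using e v by (intro interpolation_inside frame) auto
      finally show ?thesis .
    qed
    then show ?thesis
      using schreier_at_cong[of v "decoration \<omega>"] schreier_at_framed_pattern by blast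
  qed
qed

text \<open>A path leaving a piece crosses the region beyond the layer around the piece, where the
  decoration is a framed pattern; the colour components of these are squares.\<close>

lemma no_infinite_monochromatic_path:
  "\<not> infinite_monochromatic_path grid_edges (factor \<omega>) p"
proof
  let ?A = "marked \<omega>"
  assume "infinite_monochromatic_path grid_edges (factor \<omega>) p"
  then obtain c where p: "inj p" "\<And>k. {p k, p (Suc k)} \<in> grid_edges"
    and c: "\<And>k. fst (decoration \<omega> {p k, p (Suc k)}) = c"
    by (auto simp: infinite_monochromatic_path_def)
  obtain n y where n: "y \<in> centres ?A n" "p 0 \<in> piece ?A n y"
    using covers by (rule covers_piece)
  define K where "K = piece ?A n y"
  \<comment> \<open>Within distance \<open>2\<close> of the first vertex outside of this neighbourhood, where its square and the
    edges at the square are, the layer around \<open>K\<close> has no influence.\<close>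
  have "\<exists>k. p k \<notin> nbhd (r + 4) K"
  proof (rule ccontr)
    assume "\<not> ?thesis"
    then have "range p \<subseteq> nbhd (r + 4) K" by blast
    then have "finite (range p)" using finite_nbhd[OF finite_piece[OF n(1)]] finite_subset unfolding K_def by blast
    with p(1) show False using finite_imageD by blast
  qed
  then have least: "p (LEAST k. p k \<notin> nbhd (r + 4) K) \<notin> nbhd (r + 4) K" by (rule LeastI_ex)
  define k where "k = (LEAST k. p k \<notin> nbhd (r + 4) K)"
  define v where "v = p k"
  have v_far: "v \<notin> nbhd (r + 4) K" using least by (simp add: v_def k_def)
  have "p 0 \<in> nbhd (r + 4) K" using n(2) subset_nbhd unfolding K_def by blast
  with v_far obtain j where j: "k = Suc j" by (cases k) (auto simp: v_def)
  then have "p j \<in> nbhd (r + 4) K" unfolding k_def by (metis lessI not_less_Least)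
  then have "v \<in> nbhd (r + 4 + 1) K"
    using adj_sup_dist[OF p(2)[of j]] unfolding v_def j by (rule nbhd_step)
  moreover have "r + 4 + 1 = r + 5" by simp
  ultimately have v_near: "v \<in> nbhd (r + 5) K" by (simp only:)
  obtain n' y' where h: "home \<omega> n' y' v" by (rule ex_home)
  then have y': "y' \<in> centres ?A n'" "v \<in> piece ?A n' y'"
    and lower: "\<And>m x. m < n' \<Longrightarrow> x \<in> centres ?A m \<Longrightarrow> v \<notin> piece ?A m x"
    by (auto simp: home_def)
  have v_out: "v \<notin> K" using v_far subset_nbhd by blast
  have inside: "n < n'" "nbhd s K \<subseteq> piece ?A n' y'"
  proof -
    obtain a where a: "a \<in> K" "sup_dist a v \<le> r + 5" using v_near by (auto simp: nbhd_def)
    have "v \<in> nbhd s (piece ?A n' y')" using y'(2) subset_nbhd by blast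
    with close_pieces[OF n(1) y'(1) _ y'(2), of a] a v_out y'(2) wide
    show "n < n'" "nbhd s K \<subseteq> piece ?A n' y'" unfolding K_def by auto
  qed
  obtain \<psi>' where \<psi>': "is_labelling \<psi>'" "no_straight_colour \<psi>'"
    "\<And>e. e \<in> grid_edges \<Longrightarrow> framed_pattern \<omega> y' e = pattern \<psi>' e"
    using transport_pattern[OF frame_grid_aut[OF inj, of y'] labelling] by metis
  obtain S where S: "v \<in> S" "S \<subseteq> cube v 1"
    "\<And>e. e \<in> grid_edges \<Longrightarrow> e \<inter> S \<noteq> {} \<Longrightarrow> fst (pattern \<psi>' e) = c \<Longrightarrow> e \<subseteq> S"
    by (rule pattern_colour_components[OF \<psi>'(1,2), where v = v and c = c]) blast
  have eq: "decoration \<omega> e = pattern \<psi>' e" if e: "e \<in> grid_edges" "e \<inter> S \<noteq> {}" for e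
  proof -
    have vw: "sup_dist v w \<le> 2" if "w \<in> e" for w
    proof -
      obtain u where "u \<in> e" "u \<in> S" using e(2) by blast
      then have "sup_dist v u \<le> 1" "sup_dist u w \<le> 1"
        using S(2) edge_sup_dist[OF e(1) \<open>u \<in> e\<close> that] by (auto simp: cube_def)
      then show ?thesis using sup_dist_triangle[of v w u] by linarith
    qed
    have w_near: "w \<in> nbhd (r + 7) K" if "w \<in> e" for w
      using nbhd_step[OF v_near vw[OF that]] by (simp add: add.commute)
    have apart: "e \<inter> nbhd r (piece ?A m x) = {}" if m: "m < n'" "x \<in> centres ?A m" for m x
    proof (rule ccontr)
      assume "e \<inter> nbhd r (piece ?A m x) \<noteq> {}"
      then obtain w b where w: "w \<in> e" "b \<in> piece ?A m x" "sup_dist b w \<le> r" by (auto simp: nbhd_def)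
      obtain a where a: "a \<in> K" "sup_dist a w \<le> r + 7" using w_near[OF w(1)] by (auto simp: nbhd_def)
      have ab: "sup_dist a b \<le> s"
        using sup_dist_triangle[of a b w] sup_dist_sym[of b w] w(3) a(2) wide by linarith
      have wv: "sup_dist w v \<le> 2" using vw[OF w(1)] by (simp add: sup_dist_sym)
      from close_pieces[OF n(1) m(2) a(1)[unfolded K_def] w(2) ab] show False
      proof (elim disjE conjE)
        assume "n = m" "y = x"
        then have "w \<in> nbhd r K" using w by (auto simp: K_def intro: nbhdI)
        then have "v \<in> nbhd (r + 2) K" using nbhd_step wv by blast
        then show False using v_far nbhd_mono[OF order_refl, of "r + 2" "r + 4" K] by auto
      next
        assume "nbhd s (piece ?A n y) \<subseteq> piece ?A m x"
        moreover have "v \<in> nbhd s K" using v_near nbhd_mono[OF order_refl, of "r + 5" s K] wide by auto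
        ultimately show False using lower[OF m] unfolding K_def by blast
      next
        assume "nbhd s (piece ?A m x) \<subseteq> piece ?A n y"
        moreover have "w \<in> nbhd s (piece ?A m x)" using w wide by (auto intro: nbhdI)
        ultimately have "w \<in> K" by (auto simp: K_def)
        then have "v \<in> nbhd (r + 4) K" using wv by (auto intro: nbhdI)
        then show False using v_far by blast
      qed
    qed
    have "e \<noteq> {}" using e(2) by blast
    have "owns \<omega> n' y' e"
      unfolding owns_def
    proof (intro conjI allI impI ballI)
      show "e \<subseteq> piece ?A n' y'"
        using w_near inside(2) nbhd_mono[OF order_refl, of "r + 7" s K] wide by auto
      show "\<not> e \<subseteq> piece ?A m x" if "m < n'" "x \<in> centres ?A m" for m x
        using apart[OF that] subset_nbhd[of "piece ?A m x" r] \<open>e \<noteq> {}\<close> by blast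
    qed (rule y')
    then have "decoration \<omega> e = framed_pattern \<omega> y' e"
      using apart e(1) by (intro decoration_not_near) (auto simp: near_def)
    with \<psi>'(3)[OF e(1)] show ?thesis by simp
  qed
  have "p (k + i) \<in> S" for i
  proof (induction i)
    case 0
    show ?case using S(1) by (simp add: v_def)
  next
    case (Suc i)
    let ?e = "{p (k + i), p (Suc (k + i))}"
    have e: "?e \<in> grid_edges" "?e \<inter> S \<noteq> {}" using p(2) Suc by auto
    have "fst (pattern \<psi>' ?e) = c" using eq[OF e] c[of "k + i"] by simp
    from S(3)[OF e this] show ?case by simp
  qed
  then have "range (\<lambda>i. p (k + i)) \<subseteq> S" by blast
  moreover have "finite S" using S(2) finite_subset finite_cube by blast
  ultimately have "finite (range (\<lambda>i. p (k + i)))" by (rule finite_subset)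
  moreover have "inj (\<lambda>i. p (k + i))" by (rule injI) (use injD[OF p(1)] in force)
  ultimately show False using finite_imageD by blast
qed

end

subsection \<open>Equivariance\<close>

lemma marked_act_labels: "\<gamma> \<in> grid_aut \<Longrightarrow> marked (act_labels \<gamma> \<omega>) = (\<lambda>n. \<gamma> ` marked \<omega> n)"
proof (intro ext set_eqI)
  fix n y assume g: "\<gamma> \<in> grid_aut"
  show "y \<in> marked (act_labels \<gamma> \<omega>) n \<longleftrightarrow> y \<in> \<gamma> ` marked \<omega> n"
    by (simp add: mem_image_grid_aut[OF g] marked_def act_labels_def)
qed

context
  fixes \<gamma> :: "int ^ 'n \<Rightarrow> int ^ 'n" and \<omega> :: "int ^ 'n \<Rightarrow> real"
  assumes \<gamma>: "\<gamma> \<in> grid_aut" and inj: "inj \<omega>"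
begin

lemma covers_act_labels: "covers (marked \<omega>) \<Longrightarrow> covers (marked (act_labels \<gamma> \<omega>))"
  unfolding covers_def
proof (intro allI)
  fix z m assume "\<forall>z m. \<exists>n\<ge>m. \<exists>y\<in>marked \<omega> n. z \<in> cell (marked \<omega>) n y"
  then obtain n y where n: "m \<le> n" "y \<in> marked \<omega> n" "inv \<gamma> z \<in> cell (marked \<omega>) n y" by blast
  have "z = \<gamma> (inv \<gamma> z)" by (simp add: grid_aut_f_inv[OF \<gamma>])
  then have "z \<in> cell (marked (act_labels \<gamma> \<omega>)) n (\<gamma> y)"
    unfolding marked_act_labels[OF \<gamma>] cell_equivariant[OF \<gamma>] using n(3) by blast
  with n show "\<exists>n\<ge>m. \<exists>y\<in>marked (act_labels \<gamma> \<omega>) n. z \<in> cell (marked (act_labels \<gamma> \<omega>)) n y"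
    by (intro exI[of _ n] conjI bexI[of _ "\<gamma> y"]) (simp_all add: marked_act_labels[OF \<gamma>])
qed

lemma piece_act_labels: "piece (marked (act_labels \<gamma> \<omega>)) n (\<gamma> y) = \<gamma> ` piece (marked \<omega>) n y"
  unfolding marked_act_labels[OF \<gamma>] by (rule piece_equivariant[OF \<gamma>])

lemma centres_act_labels: "centres (marked (act_labels \<gamma> \<omega>)) n = \<gamma> ` centres (marked \<omega>) n"
  unfolding marked_act_labels[OF \<gamma>] by (rule centres_equivariant[OF \<gamma>])

lemma inj_\<gamma>: "inj \<gamma>"
  using grid_aut_bij[OF \<gamma>] by (rule bij_is_inj)

lemma owns_act_labels: "owns (act_labels \<gamma> \<omega>) n (\<gamma> y) (\<gamma> ` e) \<longleftrightarrow> owns \<omega> n y e"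
  by (simp add: owns_def piece_act_labels centres_act_labels inj_image_subset_iff[OF inj_\<gamma>]
      inj_image_mem_iff[OF inj_\<gamma>])

lemma near_act_labels: "near (act_labels \<gamma> \<omega>) n m (\<gamma> x) (\<gamma> ` e) \<longleftrightarrow> near \<omega> n m x e"
  by (simp add: near_def piece_act_labels centres_act_labels inj_image_mem_iff[OF inj_\<gamma>]
      nbhd_grid_aut[OF \<gamma>] image_Int[OF inj_\<gamma>, symmetric])

lemma decorated_act_labels:
  assumes "decorated \<omega> n e q"
  shows "decorated (act_labels \<gamma> \<omega>) n (\<gamma> ` e) (map_prod id \<gamma> q)"
proof -
  let ?\<omega>' = "act_labels \<gamma> \<omega>"
  from assms obtain y where y: "owns \<omega> n y e"
    and q: "prescribed \<omega> n y e q"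
    unfolding decorated_def by blast
  note fr = frame_equivariant[OF \<gamma> inj] and aut = frame_grid_aut[OF inj]
  have y': "owns ?\<omega>' n (\<gamma> y) (\<gamma> ` e)" using y by (simp add: owns_act_labels)
  from q[unfolded prescribed_def] show ?thesis
  proof
    assume "\<exists>m x. near \<omega> n m x e \<and> q = layer \<omega> m x y e"
    then obtain m x where m: "near \<omega> n m x e" "q = layer \<omega> m x y e" by blast
    have "layer ?\<omega>' m (\<gamma> x) (\<gamma> y) (\<gamma> ` e) = map_prod id \<gamma> q"
      by (simp add: piece_act_labels fr interpolation_equivariant[OF \<gamma> aut aut] transport_image[OF \<gamma>] m(2))
    moreover have "near ?\<omega>' n m (\<gamma> x) (\<gamma> ` e)" using m(1) by (simp add: near_act_labels)
    ultimately show ?thesis unfolding decorated_def prescribed_def using y' by metis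
  next
    assume nn: "\<not> (\<exists>m x. near \<omega> n m x e) \<and> q = framed_pattern \<omega> y e"
    have "\<not> near ?\<omega>' n m x (\<gamma> ` e)" for m x
      using nn near_act_labels[of n m "inv \<gamma> x" e] by (simp add: grid_aut_f_inv[OF \<gamma>])
    moreover have "framed_pattern ?\<omega>' (\<gamma> y) (\<gamma> ` e) = map_prod id \<gamma> q"
      using nn by (simp add: fr transport_comp[OF \<gamma> aut] transport_image[OF \<gamma>])
    ultimately show ?thesis unfolding decorated_def prescribed_def using y' by metis
  qed
qed

lemma decoration_act_labels:
  assumes "covers (marked \<omega>)" "e \<in> grid_edges"
  shows "decoration (act_labels \<gamma> \<omega>) (\<gamma> ` e) = map_prod id \<gamma> (decoration \<omega> e)"
proof -
  obtain n q where q: "decorated \<omega> n e q" using ex_decorated[OF inj assms] by blast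
  have "\<gamma> ` e \<in> grid_edges" using assms(2) by (simp add: grid_aut_image_edge[OF \<gamma>])
  from decoration_eqI[OF decorated_act_labels[OF q] this] decoration_eqI[OF q assms(2)] show ?thesis by simp
qed

lemma act_decoration_decoration:
  assumes "covers (marked \<omega>)"
  shows "act_decoration grid_edges \<gamma> (factor \<omega>) =
    factor (act_labels \<gamma> \<omega>)"
proof
  fix e
  show "act_decoration grid_edges \<gamma> (factor \<omega>) e =
    factor (act_labels \<gamma> \<omega>) e"
  proof (cases "e \<in> grid_edges")
    case True
    then obtain e' where e': "e' \<in> grid_edges" "e = \<gamma> ` e'" using grid_edge_image_inv[OF \<gamma>] by blast
    have "inv \<gamma> ` e = e'" by (simp add: e' image_image grid_aut_inv_f[OF \<gamma>])
    then show ?thesis using True e' decoration_act_labels[OF assms e'(1)] by (simp add: act_decoration_def)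
  qed (simp add: act_decoration_def)
qed

end

end

subsection \<open>Locality and measurability\<close>

lemma sets_if_determined_by_finitely_many:
  fixes J :: "'j set"
  assumes "finite J" and J: "\<And>j. j \<in> J \<Longrightarrow> {\<omega> \<in> space M. P j \<omega>} \<in> sets M"
    and det: "\<And>\<omega> \<omega>'. \<omega> \<in> space M \<Longrightarrow> \<omega>' \<in> space M \<Longrightarrow> (\<And>j. j \<in> J \<Longrightarrow> P j \<omega> \<longleftrightarrow> P j \<omega>') \<Longrightarrow> Q \<omega> \<Longrightarrow> Q \<omega>'"
  shows "{\<omega> \<in> space M. Q \<omega>} \<in> sets M"
proof -
  let ?T = "{T \<in> Pow J. \<exists>\<omega>\<in>space M. Q \<omega> \<and> T = {j \<in> J. P j \<omega>}}"
  define atom where "atom T = {\<omega> \<in> space M. \<forall>j\<in>J. P j \<omega> \<longleftrightarrow> j \<in> T}" for T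
  have "atom T \<in> sets M" for T
    unfolding atom_def
  proof (rule sets.sets_Collect_finite_All[OF _ \<open>finite J\<close>])
    show "{\<omega> \<in> space M. P j \<omega> \<longleftrightarrow> j \<in> T} \<in> sets M" if "j \<in> J" for j
      using J[OF that] sets.sets_Collect_neg[OF J[OF that]] by (cases "j \<in> T") simp_all
  qed
  then have "(\<Union>T\<in>?T. atom T) \<in> sets M"
    using \<open>finite J\<close> by (intro sets.finite_UN) auto
  also have "(\<Union>T\<in>?T. atom T) = {\<omega> \<in> space M. Q \<omega>}"
  proof (intro equalityI subsetI)
    fix \<omega> assume "\<omega> \<in> (\<Union>T\<in>?T. atom T)"
    then obtain \<omega>' where "\<omega>' \<in> space M" "Q \<omega>'" "\<omega> \<in> atom {j \<in> J. P j \<omega>'}" by blast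
    then show "\<omega> \<in> {\<omega> \<in> space M. Q \<omega>}" using det[of \<omega>' \<omega>] by (auto simp: atom_def)
  next
    fix \<omega> assume w: "\<omega> \<in> {\<omega> \<in> space M. Q \<omega>}"
    then have "\<omega> \<in> atom {j \<in> J. P j \<omega>}" by (auto simp: atom_def)
    with w show "\<omega> \<in> (\<Union>T\<in>?T. atom T)"
      by (intro UN_I[of "{j \<in> J. P j \<omega>}"]) auto
  qed
  finally show ?thesis .
qed

lemma label_measurable [measurable]: "(\<lambda>\<omega>. \<omega> v) \<in> borel_measurable iid"
proof -
  have "(\<lambda>\<omega>. \<omega> v) \<in> iid \<rightarrow>\<^sub>M restrict_space lborel {0..1}"
    unfolding iid_def by (rule measurable_component_singleton) simp
  moreover have "(\<lambda>x. x) \<in> restrict_space lborel {0..1::real} \<rightarrow>\<^sub>M borel"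
    by (rule measurable_restrict_space1) simp
  ultimately show ?thesis by (rule measurable_compose)
qed

context toast_decoration begin

text \<open>An edge that is decided on at level \<open>n\<close> depends on comparisons of finitely many labels, with the first
  thresholds and with each other.  This gives measurability as well as finitarity.\<close>

definition same_data :: "nat \<Rightarrow> nat \<Rightarrow> int ^ 'n \<Rightarrow> (int ^ 'n \<Rightarrow> real) \<Rightarrow> (int ^ 'n \<Rightarrow> real) \<Rightarrow> bool" where
  "same_data n \<rho> z \<omega> \<omega>' \<longleftrightarrow> agree n \<rho> z (marked \<omega>) (marked \<omega>') \<and>
     (\<forall>u\<in>cube z \<rho>. \<forall>v\<in>cube z \<rho>. \<omega> u < \<omega> v \<longleftrightarrow> \<omega>' u < \<omega>' v)"

lemma same_data_if_eq: "(\<And>y. y \<in> cube z \<rho> \<Longrightarrow> \<omega>' y = \<omega> y) \<Longrightarrow> same_data n \<rho> z \<omega> \<omega>'"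
  by (simp add: same_data_def agree_def marked_def)

lemma sets_if_same_data:
  assumes "\<And>\<omega> \<omega>'. same_data n \<rho> z \<omega> \<omega>' \<Longrightarrow> Q \<omega> \<Longrightarrow> Q \<omega>'"
  shows "{\<omega> \<in> space iid. Q \<omega>} \<in> sets iid"
proof (rule sets_if_determined_by_finitely_many)
  let ?J = "({..n} \<times> cube z \<rho>) <+> (cube z \<rho> \<times> cube z \<rho>)"
  let ?P = "\<lambda>j \<omega>. case j of Inl (m, y) \<Rightarrow> \<omega> y < \<theta> m | Inr (u, v) \<Rightarrow> \<omega> u < \<omega> v"
  show "finite ?J" by simp
  show "{\<omega> \<in> space iid. ?P j \<omega>} \<in> sets iid" for j
    by (cases j) (auto split: prod.split)
  fix \<omega> \<omega>' :: "int ^ 'n \<Rightarrow> real"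
  assume eq: "\<And>j. j \<in> ?J \<Longrightarrow> ?P j \<omega> \<longleftrightarrow> ?P j \<omega>'" and "Q \<omega>"
  have "\<omega> y < \<theta> m \<longleftrightarrow> \<omega>' y < \<theta> m" if "m \<le> n" "y \<in> cube z \<rho>" for m y
    using eq[of "Inl (m, y)"] that by auto
  moreover have "\<omega> u < \<omega> v \<longleftrightarrow> \<omega>' u < \<omega>' v" if "u \<in> cube z \<rho>" "v \<in> cube z \<rho>" for u v
    using eq[of "Inr (u, v)"] that by auto
  ultimately have "same_data n \<rho> z \<omega> \<omega>'" by (simp add: same_data_def agree_def marked_def)
  with \<open>Q \<omega>\<close> show "Q \<omega>'" by (rule assms[rotated])
qed

lemma decorated_local:
  obtains \<rho> where "\<And>\<omega> \<omega>' z e q. e \<in> grid_edges \<Longrightarrow> z \<in> e \<Longrightarrow> same_data n \<rho> z \<omega> \<omega>' \<Longrightarrow>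
    decorated \<omega> n e q \<Longrightarrow> decorated \<omega>' n e q"
proof -
  have "\<forall>m. \<exists>\<rho>. \<forall>(z :: int ^ 'n) A A'. agree m \<rho> z A A' \<longrightarrow>
    at_centres A m (piece A m) z = at_centres A' m (piece A' m) z"
    using piece_local unfolding local_to_def by blast
  from choice[OF this] obtain f where f: "\<forall>m. \<forall>(z :: int ^ 'n) A A'. agree m (f m) z A A' \<longrightarrow>
    at_centres A m (piece A m) z = at_centres A' m (piece A' m) z" by (rule exE)
  define k where "k = (\<Sum>m\<le>n. R m + E m + 4 * s) + r + 1"
  define \<rho> where "\<rho> = k + 1 + (\<Sum>m\<le>n. f m)"
  have k: "R m + E m + 4 * s + r + 1 \<le> k" if "m \<le> n" for m
    using that member_le_sum[of m "{..n}" "\<lambda>m. R m + E m + 4 * s"] by (simp add: k_def)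
  have "decorated \<omega>' n e q"
    if e: "e \<in> grid_edges" "z \<in> e" and same: "same_data n \<rho> z \<omega> \<omega>'" and dec: "decorated \<omega> n e q"
    for \<omega> \<omega>' :: "int ^ 'n \<Rightarrow> real" and z e q
  proof -
    have eq: "(y \<in> centres (marked \<omega>) m \<longleftrightarrow> y \<in> centres (marked \<omega>') m) \<and>
      (y \<in> centres (marked \<omega>) m \<longrightarrow> piece (marked \<omega>) m y = piece (marked \<omega>') m y)"
      if "m \<le> n" "y \<in> cube z k" for m y
    proof -
      have "f m \<le> (\<Sum>m\<le>n. f m)" using that(1) by (intro member_le_sum) auto
      then have "sup_dist z y + f m \<le> \<rho>" using that(2) by (simp add: \<rho>_def cube_def)
      with same that(1) have "agree m (f m) y (marked \<omega>) (marked \<omega>')"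
        unfolding same_data_def by (blast intro: agree_mono)
      from f[rule_format, OF this] show ?thesis by (simp add: at_centres_eq_iff)
    qed
    have fr: "frame \<omega> y = frame \<omega>' y" if "y \<in> cube z k" for y
    proof (rule frame_local)
      have sub: "cube y 1 \<subseteq> cube z \<rho>" using that by (intro cube_mono) (auto simp: cube_def \<rho>_def)
      show "\<omega> u < \<omega> v \<longleftrightarrow> \<omega>' u < \<omega>' v" if "u \<in> cube y 1" "v \<in> cube y 1" for u v
        using same sub that unfolding same_data_def by blast
    qed
    have near_cube: "x \<in> cube z k"
      if "x \<in> centres (marked \<alpha>) m" "e \<inter> nbhd r (piece (marked \<alpha>) m x) \<noteq> {}" "m \<le> n" for \<alpha> m x
    proof -
      obtain w b where w: "w \<in> e" "b \<in> piece (marked \<alpha>) m x" "sup_dist b w \<le> r"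
        using \<open>e \<inter> nbhd r (piece (marked \<alpha>) m x) \<noteq> {}\<close> by (auto simp: nbhd_def)
      have "sup_dist x b \<le> R m + E m + 4 * s"
        using piece_subset_cube[OF that(1)] w(2) by (auto simp: cube_def)
      moreover have "sup_dist w z \<le> 1" using edge_sup_dist[OF e(1) w(1) e(2)] .
      moreover have "sup_dist x z \<le> sup_dist x b + (sup_dist b w + sup_dist w z)"
        using sup_dist_triangle[of x z b] sup_dist_triangle[of b z w] by linarith
      ultimately show ?thesis using w(3) k[OF that(3)] by (simp add: cube_def sup_dist_sym)
    qed
    have subset_cube: "x \<in> cube z k"
      if "x \<in> centres (marked \<alpha>) m" "e \<subseteq> piece (marked \<alpha>) m x" "m \<le> n" for \<alpha> m x
      using near_cube[OF that(1) _ that(3)] that(2) e(2) subset_nbhd[of "piece (marked \<alpha>) m x" r] by blast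
    have near: "near \<omega> n m x e \<longleftrightarrow> near \<omega>' n m x e" for m x
    proof (cases "m < n \<and> x \<in> cube z k")
      case True
      then have "m \<le> n" "x \<in> cube z k" by simp_all
      from eq[OF this] show ?thesis unfolding near_def by metis
    next
      case False
      then show ?thesis using near_cube[of x _ m] unfolding near_def by (meson less_imp_le)
    qed
    have near': "x \<in> cube z k" "m \<le> n" "x \<in> centres (marked \<omega>) m" if "near \<omega> n m x e" for m x
      using near_cube[of x \<omega> m] that unfolding near_def by (simp_all add: less_imp_le)
    obtain y where y: "owns \<omega> n y e"
      and q: "prescribed \<omega> n y e q"
      using dec unfolding decorated_def by blast
    have yk: "y \<in> cube z k" using y by (intro subset_cube) (auto simp: owns_def)
    have "owns \<omega>' n y e"
      unfolding owns_def
    proof (intro conjI allI impI ballI notI)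
      show "y \<in> centres (marked \<omega>') n" "e \<subseteq> piece (marked \<omega>') n y"
        using y eq[OF order_refl yk] by (auto simp: owns_def)
      fix m x assume m: "m < n" "x \<in> centres (marked \<omega>') m" "e \<subseteq> piece (marked \<omega>') m x"
      then have "x \<in> cube z k" by (intro subset_cube) auto
      with m eq[of m x] have "x \<in> centres (marked \<omega>) m" "e \<subseteq> piece (marked \<omega>) m x" by simp_all
      with m(1) y show False unfolding owns_def by blast
    qed
    moreover have "layer \<omega> m x y e = layer \<omega>' m x y e" if "near \<omega> n m x e" for m x
      using near'[OF that] fr yk eq[of m x] by simp
    ultimately show ?thesis
      using q unfolding decorated_def prescribed_def near[symmetric] fr[OF yk] by metis
  qed
  then show ?thesis by (rule that)
qed

definition domain :: "(int ^ 'n \<Rightarrow> real) set" where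
  "domain = {\<omega> \<in> space iid. inj \<omega> \<and> covers (marked \<omega>)}"

lemma covered_sets: "{\<omega> \<in> space iid. \<exists>y\<in>marked \<omega> n. z \<in> cell (marked \<omega>) n y} \<in> sets iid"
proof -
  obtain \<rho> where "\<forall>(y :: int ^ 'n) A A'. agree n \<rho> y A A' \<longrightarrow> cell A n y = cell A' n y"
    using cell_local unfolding local_to_def by (rule exE)
  note \<rho> = this[rule_format]
  show ?thesis
  proof (rule sets_if_same_data[of n "R n + \<rho>" z])
    fix \<omega> \<omega>' assume same: "same_data n (R n + \<rho>) z \<omega> \<omega>'" and "\<exists>y\<in>marked \<omega> n. z \<in> cell (marked \<omega>) n y"
    then obtain y where y: "y \<in> marked \<omega> n" "z \<in> cell (marked \<omega>) n y" by blast
    then have d: "sup_dist z y \<le> R n" by (simp add: cell_def)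
    then have "y \<in> marked \<omega>' n" using same y(1) by (auto simp: same_data_def agree_def cube_def)
    moreover have "cell (marked \<omega>) n y = cell (marked \<omega>') n y"
    proof (rule \<rho>, rule agree_mono)
      show "agree n (R n + \<rho>) z (marked \<omega>) (marked \<omega>')" using same by (simp add: same_data_def)
      show "sup_dist z y + \<rho> \<le> R n + \<rho>" using d by simp
    qed simp
    ultimately show "\<exists>y\<in>marked \<omega>' n. z \<in> cell (marked \<omega>') n y" using y(2) by blast
  qed
qed

lemma domain_sets: "domain \<in> sets iid"
proof -
  have "{\<omega> \<in> space iid. \<omega> u = \<omega> v \<longrightarrow> u = v} \<in> sets iid" for u v :: "int ^ 'n"
    by (intro sets.sets_Collect_imp sets.sets_Collect_const borel_measurable_eq label_measurable)
  then have "{\<omega> \<in> space iid. inj (\<omega> :: int ^ 'n \<Rightarrow> real)} \<in> sets iid"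
    unfolding inj_def by (intro sets.sets_Collect_countable_All)
  moreover have "{\<omega> \<in> space iid. \<forall>z m. \<exists>n. m \<le> n \<and> (\<exists>y\<in>marked \<omega> n. z \<in> cell (marked \<omega>) n y)} \<in> sets iid"
    by (intro sets.sets_Collect_countable_All sets.sets_Collect_countable_Ex sets.sets_Collect_conj
        sets.sets_Collect_const covered_sets)
  ultimately have "{\<omega> \<in> space iid. inj \<omega> \<and> (\<forall>z m. \<exists>n. m \<le> n \<and> (\<exists>y\<in>marked \<omega> n. z \<in> cell (marked \<omega>) n y))} \<in> sets iid"
    by (intro sets.sets_Collect_conj)
  then show ?thesis by (simp add: domain_def covers_def)
qed

lemma act_labels_domain:
  assumes \<gamma>: "\<gamma> \<in> grid_aut" and "\<omega> \<in> domain" shows "act_labels \<gamma> \<omega> \<in> domain"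
proof -
  have "act_labels \<gamma> \<omega> \<in> space iid"
    using assms(2) by (simp add: domain_def iid_def space_PiM PiE_iff act_labels_def)
  then show ?thesis
    using assms covers_act_labels[OF \<gamma>, of \<omega>] by (simp add: domain_def inj_act_labels)
qed

lemma schreier_decoration_decoration:
  assumes "\<omega> \<in> domain"
  shows "schreier_decoration grid_edges CARD('n) (factor \<omega>)"
  unfolding schreier_decoration_iff
  using assms schreier_at_decoration[of \<omega>] unfolding domain_def by blast

lemma decoration_measurable:
  "(\<lambda>\<omega>. factor \<omega>) \<in> restrict_space iid domain \<rightarrow>\<^sub>M decoration_space grid_edges CARD('n)"
  unfolding decoration_space_def
proof (rule measurable_restrict)
  fix e :: "(int ^ 'n) set" assume e: "e \<in> grid_edges"
  obtain z where z: "z \<in> e" using e by (auto simp: grid_edges_eq edge_def)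
  have sp: "space (restrict_space iid domain) = domain"
    using sets.sets_into_space[OF domain_sets] by (auto simp: space_restrict_space)
  have fin: "finite ({..<CARD('n)} \<times> e)" using edge_finite[OF e] by simp
  show "(\<lambda>\<omega>. decoration \<omega> e) \<in> restrict_space iid domain \<rightarrow>\<^sub>M count_space ({..<CARD('n)} \<times> e)"
  proof (unfold measurable_count_space_eq2[OF fin], intro conjI ballI)
    show "(\<lambda>\<omega>. decoration \<omega> e) \<in> space (restrict_space iid domain) \<rightarrow> {..<CARD('n)} \<times> e"
      unfolding sp
    proof
      fix \<omega> assume "\<omega> \<in> domain"
      then have "factor \<omega> \<in> (\<Pi>\<^sub>E e\<in>grid_edges. {..<CARD('n)} \<times> e)"
        using schreier_decoration_decoration unfolding schreier_decoration_def by blast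
      from PiE_mem[OF this e] show "decoration \<omega> e \<in> {..<CARD('n)} \<times> e" using e by simp
    qed
    fix q
    have "{\<omega> \<in> space iid. decorated \<omega> n e q} \<in> sets iid" for n
    proof -
      obtain \<rho> where "\<And>\<omega> \<omega>' z e q. e \<in> grid_edges \<Longrightarrow> z \<in> e \<Longrightarrow> same_data n \<rho> z \<omega> \<omega>' \<Longrightarrow>
        decorated \<omega> n e q \<Longrightarrow> decorated \<omega>' n e q"
        using decorated_local[of n] by blast
      with e z show ?thesis by (intro sets_if_same_data[of n \<rho> z]) blast
    qed
    then have "domain \<inter> (\<Union>n. {\<omega> \<in> space iid. decorated \<omega> n e q}) \<in> sets iid"
      using domain_sets by blast
    also have "domain \<inter> (\<Union>n. {\<omega> \<in> space iid. decorated \<omega> n e q}) = (\<lambda>\<omega>. decoration \<omega> e) -` {q} \<inter> domain"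
    proof (intro equalityI subsetI)
      fix \<omega> assume "\<omega> \<in> (\<lambda>\<omega>. decoration \<omega> e) -` {q} \<inter> domain"
      then have w: "decoration \<omega> e = q" "\<omega> \<in> domain" by auto
      then obtain n q' where d: "decorated \<omega> n e q'" using ex_decorated[OF _ _ e, of \<omega>] by (auto simp: domain_def)
      with w decoration_eqI[OF d e] show "\<omega> \<in> domain \<inter> (\<Union>n. {\<omega> \<in> space iid. decorated \<omega> n e q})"
        by (auto simp: domain_def)
    qed (auto intro: decoration_eqI[OF _ e])
    finally show "(\<lambda>\<omega>. decoration \<omega> e) -` {q} \<inter> space (restrict_space iid domain) \<in> sets (restrict_space iid domain)"
      unfolding sp using domain_sets by (simp add: sets_restrict_space_iff)
  qed
qed

lemma decoration_finitary_at:
  assumes \<omega>: "\<omega> \<in> domain"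
  shows "\<exists>R. \<forall>\<omega>'\<in>domain. (\<forall>y\<in>graph_ball grid_edges x R. \<omega>' y = \<omega> y) \<longrightarrow>
    (\<forall>e\<in>grid_edges. x \<in> e \<longrightarrow> decoration \<omega>' e = decoration \<omega> e)"
proof -
  have "\<exists>k. \<forall>\<omega>'. (\<forall>y\<in>cube x k. \<omega>' y = \<omega> y) \<longrightarrow> decoration \<omega>' e = decoration \<omega> e"
    if e: "e \<in> grid_edges" "x \<in> e" for e
  proof -
    obtain n q where d: "decorated \<omega> n e q" using ex_decorated[OF _ _ e(1), of \<omega>] \<omega> by (auto simp: domain_def)
    obtain \<rho> where \<rho>: "\<And>\<omega> \<omega>' z e q. e \<in> grid_edges \<Longrightarrow> z \<in> e \<Longrightarrow> same_data n \<rho> z \<omega> \<omega>' \<Longrightarrow>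
      decorated \<omega> n e q \<Longrightarrow> decorated \<omega>' n e q"
      using decorated_local[of n] by blast
    have "decoration \<omega>' e = decoration \<omega> e" if "\<forall>y\<in>cube x \<rho>. \<omega>' y = \<omega> y" for \<omega>'
    proof -
      have "same_data n \<rho> x \<omega> \<omega>'" using that by (intro same_data_if_eq) blast
      then have "decorated \<omega>' n e q" using \<rho>[OF e _ d] by blast
      with d show ?thesis using decoration_eqI e(1) by metis
    qed
    then show ?thesis by blast
  qed
  then obtain k where k: "\<And>e \<omega>'. e \<in> grid_edges \<Longrightarrow> x \<in> e \<Longrightarrow> (\<forall>y\<in>cube x (k e). \<omega>' y = \<omega> y) \<Longrightarrow>
    decoration \<omega>' e = decoration \<omega> e" by metis
  let ?k = "Max (k ` {e \<in> grid_edges. x \<in> e})"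
  obtain R where R: "cube x ?k \<subseteq> graph_ball grid_edges x R" by (rule cube_subset_graph_ball)
  show ?thesis
  proof (intro exI[of _ R] ballI impI)
    fix \<omega>' e assume w: "\<forall>y\<in>graph_ball grid_edges x R. \<omega>' y = \<omega> y" and e: "e \<in> grid_edges" "x \<in> e"
    have "k e \<le> ?k" using e finite_edges_at[of x] by (intro Max_ge) auto
    then have "cube x (k e) \<subseteq> cube x ?k" by (intro cube_mono) simp
    with R w show "decoration \<omega>' e = decoration \<omega> e" by (intro k[OF e]) blast
  qed
qed

end

section \<open>The cells cover with high probability\<close>

abbreviation unit_interval :: "real measure" where
  "unit_interval \<equiv> restrict_space lborel {0..1}"

lemma prob_space_unit_interval: "prob_space unit_interval"
  by (rule prob_space_restrict_space) auto

interpretation labels: product_prob_space "\<lambda>_. unit_interval" UNIV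
  by (rule product_prob_spaceI) (rule prob_space_unit_interval)

lemma prob_space_iid: "prob_space (iid :: ('v \<Rightarrow> real) measure)"
  unfolding iid_def by (rule prob_space_PiM) (rule prob_space_unit_interval)

interpretation iid: prob_space "iid :: ('v \<Rightarrow> real) measure"
  by (rule prob_space_iid)

lemma unit_interval_subset:
  assumes "S \<in> sets borel" "S \<subseteq> {0..1}"
  shows "S \<in> sets unit_interval" "measure unit_interval S = measure lborel S"
  using assms by (simp_all add: sets_restrict_space_iff measure_restrict_space)

lemma prob_labels:
  assumes "finite J" "\<And>v. v \<in> J \<Longrightarrow> X v \<in> sets unit_interval"
  shows "iid.prob {\<omega> \<in> space iid. \<forall>v\<in>J. \<omega> v \<in> X v} = (\<Prod>v\<in>J. measure unit_interval (X v))"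
proof -
  have "emeasure iid {\<omega> \<in> space iid. \<forall>v\<in>J. \<omega> v \<in> X v} = (\<Prod>v\<in>J. emeasure unit_interval (X v))"
    unfolding iid_def using assms by (intro labels.emeasure_PiM_Collect) auto
  also have "\<dots> = (\<Prod>v\<in>J. ennreal (measure unit_interval (X v)))"
    by (intro prod.cong refl) (simp add: finite_measure.emeasure_eq_measure prob_space.finite_measure[OF prob_space_unit_interval])
  also have "\<dots> = ennreal (\<Prod>v\<in>J. measure unit_interval (X v))" by (simp add: prod_ennreal)
  finally show ?thesis by (simp add: measure_def prod_nonneg)
qed

lemma space_iid: "space iid = {\<omega>. \<forall>v. \<omega> v \<in> {0..1}}"
  by (auto simp: iid_def space_PiM space_restrict_space PiE_def Pi_def extensional_def)

lemma prob_all_less: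
  fixes J :: "'v set"
  assumes "finite J" "0 \<le> p" "p \<le> 1"
  shows "iid.prob {\<omega> \<in> space iid. \<forall>v\<in>J. \<omega> v < p} = p ^ card J"
proof -
  have "{\<omega> \<in> space iid. \<forall>v\<in>J. \<omega> v < p} = {\<omega> \<in> space iid. \<forall>v\<in>J. \<omega> v \<in> {0..<p}}"
    by (auto simp: space_iid)
  also have "iid.prob \<dots> = (\<Prod>v\<in>J. p)"
    using assms by (subst prob_labels) (simp_all add: unit_interval_subset subset_iff)
  finally show ?thesis by simp
qed

lemma prob_all_not_less:
  fixes J :: "'v set"
  assumes "finite J" "0 \<le> p" "p \<le> 1"
  shows "iid.prob {\<omega> \<in> space iid. \<forall>v\<in>J. \<not> \<omega> v < p} = (1 - p) ^ card J"
proof -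
  have "{\<omega> \<in> space iid. \<forall>v\<in>J. \<not> \<omega> v < p} = {\<omega> \<in> space iid. \<forall>v\<in>J. \<omega> v \<in> {p..1}}"
    by (auto simp: space_iid)
  also have "iid.prob \<dots> = (\<Prod>v\<in>J. 1 - p)"
    using assms by (subst prob_labels) (simp_all add: unit_interval_subset subset_iff)
  finally show ?thesis by simp
qed

lemma label_less_sets: "{\<omega> \<in> space iid. \<forall>v\<in>J. \<omega> v < p} \<in> sets iid" if "finite J"
  using that by (intro sets.sets_Collect_finite_All borel_measurable_less label_measurable) auto

lemma label_not_less_sets: "{\<omega> \<in> space iid. \<forall>v\<in>J. \<not> \<omega> v < p} \<in> sets iid" if "finite J"
  using that by (intro sets.sets_Collect_finite_All sets.sets_Collect_neg borel_measurable_less label_measurable) auto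

text \<open>Two labels lie in a common interval of length \<open>1 / N\<close> with probability \<open>1 / N\<close>.\<close>

lemma AE_labels_distinct:
  assumes "u \<noteq> v" shows "AE \<omega> in iid. \<omega> u \<noteq> \<omega> v"
proof -
  define D where "D = {\<omega> \<in> space (iid :: ('a \<Rightarrow> real) measure). \<omega> u = \<omega> v}"
  have D: "D \<in> sets iid" unfolding D_def by (intro borel_measurable_eq label_measurable)
  have bound: "iid.prob D \<le> 1 / real (Suc N)" for N
  proof -
    let ?N = "real (Suc N)"
    define I where "I k = {real k / ?N..(real k + 1) / ?N}" for k :: nat
    define C where "C k = {\<omega> \<in> space (iid :: ('a \<Rightarrow> real) measure). \<forall>w\<in>{u, v}. \<omega> w \<in> I k}" for k
    have I: "I k \<in> sets unit_interval" "measure unit_interval (I k) = 1 / ?N" if "k < Suc N" for k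
    proof -
      have sub: "I k \<subseteq> {0..1}" using that by (auto simp: I_def field_simps)
      then show "I k \<in> sets unit_interval" by (intro unit_interval_subset) (simp_all add: I_def)
      have "measure unit_interval (I k) = measure lborel (I k)"
        using sub by (intro unit_interval_subset) (simp_all add: I_def)
      also have "\<dots> = 1 / ?N" by (simp add: I_def field_simps)
      finally show "measure unit_interval (I k) = 1 / ?N" .
    qed
    have C: "C k \<in> sets iid" for k
      unfolding C_def I_def by (intro sets.sets_Collect_finite_All) (auto intro!: borel_measurable_le sets.sets_Collect_conj simp: label_measurable)
    have pC: "iid.prob (C k) = 1 / ?N * (1 / ?N)" if "k < Suc N" for k
      unfolding C_def using I[OF that] assms by (subst prob_labels) auto
    have "D \<subseteq> (\<Union>k<Suc N. C k)"
    proof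
      fix \<omega> assume w: "\<omega> \<in> D"
      then have u: "0 \<le> \<omega> u" "\<omega> u \<le> 1" by (auto simp: D_def space_iid)
      \<comment> \<open>The value \<open>1\<close> belongs to the last one of the intervals, which are closed.\<close>
      define k where "k = (if \<omega> u = 1 then N else nat \<lfloor>\<omega> u * ?N\<rfloor>)"
      have "k < Suc N \<and> real k \<le> \<omega> u * ?N \<and> \<omega> u * ?N \<le> real k + 1"
      proof (cases "\<omega> u = 1")
        case False
        then have "\<omega> u * ?N < ?N" using u by simp
        then have "nat \<lfloor>\<omega> u * ?N\<rfloor> < Suc N" using u by (simp add: nat_less_iff floor_less_iff)
        moreover have "real (nat \<lfloor>\<omega> u * ?N\<rfloor>) = of_int \<lfloor>\<omega> u * ?N\<rfloor>" using u by simp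
        ultimately show ?thesis unfolding k_def if_not_P[OF False] by linarith
      qed (simp add: k_def)
      then have "\<omega> u \<in> I k" "k < Suc N" by (auto simp: I_def field_simps)
      with w show "\<omega> \<in> (\<Union>k<Suc N. C k)" by (auto simp: C_def D_def)
    qed
    then have "iid.prob D \<le> iid.prob (\<Union>k<Suc N. C k)"
      using C by (intro iid.finite_measure_mono) auto
    also have "\<dots> \<le> (\<Sum>k<Suc N. iid.prob (C k))"
      using C by (intro iid.finite_measure_subadditive_finite) auto
    also have "\<dots> = (\<Sum>k<Suc N. 1 / ?N * (1 / ?N))" by (intro sum.cong) (simp_all add: pC)
    also have "\<dots> = 1 / ?N" by simp
    finally show ?thesis .
  qed
  have "iid.prob D = 0"
  proof (rule ccontr)
    assume "iid.prob D \<noteq> 0"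
    then have "0 < iid.prob D" by (simp add: zero_less_measure_iff)
    then obtain N where "1 / real (Suc N) < iid.prob D" using nat_approx_posE by blast
    with bound[of N] show False by simp
  qed
  then have "emeasure iid D = 0" by (simp add: iid.emeasure_eq_measure)
  with D show ?thesis by (intro AE_I[of _ _ D]) (auto simp: D_def)
qed

lemma power_diff_le:
  fixes a b :: real assumes "0 \<le> b" "b \<le> a"
  shows "a ^ Suc n - b ^ Suc n \<le> real (Suc n) * (a - b) * a ^ n"
proof (induction n)
  case (Suc n)
  have "a ^ Suc (Suc n) - b ^ Suc (Suc n) = a * (a ^ Suc n - b ^ Suc n) + (a - b) * b ^ Suc n"
    by (simp add: algebra_simps)
  also have "\<dots> \<le> a * (real (Suc n) * (a - b) * a ^ n) + (a - b) * a ^ Suc n"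
    using assms Suc by (intro add_mono mult_left_mono power_mono) auto
  also have "\<dots> = real (Suc (Suc n)) * (a - b) * a ^ Suc n" by (simp add: algebra_simps)
  finally show ?case .
qed simp

text \<open>A shell of bounded width has as many points as the surface of a cube, up to a constant.\<close>

lemma card_shell:
  fixes z :: "int ^ 'n::finite"
  assumes "k \<le> K"
  shows "real (card {w. k \<le> sup_dist z w \<and> sup_dist z w < k + G}) \<le>
    real CARD('n) * (2 * real G) * (2 * real (K + G)) ^ (CARD('n) - 1)"
proof (cases "G = 0")
  case False
  let ?d = "CARD('n)"
  obtain d' where d': "?d = Suc d'" using zero_less_card_finite not0_implies_Suc by (metis not_gr_zero)
  define b where "b = (if k = 0 then 0 else 2 * real k - 1)"
  have outer: "{w. k \<le> sup_dist z w \<and> sup_dist z w < k + G} = cube z (k + G - 1) - {w. sup_dist z w < k}"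
    using False by (auto simp: cube_def)
  have inner: "finite {w. sup_dist z w < k} \<and> real (card {w. sup_dist z w < k}) = b ^ ?d"
  proof (cases "k = 0")
    case False
    then have "{w. sup_dist z w < k} = cube z (k - 1)" by (auto simp: cube_def)
    moreover have "real (2 * (k - 1) + 1) = b" using False by (simp add: b_def of_nat_diff)
    ultimately show ?thesis by (simp only: card_cube of_nat_power finite_cube simp_thms)
  qed (simp add: b_def)
  have "{w. sup_dist z w < k} \<subseteq> cube z (k + G - 1)" using False by (auto simp: cube_def)
  then have "real (card {w. k \<le> sup_dist z w \<and> sup_dist z w < k + G}) =
      real (card (cube z (k + G - 1))) - real (card {w. sup_dist z w < k})"
    unfolding outer using inner by (simp add: card_Diff_subset of_nat_diff card_mono)
  also have "\<dots> = (2 * real (k + G) - 1) ^ ?d - b ^ ?d"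
    using False inner by (simp add: card_cube of_nat_diff algebra_simps)
  also have "\<dots> \<le> real ?d * ((2 * real (k + G) - 1) - b) * (2 * real (k + G) - 1) ^ d'"
    unfolding d' using False by (intro power_diff_le) (auto simp: b_def)
  also have "\<dots> \<le> real ?d * (2 * real G) * (2 * real (K + G)) ^ d'"
    using assms False by (intro mult_mono power_mono mult_nonneg_nonneg) (auto simp: b_def)
  finally show ?thesis by (simp add: d')
next
  case True
  then have "{w. k \<le> sup_dist z w \<and> sup_dist z w < k + G} = {}" by auto
  then show ?thesis by (simp only: card.empty) (simp add: True)
qed

text \<open>If \<open>z\<close> is in no cell, then either there are no marked points within distance \<open>R\<close>, or the nearest one has a
  rival which is further away by less than \<open>G\<close>.  The second term counts the possible pairs.\<close>

definition miss_bound :: "nat \<Rightarrow> nat \<Rightarrow> nat \<Rightarrow> real \<Rightarrow> real" where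
  "miss_bound d R G p = (1 - p) ^ ((2 * R + 1) ^ d) +
    real ((2 * R + 1) ^ d) * (real d * (2 * real G) * (2 * real (R + G)) ^ (d - 1)) * p\<^sup>2"

lemma prob_no_cell_le:
  fixes z :: "int ^ 'n::finite" and p :: real and R G :: nat
  assumes p: "0 \<le> p" "p \<le> 1"
  defines "bad \<equiv> {\<omega> \<in> space iid. \<not> (\<exists>y. \<omega> y < p \<and> sup_dist z y \<le> R \<and>
    (\<forall>y'. \<omega> y' < p \<longrightarrow> y' \<noteq> y \<longrightarrow> sup_dist z y + G \<le> sup_dist z y'))}"
  assumes "bad \<in> sets iid"
  shows "iid.prob bad \<le> miss_bound CARD('n) R G p"
proof -
  define shell where "shell y = {y'. sup_dist z y \<le> sup_dist z y' \<and> sup_dist z y' < sup_dist z y + G}" for y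
  define none where "none = {\<omega> \<in> space (iid :: (int ^ 'n \<Rightarrow> real) measure). \<forall>y\<in>cube z R. \<not> \<omega> y < p}"
  define two where "two yy' = {\<omega> \<in> space (iid :: (int ^ 'n \<Rightarrow> real) measure). \<forall>y\<in>{fst yy', snd yy'}. \<omega> y < p}"
    for yy'
  define Y where "Y = (SIGMA y:cube z R. shell y - {y})"
  have fin_shell: "finite (shell y)" for y
    by (rule finite_subset[OF _ finite_cube[of z "sup_dist z y + G"]]) (auto simp: shell_def cube_def)
  then have finY: "finite Y" by (simp add: Y_def)
  have sub: "bad \<subseteq> none \<union> (\<Union>yy'\<in>Y. two yy')"
  proof
    fix \<omega> assume w: "\<omega> \<in> bad"
    show "\<omega> \<in> none \<union> (\<Union>yy'\<in>Y. two yy')"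
    proof (cases "\<omega> \<in> none")
      case False
      with w have "\<exists>y. y \<in> cube z R \<and> \<omega> y < p" by (auto simp: none_def bad_def)
      then obtain y where y: "y \<in> cube z R \<and> \<omega> y < p"
        and min: "\<And>y'. y' \<in> cube z R \<and> \<omega> y' < p \<Longrightarrow> sup_dist z y \<le> sup_dist z y'"
        using ex_has_least_nat[of "\<lambda>y. y \<in> cube z R \<and> \<omega> y < p" _ "sup_dist z"] by blast
      from w y obtain y' where y': "\<omega> y' < p" "y' \<noteq> y" "sup_dist z y' < sup_dist z y + G"
        unfolding bad_def cube_def by (auto simp: not_le)
      have "sup_dist z y \<le> sup_dist z y'"
        using min[of y'] y' y by (cases "sup_dist z y' \<le> R") (auto simp: cube_def)
      with y y' have "(y, y') \<in> Y" by (simp add: Y_def shell_def)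
      moreover have "\<omega> \<in> two (y, y')" using w y y' by (simp add: two_def bad_def)
      ultimately show ?thesis by blast
    qed simp
  qed
  have none: "none \<in> sets iid" and two: "two yy' \<in> sets iid" for yy'
    unfolding none_def two_def by (intro label_not_less_sets label_less_sets; simp)+
  have "real (card Y) = (\<Sum>y\<in>cube z R. real (card (shell y - {y})))"
    unfolding Y_def using fin_shell by (subst card_SigmaI) auto
  also have "\<dots> \<le> (\<Sum>y\<in>cube z R. real CARD('n) * (2 * real G) * (2 * real (R + G)) ^ (CARD('n) - 1))"
  proof (rule sum_mono)
    fix y assume "y \<in> cube z R"
    have "real (card (shell y - {y})) \<le> real (card (shell y))"
      using fin_shell by (intro of_nat_mono card_mono) auto
    also have "\<dots> \<le> real CARD('n) * (2 * real G) * (2 * real (R + G)) ^ (CARD('n) - 1)"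
      unfolding shell_def by (rule card_shell) (use \<open>y \<in> cube z R\<close> in \<open>simp add: cube_def\<close>)
    finally show "real (card (shell y - {y})) \<le> \<dots>" .
  qed
  finally have cardY: "real (card Y) \<le>
      real ((2 * R + 1) ^ CARD('n)) * (real CARD('n) * (2 * real G) * (2 * real (R + G)) ^ (CARD('n) - 1))"
    by (simp add: card_cube)
  have "iid.prob bad \<le> iid.prob (none \<union> (\<Union>yy'\<in>Y. two yy'))"
    using none two finY by (intro iid.finite_measure_mono sub sets.Un sets.finite_UN) auto
  also have "\<dots> \<le> iid.prob none + iid.prob (\<Union>yy'\<in>Y. two yy')"
    using none two finY by (intro measure_Un_le sets.finite_UN) auto
  also have "\<dots> \<le> iid.prob none + (\<Sum>yy'\<in>Y. iid.prob (two yy'))"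
    using two finY by (intro add_left_mono iid.finite_measure_subadditive_finite) auto
  also have "iid.prob none = (1 - p) ^ ((2 * R + 1) ^ CARD('n))"
    unfolding none_def using p by (simp add: prob_all_not_less card_cube)
  also have "(\<Sum>yy'\<in>Y. iid.prob (two yy')) = (\<Sum>yy'\<in>Y. p\<^sup>2)"
  proof (rule sum.cong)
    fix yy' assume "yy' \<in> Y"
    then have "fst yy' \<noteq> snd yy'" by (auto simp: Y_def)
    then show "iid.prob (two yy') = p\<^sup>2" unfolding two_def using p by (subst prob_all_less) (simp_all add: power2_eq_square)
  qed simp
  also have "\<dots> = real (card Y) * p\<^sup>2" by simp
  also have "\<dots> \<le> real ((2 * R + 1) ^ CARD('n)) *
      (real CARD('n) * (2 * real G) * (2 * real (R + G)) ^ (CARD('n) - 1)) * p\<^sup>2"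
    using cardY by (intro mult_right_mono) auto
  finally show ?thesis by (simp add: miss_bound_def)
qed

text \<open>With about \<open>T\<close> marked vertices per cube of radius \<open>R\<close>, the first term is at most \<open>exp (- T)\<close>, and the
  second one is of order \<open>T\<^sup>2 / R\<close>, because shells of bounded width are small compared to cubes.\<close>

lemma ex_radius_density:
  fixes \<epsilon> :: real
  assumes "0 < \<epsilon>"
  obtains R :: nat and p :: real where "0 \<le> p" "p \<le> 1" "miss_bound (Suc d) R G p \<le> \<epsilon>"
proof -
  define T where "T = max 0 (ln (2 / \<epsilon>))"
  define c where "c = real (Suc d) * (2 * real G) * 2 ^ d * T\<^sup>2"
  have c: "0 \<le> c" by (simp add: c_def T_def)
  obtain R :: nat where R: "real R \<ge> max (real G) (max T (2 * c / \<epsilon>))" using real_arch_simple by blast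
  define V where "V = (2 * real R + 1) ^ Suc d"
  have V: "2 * real R + 1 \<le> V" unfolding V_def by (rule self_le_power) auto
  define p where "p = T / V"
  have V_pos: "0 < V" using V by linarith
  have p: "0 \<le> p" "p \<le> 1" using V R V_pos by (auto simp: p_def T_def)
  have V_eq: "real ((2 * R + 1) ^ Suc d) = V"
    by (simp only: V_def of_nat_power of_nat_add of_nat_mult of_nat_1 of_nat_numeral)
  have "(1 - p) ^ ((2 * R + 1) ^ Suc d) \<le> exp (- p) ^ ((2 * R + 1) ^ Suc d)"
    using p exp_ge_add_one_self[of "- p"] by (intro power_mono) auto
  also have "\<dots> = exp (- T)"
    using V_pos by (simp only: exp_of_nat_mult[symmetric] V_eq) (simp add: p_def)
  also have "\<dots> \<le> exp (- ln (2 / \<epsilon>))" by (simp add: T_def)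
  also have "\<dots> = \<epsilon> / 2" using assms by (simp add: exp_minus)
  finally have 1: "(1 - p) ^ ((2 * R + 1) ^ Suc d) \<le> \<epsilon> / 2" .
  have "V * (real (Suc d) * (2 * real G) * (2 * real (R + G)) ^ d) * p\<^sup>2
      = real (Suc d) * (2 * real G) * T\<^sup>2 * ((2 * real (R + G)) ^ d / V)"
    using V_pos by (simp add: p_def power2_eq_square)
  also have "\<dots> \<le> real (Suc d) * (2 * real G) * T\<^sup>2 * ((2 * (2 * real R + 1)) ^ d / V)"
    using R V_pos by (intro mult_left_mono divide_right_mono power_mono) auto
  also have "(2 * (2 * real R + 1)) ^ d / V = 2 ^ d / (2 * real R + 1)"
    unfolding V_def power_mult_distrib by simp
  also have "real (Suc d) * (2 * real G) * T\<^sup>2 * (2 ^ d / (2 * real R + 1)) = c / (2 * real R + 1)"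
    by (simp add: c_def)
  also have "\<dots> \<le> \<epsilon> / 2"
  proof -
    have "2 * c / \<epsilon> \<le> 2 * real R + 1" using R by simp
    then show ?thesis using assms by (simp add: field_simps)
  qed
  finally have 2: "V * (real (Suc d) * (2 * real G) * (2 * real (R + G)) ^ d) * p\<^sup>2 \<le> \<epsilon> / 2" .
  show ?thesis using 1 2 p by (intro that[of p R]) (simp_all only: V_eq miss_bound_def diff_Suc_1)
qed

section \<open>The factor of iid\<close>

context toast_decoration begin

text \<open>A vertex that is in no cell from some level on has been missed at arbitrarily high levels, which has
  arbitrarily small probability.\<close>

lemma AE_domain:
  assumes bound: "\<And>n z. iid.prob {\<omega> \<in> space iid. \<not> (\<exists>y\<in>marked \<omega> n. z \<in> cell (marked \<omega>) n y)} \<le> 1 / real (Suc n)"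
  shows "AE \<omega> in iid. \<omega> \<in> domain"
proof -
  have "AE \<omega> in iid. \<exists>n. m \<le> n \<and> (\<exists>y\<in>marked \<omega> n. z \<in> cell (marked \<omega>) n y)" for z m
  proof -
    let ?bad = "\<lambda>n. {\<omega> \<in> space iid. \<not> (\<exists>y\<in>marked \<omega> n. z \<in> cell (marked \<omega>) n y)}"
    define B where "B = {\<omega> \<in> space iid. \<not> (\<exists>n. m \<le> n \<and> (\<exists>y\<in>marked \<omega> n. z \<in> cell (marked \<omega>) n y))}"
    have bad: "?bad n \<in> sets iid" for n by (rule sets.sets_Collect_neg[OF covered_sets])
    have B: "B \<in> sets iid"
      unfolding B_def by (intro sets.sets_Collect_neg sets.sets_Collect_countable_Ex sets.sets_Collect_conj
        sets.sets_Collect_const covered_sets)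
    have le: "iid.prob B \<le> 1 / real (Suc n)" for n
    proof -
      have "iid.prob B \<le> iid.prob (?bad (max m n))"
        by (intro iid.finite_measure_mono bad) (auto simp: B_def)
      also have "\<dots> \<le> 1 / real (Suc (max m n))" by (rule bound)
      also have "\<dots> \<le> 1 / real (Suc n)" by (intro divide_left_mono) auto
      finally show ?thesis .
    qed
    have "iid.prob B = 0"
    proof (rule ccontr)
      assume "iid.prob B \<noteq> 0"
      then have "0 < iid.prob B" by (simp add: zero_less_measure_iff)
      then obtain n where "1 / real (Suc n) < iid.prob B" using nat_approx_posE by blast
      with le[of n] show False by simp
    qed
    then have "emeasure iid B = 0" by (simp add: iid.emeasure_eq_measure)
    from this B show ?thesis by (rule AE_I[rotated]) (unfold B_def, rule order_refl)
  qed
  then have "AE \<omega> in iid. \<forall>z m. \<exists>n. m \<le> n \<and> (\<exists>y\<in>marked \<omega> n. z \<in> cell (marked \<omega>) n y)"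
    by (simp only: AE_all_countable) blast
  moreover have "AE \<omega> in iid. \<forall>u v. u \<noteq> v \<longrightarrow> \<omega> u \<noteq> (\<omega> (v :: int ^ 'n) :: real)"
    unfolding AE_all_countable
  proof (intro allI)
    fix u v :: "int ^ 'n"
    show "AE \<omega> in iid. u \<noteq> v \<longrightarrow> \<omega> u \<noteq> (\<omega> v :: real)"
      using AE_labels_distinct[of u v] by (cases "u = v") simp_all
  qed
  ultimately show ?thesis
    using AE_space
  proof eventually_elim
    case (elim \<omega>)
    then have "inj \<omega>" unfolding inj_def by blast
    with elim show ?case by (simp add: domain_def covers_def)
  qed
qed

lemma decoration_factor:
  assumes "AE \<omega> in iid. \<omega> \<in> domain"
  shows "aut_factor_of_iid grid_edges CARD('n) domain (\<lambda>\<omega>. factor \<omega>)"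
    and "finitary grid_edges domain (\<lambda>\<omega>. factor \<omega>)"
    and "AE \<omega> in iid. schreier_decoration grid_edges CARD('n) (factor \<omega>)"
    and "AE \<omega> in iid. \<not> (\<exists>p. infinite_monochromatic_path grid_edges (factor \<omega>) p)"
proof -
  have "act_decoration grid_edges \<gamma> (factor \<omega>) =
      factor (act_labels \<gamma> \<omega>)" if "\<gamma> \<in> grid_aut" "\<omega> \<in> domain" for \<gamma> \<omega>
    using that by (intro act_decoration_decoration) (auto simp: domain_def)
  then show "aut_factor_of_iid grid_edges CARD('n) domain (\<lambda>\<omega>. factor \<omega>)"
    using assms domain_sets decoration_measurable act_labels_domain by (simp add: aut_factor_of_iid_def)
  show "finitary grid_edges domain (\<lambda>\<omega>. factor \<omega>)"
    unfolding finitary_def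
  proof
    fix x
    show "AE \<omega> in iid. \<exists>R. \<forall>\<omega>'\<in>domain. (\<forall>y\<in>graph_ball grid_edges x R. \<omega>' y = \<omega> y) \<longrightarrow>
      (\<forall>e\<in>grid_edges. x \<in> e \<longrightarrow> restrict (decoration \<omega>') grid_edges e = factor \<omega> e)"
      using assms
    proof eventually_elim
      case (elim \<omega>)
      from decoration_finitary_at[OF elim, of x] show ?case by simp
    qed
  qed
  show "AE \<omega> in iid. schreier_decoration grid_edges CARD('n) (factor \<omega>)"
    using assms by eventually_elim (rule schreier_decoration_decoration)
  show "AE \<omega> in iid. \<not> (\<exists>p. infinite_monochromatic_path grid_edges (factor \<omega>) p)"
    using assms
  proof eventually_elim
    case (elim \<omega>)
    then show ?case using no_infinite_monochromatic_path[of \<omega>] by (auto simp: domain_def)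
  qed
qed

end

theorem theorem1p2:
  assumes "CARD('n::finite) \<ge> 3"
  shows "\<exists>\<Omega> (\<Phi> :: (int ^ 'n \<Rightarrow> real) \<Rightarrow> (int ^ 'n) decoration).
           aut_factor_of_iid grid_edges CARD('n) \<Omega> \<Phi> \<and>
           finitary grid_edges \<Omega> \<Phi> \<and>
           (AE \<omega> in iid. schreier_decoration grid_edges CARD('n) (\<Phi> \<omega>)) \<and>
           (AE \<omega> in iid. \<not> (\<exists>p. infinite_monochromatic_path grid_edges (\<Phi> \<omega>) p))"
proof -
  have "CARD('n) \<ge> 2" using assms by simp
  then obtain \<psi> :: "'n labelling" and r where layer: "transition_layer \<psi> r"
    by (rule ex_transition_layer)
  define s where "s = 2 * r + 10"
  have "\<forall>G n. \<exists>R p. 0 \<le> p \<and> p \<le> 1 \<and> miss_bound CARD('n) R G p \<le> 1 / real (Suc n)"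
  proof (intro allI)
    fix G n
    have d: "CARD('n) = Suc (CARD('n) - 1)" using assms by simp
    obtain R :: nat and p :: real where "0 \<le> p" "p \<le> 1" "miss_bound CARD('n) R G p \<le> 1 / real (Suc n)"
      by (rule ex_radius_density[of "1 / real (Suc n)" "CARD('n) - 1" G, folded d]) simp_all
    then show "\<exists>R p. 0 \<le> p \<and> p \<le> 1 \<and> miss_bound CARD('n) R G p \<le> 1 / real (Suc n)" by blast
  qed
  then obtain R0 :: "nat \<Rightarrow> nat \<Rightarrow> nat" and p0 :: "nat \<Rightarrow> nat \<Rightarrow> real"
    where p0: "\<And>G n. 0 \<le> p0 G n" "\<And>G n. p0 G n \<le> 1"
      and bound: "\<And>G n. miss_bound CARD('n) (R0 G n) G (p0 G n) \<le> 1 / real (Suc n)"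
    unfolding choice_iff by blast
  \<comment> \<open>The extent of the clusters of lower levels dictates the gap between the cells of level \<open>n\<close>, which
    in turn dictates how large and sparse these have to be.\<close>
  define E where "E = rec_nat 0 (\<lambda>n e. 4 * e + 2 * R0 (3 * e + 15 * s) n + 14 * s)"
  define G where "G n = 3 * E n + 15 * s" for n
  define R where "R n = R0 (G n) n" for n
  define \<theta> where "\<theta> n = p0 (G n) n" for n
  interpret transition_layer \<psi> r by (rule layer)
  interpret toast_decoration \<psi> r R G E s \<theta>
    by unfold_locales (simp_all add: s_def G_def R_def E_def)
  have "iid.prob {\<omega> \<in> space iid. \<not> (\<exists>y\<in>marked \<omega> n. z \<in> cell (marked \<omega>) n y)} \<le> 1 / real (Suc n)" for n z
  proof -
    have eq: "{\<omega> \<in> space iid. \<not> (\<exists>y\<in>marked \<omega> n. z \<in> cell (marked \<omega>) n y)} =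
      {\<omega> \<in> space iid. \<not> (\<exists>y. \<omega> y < \<theta> n \<and> sup_dist z y \<le> R n \<and>
        (\<forall>y'. \<omega> y' < \<theta> n \<longrightarrow> y' \<noteq> y \<longrightarrow> sup_dist z y + G n \<le> sup_dist z y'))}"
      by (simp add: marked_def cell_def)
    have "{\<omega> \<in> space iid. \<not> (\<exists>y\<in>marked \<omega> n. z \<in> cell (marked \<omega>) n y)} \<in> sets iid"
      by (rule sets.sets_Collect_neg[OF covered_sets])
    then have "iid.prob {\<omega> \<in> space iid. \<not> (\<exists>y\<in>marked \<omega> n. z \<in> cell (marked \<omega>) n y)} \<le>
      miss_bound CARD('n) (R n) (G n) (\<theta> n)"
      unfolding eq by (intro prob_no_cell_le) (simp_all add: \<theta>_def p0)
    also have "\<dots> \<le> 1 / real (Suc n)" unfolding \<theta>_def R_def by (rule bound)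
    finally show ?thesis .
  qed
  then have "AE \<omega> in iid. \<omega> \<in> domain" by (rule AE_domain)
  from decoration_factor[OF this] show ?thesis by blast
qed

end
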